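(* Suppose $n \geq 2$, $0<\alpha\le n/2$, and $S$ is a smooth compact hypersurface in $\mathbb{R}^n$ with a nowhere vanishing Gaussian curvature. Then to every $\epsilon > 0$ there is a constant $C_\epsilon$ (independent of $R$, $X$, $\gamma$ and $f$) such that the following holds. Let $R \geq 1$, let $X= \bigcup_k \widetilde{B}_k$ be a union of lattice unit cubes in $\widetilde{B}(0,R) \subset \mathbb{R}^n$, and let $$\gamma = \sup \frac{\#\{ \widetilde{B}_k : \widetilde{B}_k \subset \widetilde{B}(x',r) \}}{r^\alpha},$$ where the sup is taken over all pairs $(x',r) \in \mathbb{R}^n \times [1,\infty)$ satisfying $\widetilde{B}(x',r) \subset \widetilde{B}(0,R)$. Then $$\| E f \|_{L^2(X)} \leq C_\epsilon R^\epsilon \gamma^{1/2} R^{e(\alpha)} \| f \|_{L^2(S)}$$ for all $f \in L^2(S)$, where $$e(\alpha)= \left\{ \begin{array}{ll} 0 & \text{ if } 0 < \alpha \leq (n-1)/2, \\ \frac{\alpha}{2}-\frac{n-1}{4} & \text{ if } (n-1)/2 < \alpha \leq n/2. \end{array} \right.$$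
   Context: $\widetilde{B}(x,r)$ denotes the (axis-parallel) cube in $\mathbb{R}^n$ of center $x$ and side-length $r$. Lattice unit cubes are the cubes of the standard lattice tiling of $\mathbb{R}^n$ by unit cubes. $\sigma$ denotes the surface area measure on $S$, $L^p(S)=L^p(\sigma)$, and the extension operator $E=E_S$ is $$Ef(x) = \widehat{f d\sigma}(x)=\int_S e^{-2 \pi i x \cdot \xi} f(\xi)\, d\sigma(\xi), \qquad f \in L^1(S).$$ *)

theory Defs
  imports "HOL-Analysis.Analysis"
begin

section \<open>Hausdorff measure\<close>

text \<open>The weight of a covering set is the volume of the \<open>d\<close>-dimensional ball of the same diameter,
  so that in \<open>d\<close>-dimensional Euclidean space the \<open>d\<close>-dimensional Hausdorff measure is Lebesgue
  measure, and on a \<open>d\<close>-dimensional submanifold it is the surface area.\<close>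

definition hausdorff_weight :: "nat \<Rightarrow> 'a::metric_space set \<Rightarrow> ennreal" where
  "hausdorff_weight d C =
    (if C = {} then 0 else ennreal (unit_ball_vol (real d) * (diameter C / 2) ^ d))"

definition hausdorff_content :: "nat \<Rightarrow> real \<Rightarrow> 'a::metric_space set \<Rightarrow> ennreal" where
  "hausdorff_content d \<delta> A =
    (INF C \<in> {C :: nat \<Rightarrow> 'a set. A \<subseteq> (\<Union>i. C i) \<and> (\<forall>i. bounded (C i) \<and> diameter (C i) \<le> \<delta>)}.
       \<Sum>i. hausdorff_weight d (C i))"

definition hausdorff_outer_measure :: "nat \<Rightarrow> 'a::metric_space set \<Rightarrow> ennreal" where
  "hausdorff_outer_measure d A = (SUP \<delta>\<in>{0<..}. hausdorff_content d \<delta> A)"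

definition hausdorff_measure :: "nat \<Rightarrow> 'a::metric_space measure" where
  "hausdorff_measure d = measure_of UNIV (sets borel) (hausdorff_outer_measure d)"

text \<open>Since \<open>measure_of\<close> yields the null measure when the given set function is not countably
  additive, the rest of this section establishes countable additivity on the Borel sets
  (\<open>emeasure_hausdorff_measure\<close> below).\<close>

lemma hausdorff_weight_empty [simp]: "hausdorff_weight d {} = 0"
  by (simp add: hausdorff_weight_def)

lemma hausdorff_content_mono: "A \<subseteq> B \<Longrightarrow> hausdorff_content d \<delta> A \<le> hausdorff_content d \<delta> B"
  unfolding hausdorff_content_def by (rule INF_superset_mono) auto

lemma hausdorff_content_antimono:
  "\<delta> \<le> \<delta>' \<Longrightarrow> hausdorff_content d \<delta>' A \<le> hausdorff_content d \<delta> A"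
  unfolding hausdorff_content_def by (rule INF_superset_mono) (auto intro: order_trans)

lemma hausdorff_content_empty: "0 < \<delta> \<Longrightarrow> hausdorff_content d \<delta> {} = 0"
  unfolding hausdorff_content_def
  by (intro antisym INF_lower2[of "\<lambda>_. {}"]) auto

lemma hausdorff_content_countably_subadditive:
  "hausdorff_content d \<delta> (\<Union>i. A i) \<le> (\<Sum>n. hausdorff_content d \<delta> (A (n::nat)))"
proof (rule ennreal_le_epsilon)
  fix e :: real
  assume e: "0 < e" and fin: "(\<Sum>n. hausdorff_content d \<delta> (A n)) < top"
  let ?O = "hausdorff_content d \<delta>"
  have lt: "?O (A n) < ?O (A n) + e * (1/2)^Suc n" for n
    using fin e by (auto simp add: less_top dest!: ennreal_suminf_lessD)
  have "\<exists>B. A n \<subseteq> (\<Union>i. B i) \<and> (\<forall>i::nat. bounded (B i) \<and> diameter (B i) \<le> \<delta>) \<and>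
          (\<Sum>i. hausdorff_weight d (B i)) \<le> ?O (A n) + e * (1/2)^Suc n" for n
    using lt[of n] unfolding hausdorff_content_def[of d \<delta> "A n"] INF_less_iff
    by (auto intro: less_imp_le)
  then obtain B :: "nat \<Rightarrow> nat \<Rightarrow> 'a set" where B: "\<And>n. A n \<subseteq> (\<Union>i. B n i)"
      "\<And>n i. bounded (B n i)" "\<And>n i. diameter (B n i) \<le> \<delta>"
      "\<And>n. (\<Sum>i. hausdorff_weight d (B n i)) \<le> ?O (A n) + e * (1/2)^Suc n"
    by metis
  define C where "C = case_prod B o prod_decode"
  have "(\<Union>i. A i) \<subseteq> (\<Union>i. C i)"
    using B(1) by (auto simp add: C_def subset_eq) (metis prod.case prod_encode_inverse)
  then have "?O (\<Union>i. A i) \<le> (\<Sum>i. hausdorff_weight d (C i))"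
    unfolding hausdorff_content_def
    by (intro INF_lower) (auto simp: C_def B split: prod.split)
  also have "\<dots> = (\<Sum>n. \<Sum>i. hausdorff_weight d (B n i))"
    using suminf_ennreal_2dimen[of "\<lambda>n. \<Sum>i. hausdorff_weight d (B n i)"
        "\<lambda>p. hausdorff_weight d (case_prod B p)"]
    by (simp add: C_def)
  also have "\<dots> \<le> (\<Sum>n. ?O (A n) + e * (1/2) ^ Suc n)"
    by (intro suminf_le B allI) auto
  also have "... = (\<Sum>n. ?O (A n)) + (\<Sum>n. ennreal e * ennreal ((1/2) ^ Suc n))"
    using e by (subst suminf_add[symmetric])
      (auto simp del: ennreal_suminf_cmult simp add: ennreal_mult[symmetric])
  also have "... = (\<Sum>n. ?O (A n)) + e"
    unfolding ennreal_suminf_cmult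
    by (subst suminf_ennreal_eq[OF zero_le_power power_half_series]) auto
  finally show "?O (\<Union>i. A i) \<le> (\<Sum>n. ?O (A n)) + e" .
qed

lemma hausdorff_content_separated:
  assumes sep: "\<And>x y. x \<in> A \<Longrightarrow> y \<in> B \<Longrightarrow> \<eta> \<le> dist x y" and "\<delta> < \<eta>"
  shows "hausdorff_content d \<delta> A + hausdorff_content d \<delta> B \<le> hausdorff_content d \<delta> (A \<union> B)"
  unfolding hausdorff_content_def[of d \<delta> "A \<union> B"]
proof (rule INF_greatest, clarify)
  fix C :: "nat \<Rightarrow> 'a set"
  assume cov: "A \<union> B \<subseteq> (\<Union>i. C i)" and C: "\<forall>i. bounded (C i) \<and> diameter (C i) \<le> \<delta>"
  define P where "P = (\<lambda>D i. if C i \<inter> D = {} then {} else C i)"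
  have small: "bounded (P D i) \<and> diameter (P D i) \<le> \<delta>" for D i
  proof -
    have "0 \<le> diameter (C i)" using C by (simp add: diameter_ge_0)
    with C have "0 \<le> \<delta>" using order_trans by blast
    with C show ?thesis by (auto simp: P_def)
  qed
  have le: "hausdorff_content d \<delta> D \<le> (\<Sum>i. hausdorff_weight d (P D i))"
    if "D \<subseteq> (\<Union>i. C i)" for D
    unfolding hausdorff_content_def using that small
    by (intro INF_lower) (fastforce simp: P_def)
  have "C i \<inter> A = {} \<or> C i \<inter> B = {}" for i
  proof (rule ccontr)
    assume "\<not> ?thesis"
    then obtain x y where xy: "x \<in> C i" "x \<in> A" "y \<in> C i" "y \<in> B" by blast
    have "dist x y \<le> \<delta>"
      using C diameter_bounded_bound[of "C i" x y] xy order_trans by blast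
    with sep[of x y] xy \<open>\<delta> < \<eta>\<close> show False by auto
  qed
  then have w: "hausdorff_weight d (P A i) + hausdorff_weight d (P B i) \<le> hausdorff_weight d (C i)"
    for i by (cases "C i \<inter> A = {}") (auto simp: P_def)
  have "hausdorff_content d \<delta> A + hausdorff_content d \<delta> B
      \<le> (\<Sum>i. hausdorff_weight d (P A i)) + (\<Sum>i. hausdorff_weight d (P B i))"
    using cov by (intro add_mono le) auto
  also have "\<dots> = (\<Sum>i. hausdorff_weight d (P A i) + hausdorff_weight d (P B i))"
    by (rule suminf_add) auto
  also have "\<dots> \<le> (\<Sum>i. hausdorff_weight d (C i))"
    by (intro suminf_le w) auto
  finally show "hausdorff_content d \<delta> A + hausdorff_content d \<delta> B \<le> (\<Sum>i. hausdorff_weight d (C i))" .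
qed

lemma hausdorff_outer_measure_mono:
  "A \<subseteq> B \<Longrightarrow> hausdorff_outer_measure d A \<le> hausdorff_outer_measure d B"
  unfolding hausdorff_outer_measure_def by (intro SUP_mono) (auto intro: hausdorff_content_mono)

lemma hausdorff_outer_measure_empty [simp]: "hausdorff_outer_measure d {} = 0"
proof -
  have "hausdorff_outer_measure d {} \<le> 0"
    unfolding hausdorff_outer_measure_def by (intro SUP_least) (simp add: hausdorff_content_empty)
  then show ?thesis by simp
qed

lemma hausdorff_outer_measure_countably_subadditive:
  "hausdorff_outer_measure d (\<Union>i. A i) \<le> (\<Sum>n. hausdorff_outer_measure d (A (n::nat)))"
  unfolding hausdorff_outer_measure_def[of d "\<Union>i. A i"]
proof (rule SUP_least)
  fix \<delta> :: real assume "\<delta> \<in> {0<..}"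
  then have "hausdorff_content d \<delta> (A n) \<le> hausdorff_outer_measure d (A n)" for n
    unfolding hausdorff_outer_measure_def by (rule SUP_upper)
  then have "(\<Sum>n. hausdorff_content d \<delta> (A n)) \<le> (\<Sum>n. hausdorff_outer_measure d (A n))"
    by (intro suminf_le) auto
  with hausdorff_content_countably_subadditive
  show "hausdorff_content d \<delta> (\<Union>i. A i) \<le> (\<Sum>n. hausdorff_outer_measure d (A n))"
    using order_trans by blast
qed

lemma outer_measure_space_hausdorff:
  "outer_measure_space UNIV (hausdorff_outer_measure d)"
  unfolding outer_measure_space_def positive_def increasing_def countably_subadditive_def
  by (auto intro: hausdorff_outer_measure_mono hausdorff_outer_measure_countably_subadditive)

lemma hausdorff_outer_measure_Un:
  "hausdorff_outer_measure d (A \<union> B) \<le> hausdorff_outer_measure d A + hausdorff_outer_measure d B"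
proof -
  have "countably_subadditive UNIV (hausdorff_outer_measure d)" "positive UNIV (hausdorff_outer_measure d)"
    using outer_measure_space_hausdorff by (auto simp: outer_measure_space_def)
  then have "subadditive UNIV (hausdorff_outer_measure d)"
    using ring_of_sets.countably_subadditive_subadditive[OF ring_of_sets_Pow, of UNIV] by simp
  then have "hausdorff_outer_measure d (A \<union> (B - A))
      \<le> hausdorff_outer_measure d A + hausdorff_outer_measure d (B - A)"
    by (intro subadditiveD) auto
  also have "\<dots> \<le> hausdorff_outer_measure d A + hausdorff_outer_measure d B"
    by (intro add_left_mono hausdorff_outer_measure_mono) auto
  finally show ?thesis by simp
qed

lemma hausdorff_outer_measure_separated:
  assumes sep: "\<And>x y. x \<in> A \<Longrightarrow> y \<in> B \<Longrightarrow> \<eta> \<le> dist x y" and "0 < \<eta>"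
  shows "hausdorff_outer_measure d A + hausdorff_outer_measure d B \<le> hausdorff_outer_measure d (A \<union> B)"
proof -
  have *: "hausdorff_content d \<delta>1 A + hausdorff_content d \<delta>2 B \<le> hausdorff_outer_measure d (A \<union> B)"
    if "0 < \<delta>1" "0 < \<delta>2" for \<delta>1 \<delta>2
  proof -
    define \<delta> where "\<delta> = min (min \<delta>1 \<delta>2) (\<eta>/2)"
    have \<delta>: "0 < \<delta>" "\<delta> < \<eta>" "\<delta> \<le> \<delta>1" "\<delta> \<le> \<delta>2" using that \<open>0 < \<eta>\<close> by (auto simp: \<delta>_def)
    have "hausdorff_content d \<delta>1 A + hausdorff_content d \<delta>2 B
        \<le> hausdorff_content d \<delta> A + hausdorff_content d \<delta> B"
      by (intro add_mono hausdorff_content_antimono \<delta>)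
    also have "\<dots> \<le> hausdorff_content d \<delta> (A \<union> B)"
      using sep \<delta> by (intro hausdorff_content_separated) auto
    also have "\<dots> \<le> hausdorff_outer_measure d (A \<union> B)"
      unfolding hausdorff_outer_measure_def using \<delta> by (intro SUP_upper) auto
    finally show ?thesis .
  qed
  have ne: "{0<..} \<noteq> ({}::real set)" using greaterThan_non_empty by blast
  have "hausdorff_content d \<delta>1 A + hausdorff_outer_measure d B \<le> hausdorff_outer_measure d (A \<union> B)"
    if "0 < \<delta>1" for \<delta>1
    unfolding hausdorff_outer_measure_def[of d B] ennreal_SUP_add_right[OF ne]
    using * that by (intro SUP_least) auto
  then show ?thesis
    unfolding hausdorff_outer_measure_def[of d A] ennreal_SUP_add_left[OF ne, symmetric]
    by (intro SUP_least) auto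
qed

lemma closed_in_lambda_system_hausdorff:
  fixes F :: "'a::metric_space set"
  assumes "closed F"
  shows "F \<in> lambda_system UNIV UNIV (hausdorff_outer_measure d)"
proof -
  let ?\<mu> = "hausdorff_outer_measure d :: 'a set \<Rightarrow> ennreal"
  have main: "?\<mu> (A \<inter> F) + ?\<mu> (A - F) \<le> ?\<mu> A" for A
  proof (cases "?\<mu> A = top")
    case False
    define G where "G = (\<lambda>n::nat. {x\<in>A. \<forall>y\<in>F. 1 / real (Suc n) \<le> dist x y})"
    define T where "T = (\<lambda>n. G (Suc n) - G n)"
    have G_mono: "G m \<subseteq> G n" if "m \<le> n" for m n
    proof -
      have "1 / real (Suc n) \<le> 1 / real (Suc m)" using that by (intro divide_left_mono) auto
      then show ?thesis by (force simp: G_def)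
    qed
    have sep: "1 / real (Suc m) - 1 / real (Suc (Suc m)) \<le> dist x z"
      if x: "x \<in> G m" and z: "z \<in> A - G (Suc m)" for x z m
    proof -
      obtain y where y: "y \<in> F" "dist z y < 1 / real (Suc (Suc m))"
        using z unfolding G_def by auto
      have "1 / real (Suc m) \<le> dist x y" using x y(1) unfolding G_def by auto
      with y(2) dist_triangle[of x y z] show ?thesis by linarith
    qed
    have pos: "0 < 1 / real (Suc m) - 1 / real (Suc (Suc m))" for m
      using frac_less2[of 1 1 "real (Suc m)" "real (Suc (Suc m))"] by simp
    have superadd: "(\<Sum>k<n. ?\<mu> (T (2 * k + i))) \<le> ?\<mu> (\<Union>k<n. T (2 * k + i))" for n i
    proof (induction n)
      case (Suc n)
      have "(\<Sum>k<Suc n. ?\<mu> (T (2 * k + i))) \<le> ?\<mu> (\<Union>k<n. T (2 * k + i)) + ?\<mu> (T (2 * n + i))"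
        using Suc.IH by (simp add: add_right_mono)
      also have "\<dots> \<le> ?\<mu> ((\<Union>k<n. T (2 * k + i)) \<union> T (2 * n + i))"
      proof (cases n)
        case (Suc m)
        show ?thesis
        proof (rule hausdorff_outer_measure_separated[OF sep pos, where m1 = "2 * m + i + 1"])
          fix x z assume x: "x \<in> (\<Union>k<n. T (2 * k + i))" and z: "z \<in> T (2 * n + i)"
          from x obtain k where "k < n" "x \<in> G (Suc (2 * k + i))" by (auto simp: T_def)
          then show "x \<in> G (2 * m + i + 1)"
            using G_mono[of "Suc (2 * k + i)" "2 * m + i + 1"] Suc by auto
          show "z \<in> A - G (Suc (2 * m + i + 1))"
            using z Suc by (auto simp: T_def G_def)
        qed
      qed simp
      also have "(\<Union>k<n. T (2 * k + i)) \<union> T (2 * n + i) = (\<Union>k<Suc n. T (2 * k + i))"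
        by (auto simp: less_Suc_eq)
      finally show ?case .
    qed simp
    have T_le: "(\<Sum>k. ?\<mu> (T (2 * k + i))) \<le> ?\<mu> A" for i
    proof (rule suminf_le_const)
      show "(\<Sum>k<n. ?\<mu> (T (2 * k + i))) \<le> ?\<mu> A" for n
        by (rule order_trans[OF superadd hausdorff_outer_measure_mono]) (auto simp: T_def G_def)
    qed auto
    have split: "(\<Sum>k<n. ?\<mu> (T k)) \<le> (\<Sum>k<n. ?\<mu> (T (2 * k))) + (\<Sum>k<n. ?\<mu> (T (2 * k + 1)))" for n
    proof -
      have "(\<Sum>k<n. ?\<mu> (T k)) \<le> (\<Sum>k<2 * n. ?\<mu> (T k))"
        by (intro sum_mono2) auto
      also have "\<dots> = (\<Sum>k<n. ?\<mu> (T (2 * k))) + (\<Sum>k<n. ?\<mu> (T (2 * k + 1)))"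
        by (induction n) (auto simp: algebra_simps)
      finally show ?thesis .
    qed
    have "(\<Sum>k. ?\<mu> (T k)) \<le> ?\<mu> A + ?\<mu> A"
    proof (rule suminf_le_const)
      fix n
      have "(\<Sum>k<n. ?\<mu> (T (2 * k))) \<le> ?\<mu> A" "(\<Sum>k<n. ?\<mu> (T (2 * k + 1))) \<le> ?\<mu> A"
        using order_trans[OF sum_le_suminf T_le[of 0]] order_trans[OF sum_le_suminf T_le[of 1]]
        by simp_all
      then show "(\<Sum>k<n. ?\<mu> (T k)) \<le> ?\<mu> A + ?\<mu> A"
        using split[of n] by (meson add_mono order_trans)
    qed auto
    also have "\<dots> < top" using False by (simp add: less_top)
    finally have fin: "(\<Sum>k. ?\<mu> (T k)) \<noteq> top" by simp
    have bound: "?\<mu> (A \<inter> F) + ?\<mu> (A - F) \<le> ?\<mu> A + (\<Sum>k. ?\<mu> (T (k + n)))" for n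
    proof -
      have "A - F \<subseteq> G n \<union> (\<Union>k. T (k + n))"
      proof
        fix x assume x: "x \<in> A - F"
        obtain e where e: "0 < e" "\<forall>y. dist y x < e \<longrightarrow> y \<in> - F"
          using \<open>closed F\<close> x by (metis ComplI DiffE closed_def open_dist)
        obtain m where "inverse (real (Suc m)) < e" using reals_Archimedean e(1) by blast
        then have "x \<in> G m" using e x
          by (force simp: G_def dist_commute inverse_eq_divide)
        then have "x \<in> G (n + m)" using G_mono[of m "n + m"] by auto
        then show "x \<in> G n \<union> (\<Union>k. T (k + n))"
        proof (induction m)
          case (Suc m)
          then show ?case by (cases "x \<in> G (n + m)") (auto simp: T_def add.commute)
        qed simp
      qed
      then have "?\<mu> (A - F) \<le> ?\<mu> (G n \<union> (\<Union>k. T (k + n)))"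
        by (rule hausdorff_outer_measure_mono)
      also have "\<dots> \<le> ?\<mu> (G n) + ?\<mu> (\<Union>k. T (k + n))"
        by (rule hausdorff_outer_measure_Un)
      also have "\<dots> \<le> ?\<mu> (G n) + (\<Sum>k. ?\<mu> (T (k + n)))"
        by (intro add_left_mono hausdorff_outer_measure_countably_subadditive)
      finally have "?\<mu> (A \<inter> F) + ?\<mu> (A - F) \<le> (?\<mu> (A \<inter> F) + ?\<mu> (G n)) + (\<Sum>k. ?\<mu> (T (k + n)))"
        by (simp add: add.assoc add_left_mono)
      also have "?\<mu> (A \<inter> F) + ?\<mu> (G n) \<le> ?\<mu> ((A \<inter> F) \<union> G n)"
      proof (rule hausdorff_outer_measure_separated)
        show "1 / real (Suc n) \<le> dist x y" if "x \<in> A \<inter> F" "y \<in> G n" for x y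
          using that by (auto simp: G_def dist_commute)
      qed simp
      also have "?\<mu> ((A \<inter> F) \<union> G n) \<le> ?\<mu> A"
        by (rule hausdorff_outer_measure_mono) (auto simp: G_def)
      finally show ?thesis by (simp add: add_right_mono)
    qed
    have "(?\<mu> (A \<inter> F) + ?\<mu> (A - F)) + (\<Sum>k<n. ?\<mu> (T k)) \<le> ?\<mu> A + (\<Sum>k. ?\<mu> (T k))" for n
      using add_right_mono[OF bound[of n], of "\<Sum>k<n. ?\<mu> (T k)"]
        suminf_offset[of "\<lambda>k. ?\<mu> (T k)" n] by (simp add: add.assoc)
    moreover have "(\<lambda>n. (?\<mu> (A \<inter> F) + ?\<mu> (A - F)) + (\<Sum>k<n. ?\<mu> (T k)))
        \<longlonglongrightarrow> (?\<mu> (A \<inter> F) + ?\<mu> (A - F)) + (\<Sum>k. ?\<mu> (T k))"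
      by (intro tendsto_add tendsto_const summable_LIMSEQ summableI)
    ultimately have "(?\<mu> (A \<inter> F) + ?\<mu> (A - F)) + (\<Sum>k. ?\<mu> (T k)) \<le> ?\<mu> A + (\<Sum>k. ?\<mu> (T k))"
      by (intro LIMSEQ_le_const2) auto
    then show ?thesis
      using fin ennreal_add_left_cancel_le[of "\<Sum>k. ?\<mu> (T k)"] by (simp add: add.commute)
  qed simp
  have "?\<mu> A \<le> ?\<mu> (A \<inter> F) + ?\<mu> (A - F)" for A
    using hausdorff_outer_measure_Un[of d "A \<inter> F" "A - F"] by (simp add: Int_Diff_Un)
  with main have "?\<mu> (A \<inter> F) + ?\<mu> (A - F) = ?\<mu> A" for A
    using antisym by blast
  then show ?thesis
    using algebra.lambda_system_eq[of UNIV UNIV ?\<mu>] algebra_Pow[of "UNIV :: 'a set"] by simp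
qed

lemma measure_space_hausdorff:
  "measure_space UNIV (sets borel) (hausdorff_outer_measure d :: 'a::metric_space set \<Rightarrow> ennreal)"
proof -
  let ?L = "lambda_system UNIV UNIV (hausdorff_outer_measure d :: 'a set \<Rightarrow> ennreal)"
  have L: "measure_space UNIV ?L (hausdorff_outer_measure d)"
    using sigma_algebra.caratheodory_lemma[OF sigma_algebra_Pow[of "UNIV :: 'a set"],
        of "hausdorff_outer_measure d"] outer_measure_space_hausdorff[where 'a='a and d=d] by simp
  then interpret L: sigma_algebra UNIV ?L by (simp add: measure_space_def)
  have "sets (borel :: 'a measure) = sigma_sets UNIV {S. closed S}"
    by (subst borel_eq_closed) simp
  also have "\<dots> \<subseteq> ?L"
    by (intro L.sigma_sets_subset) (auto intro: closed_in_lambda_system_hausdorff)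
  finally have "sets (borel :: 'a measure) \<subseteq> ?L" .
  then show ?thesis
    using L sets.sigma_algebra_axioms[of "borel :: 'a measure"]
    unfolding measure_space_def positive_def countably_additive_def by (simp, blast)
qed

lemma sets_hausdorff_measure [simp, measurable_cong]: "sets (hausdorff_measure d) = sets borel"
  unfolding hausdorff_measure_def by (metis sets.sets_measure_of_eq space_borel)

lemma space_hausdorff_measure [simp]: "space (hausdorff_measure d) = UNIV"
  unfolding hausdorff_measure_def by (simp add: space_measure_of_conv)

lemma emeasure_hausdorff_measure:
  "A \<in> sets borel \<Longrightarrow> emeasure (hausdorff_measure d) A = hausdorff_outer_measure d A"
  using measure_space_hausdorff[of d]
  by (intro emeasure_measure_of[OF hausdorff_measure_def]) (auto simp: measure_space_def)


section \<open>Smooth hypersurfaces and Gaussian curvature\<close>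

primrec Ck_on :: "nat \<Rightarrow> 'a::real_normed_vector set \<Rightarrow> ('a \<Rightarrow> 'b::real_normed_vector) \<Rightarrow> bool" where
  "Ck_on 0 U f \<longleftrightarrow> continuous_on U f"
| "Ck_on (Suc k) U f \<longleftrightarrow>
     (\<forall>x\<in>U. f differentiable at x) \<and> (\<forall>v. Ck_on k U (\<lambda>x. frechet_derivative f (at x) v))"

definition smooth_on :: "'a::real_normed_vector set \<Rightarrow> ('a \<Rightarrow> 'b::real_normed_vector) \<Rightarrow> bool" where
  "smooth_on U f \<longleftrightarrow> (\<forall>k. Ck_on k U f)"

definition grad :: "('a::euclidean_space \<Rightarrow> real) \<Rightarrow> 'a \<Rightarrow> 'a" where
  "grad g x = (\<Sum>b\<in>Basis. frechet_derivative g (at x) b *\<^sub>R b)"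

text \<open>Near \<open>p\<close>, the set \<open>S\<close> is a smooth embedded hypersurface, possibly with boundary: it is the
  part of the regular level set \<open>g = 0\<close> where \<open>h \<ge> 0\<close>. The point \<open>p\<close> is a boundary point if
  \<open>h p = 0\<close>, and then \<open>h\<close> cuts the level set transversally; if \<open>h p > 0\<close> (for instance, \<open>h = 1\<close>)
  then \<open>S\<close> coincides with the level set near \<open>p\<close>.\<close>

definition local_defining_functions ::
    "'a::euclidean_space set \<Rightarrow> 'a \<Rightarrow> ('a \<Rightarrow> real) \<Rightarrow> ('a \<Rightarrow> real) \<Rightarrow> bool" where
  "local_defining_functions S p g h \<longleftrightarrow>
    (\<exists>U. open U \<and> p \<in> U \<and> smooth_on U g \<and> smooth_on U h \<and>
         S \<inter> U = {x \<in> U. g x = 0 \<and> 0 \<le> h x}) \<and>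
    grad g p \<noteq> 0 \<and>
    (h p = 0 \<longrightarrow> (\<forall>a b. a *\<^sub>R grad g p + b *\<^sub>R grad h p = 0 \<longrightarrow> a = 0 \<and> b = 0))"

definition smooth_hypersurface :: "'a::euclidean_space set \<Rightarrow> bool" where
  "smooth_hypersurface S \<longleftrightarrow> (\<forall>p\<in>S. \<exists>g h. local_defining_functions S p g h)"

definition unit_normal :: "('a::euclidean_space \<Rightarrow> real) \<Rightarrow> 'a \<Rightarrow> 'a" where
  "unit_normal g x = sgn (grad g x)"

definition shape_operator :: "('a::euclidean_space \<Rightarrow> real) \<Rightarrow> 'a \<Rightarrow> 'a \<Rightarrow> 'a" where
  "shape_operator g p v = - frechet_derivative (unit_normal g) (at p) v"

text \<open>The Gaussian curvature at \<open>p\<close> of the level set of \<open>g\<close> through \<open>p\<close>, with respect to the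
  orientation given by the gradient of \<open>g\<close>, is the determinant of the shape operator on the tangent
  space, i.e. on the orthogonal complement of the unit normal. To take this determinant in the
  ambient space, the operator is extended by the identity on the normal line.\<close>

definition gaussian_curvature :: "(real^'n \<Rightarrow> real) \<Rightarrow> real^'n \<Rightarrow> real" where
  "gaussian_curvature g p =
    (let \<nu> = unit_normal g p in
     det (matrix (\<lambda>v. shape_operator g p (v - (v \<bullet> \<nu>) *\<^sub>R \<nu>) + (v \<bullet> \<nu>) *\<^sub>R \<nu>)))"

text \<open>Two choices of the local defining functions give the same curvature up to sign.\<close>

definition nowhere_vanishing_gaussian_curvature :: "(real^'n) set \<Rightarrow> bool" where
  "nowhere_vanishing_gaussian_curvature S \<longleftrightarrow>
    (\<forall>p\<in>S. \<forall>g h. local_defining_functions S p g h \<longrightarrow> gaussian_curvature g p \<noteq> 0)"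


section \<open>The extension operator\<close>

definition surface_measure :: "(real^'n) set \<Rightarrow> (real^'n) measure" where
  "surface_measure S = restrict_space (hausdorff_measure (CARD('n) - 1)) S"

definition extension_operator :: "(real^'n) set \<Rightarrow> (real^'n \<Rightarrow> complex) \<Rightarrow> real^'n \<Rightarrow> complex" where
  "extension_operator S f x =
    (\<integral>\<xi>. exp (- 2 * of_real pi * \<i> * of_real (x \<bullet> \<xi>)) * f \<xi> \<partial>surface_measure S)"

definition L2_space :: "'a measure \<Rightarrow> ('a \<Rightarrow> complex) set" where
  "L2_space M = {f \<in> borel_measurable M. integrable M (\<lambda>x. (norm (f x))\<^sup>2)}"

definition L2_norm :: "'a measure \<Rightarrow> ('a \<Rightarrow> complex) \<Rightarrow> real" where
  "L2_norm M f = sqrt (\<integral>x. (norm (f x))\<^sup>2 \<partial>M)"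


section \<open>Cubes\<close>

definition cube :: "real^'n \<Rightarrow> real \<Rightarrow> (real^'n) set" where
  "cube x r = {y. \<forall>i. \<bar>y $ i - x $ i\<bar> \<le> r / 2}"

definition lattice_unit_cubes :: "(real^'n) set set" where
  "lattice_unit_cubes = {cbox m (\<chi> i. m $ i + 1) | m. \<forall>i. m $ i \<in> \<int>}"

definition cube_density :: "(real^'n) set set \<Rightarrow> real \<Rightarrow> real \<Rightarrow> real" where
  "cube_density \<B> \<alpha> R =
    (SUP (x, r) \<in> {(x, r). 1 \<le> r \<and> cube x r \<subseteq> cube 0 R}.
       real (card {B \<in> \<B>. B \<subseteq> cube x r}) / r powr \<alpha>)"

definition restriction_exponent :: "real \<Rightarrow> real \<Rightarrow> real" where
  "restriction_exponent n \<alpha> = (if \<alpha> \<le> (n - 1) / 2 then 0 else \<alpha> / 2 - (n - 1) / 4)"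

end

theory Submission
  imports Defs "HOL-Real_Asymp.Real_Asymp"
begin

text \<open>By duality it suffices to bound the Fourier transform of functions supported on \<open>X\<close> in
  \<open>L\<^sup>2(\<sigma>)\<close>. If \<open>\<sigma>\<close> is dominated by finite measures \<open>\<mu>\<close> with \<open>|\<mu>^(x)| \<le> C (1 + |x|)\<^bsup>-(n-1)/2\<^esup>\<close>,
  then this follows from Schur's test, because the cube density controls
  \<open>sup\<^sub>x \<integral>\<^sub>X (1 + |x - y|)\<^bsup>-(n-1)/2\<^esup> dy\<close> by summation over dyadic cubes around \<open>x\<close>, with only a
  logarithmic loss.

  Measures \<open>\<mu>\<close> are needed instead of \<open>\<sigma>\<close> because \<open>S\<close> may have a boundary, where \<open>\<sigma>^\<close> itself need
  not decay at that rate. Near a point of \<open>S\<close>, take \<open>\<mu>\<close> to be the image of \<open>\<psi>(y) dy\<close>, with a bump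
  function \<open>\<psi>\<close>, under a parametrization of the level set as a graph of a function \<open>\<phi>\<close> over a
  coordinate hyperplane. Nonvanishing curvature means that the Hessian of \<open>\<phi>\<close> is nondegenerate.
  The decay is obtained without the Morse lemma: \<open>|\<mu>^(x)|\<^sup>2\<close> is the integral over \<open>h\<close> of the
  oscillatory integrals with phases \<open>x \<bullet> (\<Phi>(y + h) - \<Phi>(y))\<close>, whose gradients are at least of size
  \<open>|x| |h|\<close>, so repeated integration by parts in \<open>y\<close> applies.

  Since dimensions are types, the hyperplane is not a type of its own: the parametrizations are
  defined on the whole space and do not depend on the dummy coordinate \<open>j\<close>.\<close>

section \<open>Oscillatory integrals without stationary points\<close>

text \<open>The estimates must be uniform in the frequency \<open>x\<close> and the shift
  \<open>h\<close>, and this dictates the tools: \<open>dir_Ck\<close> carries an explicit bound,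
  and the constant of \<open>nonstationary_phase\<close> serves all phases with the same bounds.
  Uniformity in \<open>h\<close> comes from dividing the difference phase by
  \<open>\<bar>x $ j\<bar> * size h\<close>; its derivative is then bounded above and below
  independently of \<open>h\<close>. Near a point the Hessian is almost constant, so for each
  \<open>h\<close> a single coordinate direction has this lower bound at all \<open>y\<close>; hence
  derivatives along one axis at a time are enough. With \<open>r = \<bar>x $ j\<bar>\<close>,
  integrating by parts \<open>2 * (n - 1)\<close> times gives that power of
  \<open>1 / (1 + r * size h)\<close>, which is at most a product of \<open>n - 1\<close> integrable
  one-dimensional factors. Their integral over \<open>h\<close> is of order
  \<open>(1 / r) ^ (n - 1)\<close>, the rate required for the square. For the Hausdorff measure an
  upper bound by \<open>\<mu>\<close> with any constant will do, and it follows from covers of a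
  Lipschitz graph by small pieces.\<close>

primrec dir_Ck ::
    "'a::real_normed_vector \<Rightarrow> 'a set \<Rightarrow> real \<Rightarrow> nat \<Rightarrow> ('a \<Rightarrow> complex) \<Rightarrow> bool" where
  "dir_Ck e W B 0 f \<longleftrightarrow> continuous_on W f \<and> (\<forall>y\<in>W. norm (f y) \<le> B)"
| "dir_Ck e W B (Suc k) f \<longleftrightarrow> continuous_on W f \<and> (\<forall>y\<in>W. norm (f y) \<le> B) \<and>
     (\<exists>f'. (\<forall>y\<in>W. ((\<lambda>t. f (y + t *\<^sub>R e)) has_vector_derivative f' y) (at 0)) \<and>
           dir_Ck e W B k f')"

lemma dir_Ck_SucI:
  "continuous_on W f \<Longrightarrow> (\<And>y. y \<in> W \<Longrightarrow> norm (f y) \<le> B) \<Longrightarrow>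
    (\<And>y. y \<in> W \<Longrightarrow> ((\<lambda>t. f (y + t *\<^sub>R e)) has_vector_derivative f' y) (at 0)) \<Longrightarrow>
    dir_Ck e W B k f' \<Longrightarrow> dir_Ck e W B (Suc k) f"
  by auto

lemma dir_Ck_continuous: "dir_Ck e W B k f \<Longrightarrow> continuous_on W f"
  by (cases k) auto

lemma dir_Ck_bound: "dir_Ck e W B k f \<Longrightarrow> y \<in> W \<Longrightarrow> norm (f y) \<le> B"
  by (cases k) auto

lemma dir_Ck_mono: "dir_Ck e W B k f \<Longrightarrow> B \<le> B' \<Longrightarrow> dir_Ck e W B' k f"
  by (induction k arbitrary: f) (auto intro: order_trans)

lemma dir_Ck_subset: "dir_Ck e W B k f \<Longrightarrow> W' \<subseteq> W \<Longrightarrow> dir_Ck e W' B k f"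
  by (induction k arbitrary: f) (auto intro: continuous_on_subset, metis subsetD)

lemma dir_Ck_SucD: "dir_Ck e W B (Suc k) f \<Longrightarrow> dir_Ck e W B k f"
  by (induction k arbitrary: f) auto

lemma dir_Ck_add:
  "dir_Ck e W B k f \<Longrightarrow> dir_Ck e W B' k g \<Longrightarrow> dir_Ck e W (B + B') k (\<lambda>y. f y + g y)"
proof (induction k arbitrary: f g)
  case 0
  then show ?case by (auto intro!: continuous_intros norm_triangle_mono)
next
  case (Suc k)
  obtain f' where f': "\<forall>y\<in>W. ((\<lambda>t. f (y + t *\<^sub>R e)) has_vector_derivative f' y) (at 0)"
    "dir_Ck e W B k f'" using Suc.prems by auto
  obtain g' where g': "\<forall>y\<in>W. ((\<lambda>t. g (y + t *\<^sub>R e)) has_vector_derivative g' y) (at 0)"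
    "dir_Ck e W B' k g'" using Suc.prems by auto
  have "\<forall>y\<in>W. ((\<lambda>t. f (y + t *\<^sub>R e) + g (y + t *\<^sub>R e)) has_vector_derivative f' y + g' y) (at 0)"
    using f' g' by (auto intro!: derivative_intros)
  with Suc.IH[OF f'(2) g'(2)] Suc.prems show ?case
    by (auto intro!: continuous_intros norm_triangle_mono exI[of _ "\<lambda>y. f' y + g' y"])
qed

text \<open>By the Leibniz rule a derivative of order at most \<open>k\<close> of the product is a
  sum of at most \<open>2 ^ k\<close> terms, each bounded by \<open>B * B'\<close>.\<close>

lemma dir_Ck_mult:
  assumes "0 \<le> B" "0 \<le> B'"
  shows "dir_Ck e W B k f \<Longrightarrow> dir_Ck e W B' k g \<Longrightarrow> dir_Ck e W (2 ^ k * B * B') k (\<lambda>y. f y * g y)"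
proof (induction k arbitrary: f g)
  case 0
  then show ?case using assms by (auto intro!: continuous_intros mult_mono simp: norm_mult)
next
  case (Suc k)
  obtain f' where f': "\<forall>y\<in>W. ((\<lambda>t. f (y + t *\<^sub>R e)) has_vector_derivative f' y) (at 0)"
    "dir_Ck e W B k f'" using Suc.prems by auto
  obtain g' where g': "\<forall>y\<in>W. ((\<lambda>t. g (y + t *\<^sub>R e)) has_vector_derivative g' y) (at 0)"
    "dir_Ck e W B' k g'" using Suc.prems by auto
  have d: "((\<lambda>t. f (y + t *\<^sub>R e) * g (y + t *\<^sub>R e)) has_vector_derivative f y * g' y + f' y * g y) (at 0)"
    if "y \<in> W" for y
    using has_vector_derivative_mult[of "\<lambda>t. f (y + t *\<^sub>R e)" "f' y" 0 UNIV "\<lambda>t. g (y + t *\<^sub>R e)" "g' y"]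
      f' g' that by auto
  have "dir_Ck e W (2 ^ k * B * B' + 2 ^ k * B * B') k (\<lambda>y. f y * g' y + f' y * g y)"
    by (intro dir_Ck_add Suc.IH f' g' dir_Ck_SucD[OF Suc.prems(1)] dir_Ck_SucD[OF Suc.prems(2)])
  then have e: "dir_Ck e W (2 ^ Suc k * B * B') k (\<lambda>y. f y * g' y + f' y * g y)"
    by (simp add: algebra_simps)
  have "norm (f y * g y) \<le> 2 ^ Suc k * B * B'" if "y \<in> W" for y
  proof -
    have "norm (f y * g y) \<le> B * B'"
      using Suc.prems that assms by (auto intro!: mult_mono simp: norm_mult)
    also have "\<dots> \<le> 2 ^ Suc k * (B * B')"
      using mult_right_mono[of 1 "2 ^ Suc k" "B * B'"] assms one_le_power[of "2::real" "Suc k"] by simp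
    finally show ?thesis by (simp add: mult.assoc)
  qed
  with Suc.prems d e show ?case
    by (simp del: power_Suc) (auto intro!: continuous_intros exI[of _ "\<lambda>y. f y * g' y + f' y * g y"])
qed

lemma dir_Ck_cmult:
  assumes "dir_Ck e W B k f"
  shows "dir_Ck e W (norm c * B) k (\<lambda>y. c * f y)"
  using assms
proof (induction k arbitrary: f)
  case 0
  then show ?case by (auto intro!: continuous_intros mult_left_mono simp: norm_mult)
next
  case (Suc k)
  obtain f' where f': "\<forall>y\<in>W. ((\<lambda>t. f (y + t *\<^sub>R e)) has_vector_derivative f' y) (at 0)"
    "dir_Ck e W B k f'" using Suc.prems by auto
  have "\<forall>y\<in>W. ((\<lambda>t. c * f (y + t *\<^sub>R e)) has_vector_derivative c * f' y) (at 0)"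
    using f' by (auto intro!: derivative_intros has_vector_derivative_mult_right)
  with Suc.IH[OF f'(2)] Suc.prems show ?case
    by (auto intro!: continuous_intros mult_left_mono exI[of _ "\<lambda>y. c * f' y"] simp: norm_mult)
qed

text \<open>\<open>C\<close> is chosen before \<open>e\<close>, \<open>W\<close> and
  \<open>g\<close>, so it depends on \<open>k\<close>, \<open>B\<close> and \<open>c\<close> alone.
  The induction writes the derivative of the reciprocal as \<open>- g' / g^2\<close> and bounds it
  by the product rule.\<close>

lemma dir_Ck_inverse:
  assumes "0 \<le> B" "0 < c"
  shows "\<exists>C\<ge>0. \<forall>(e::'a::real_normed_vector) W g. dir_Ck e W B k g \<longrightarrow> (\<forall>y\<in>W. c \<le> norm (g y)) \<longrightarrow>
    dir_Ck e W C k (\<lambda>y. inverse (g y))"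
proof (induction k)
  case 0
  show ?case
    using \<open>0 < c\<close>
    by (intro exI[of _ "inverse c"]) (auto intro!: continuous_intros simp: norm_inverse intro: le_imp_inverse_le)
next
  case (Suc k)
  then obtain C where C: "0 \<le> C" "\<And>(e::'a) W g. dir_Ck e W B k g \<Longrightarrow> (\<forall>y\<in>W. c \<le> norm (g y)) \<Longrightarrow>
    dir_Ck e W C k (\<lambda>y. inverse (g y))" by blast
  \<comment> \<open>Two applications of \<open>dir_Ck_mult\<close> to
    \<open>g' * inverse g * inverse g\<close> give this bound.\<close>
  define D where "D = 2 ^ k * (2 ^ k * B * C) * C"
  have D: "0 \<le> D" using C(1) assms by (simp add: D_def)
  have "dir_Ck e W (max (inverse c) D) (Suc k) (\<lambda>y. inverse (g y))"
    if g: "dir_Ck e W B (Suc k) g" and lb: "\<forall>y\<in>W. c \<le> norm (g y)" for e :: 'a and W g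
  proof -
    obtain g' where g': "\<forall>y\<in>W. ((\<lambda>t. g (y + t *\<^sub>R e)) has_vector_derivative g' y) (at 0)"
      "dir_Ck e W B k g'" using g by auto
    have nz: "g y \<noteq> 0" if "y \<in> W" for y using lb that \<open>0 < c\<close> by force
    have d: "((\<lambda>t. inverse (g (y + t *\<^sub>R e))) has_vector_derivative - (g' y * inverse (g y) * inverse (g y))) (at 0)"
      if "y \<in> W" for y
      using field_vector_diff_chain_at[of "\<lambda>t. g (y + t *\<^sub>R e)" "g' y" 0 inverse "- (inverse (g y) * inverse (g y))"]
        g' that nz[OF that] DERIV_inverse'[of "\<lambda>x. x" 1 "g y" UNIV]
      by (auto simp: o_def mult.assoc)
    have "dir_Ck e W D k (\<lambda>y. g' y * inverse (g y) * inverse (g y))"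
      unfolding D_def
      by (intro dir_Ck_mult g' C dir_Ck_SucD[OF g] lb) (use C assms in auto)
    then have e: "dir_Ck e W D k (\<lambda>y. - (g' y * inverse (g y) * inverse (g y)))"
      using dir_Ck_cmult[of e W D k "\<lambda>y. g' y * inverse (g y) * inverse (g y)" "-1"] by simp
    have "norm (inverse (g y)) \<le> inverse c" if "y \<in> W" for y
      using lb that \<open>0 < c\<close> by (auto simp: norm_inverse intro: le_imp_inverse_le)
    then have "\<forall>y\<in>W. norm (inverse (g y)) \<le> max (inverse c) D" by (auto intro: max.coboundedI1)
    moreover have "continuous_on W (\<lambda>y. inverse (g y))"
      by (intro continuous_intros dir_Ck_continuous[OF g]) (use nz in auto)
    moreover have "dir_Ck e W (max (inverse c) D) k (\<lambda>y. - (g' y * inverse (g y) * inverse (g y)))"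
      by (rule dir_Ck_mono[OF e]) simp
    ultimately show ?thesis
      using d by (auto simp only: dir_Ck.simps intro!: exI[of _ "\<lambda>y. - (g' y * inverse (g y) * inverse (g y))"])
  qed
  moreover have "0 \<le> max (inverse c) D" using D by simp
  ultimately show ?case by blast
qed

section \<open>Integrals of directional derivatives\<close>

lemma integral_translation_lborel:
  fixes F :: "'a::euclidean_space \<Rightarrow> complex"
  assumes "F \<in> borel_measurable borel"
  shows "(\<integral>y. F (y + c) \<partial>lborel) = (\<integral>y. F y \<partial>lborel)"
proof -
  have "(\<integral>y. F (c + y) \<partial>lborel) = integral\<^sup>L (distr lborel borel ((+) c)) F"
    by (rule integral_distr[symmetric]) (use assms in auto)
  then show ?thesis unfolding lborel_distr_plus by (simp add: add.commute)
qed

text \<open>Difference quotients of \<open>F\<close> along \<open>e\<close> have integral 0 by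
  translation invariance, and they converge to \<open>F'\<close> under a common integrable bound.
  The last conclusion, that \<open>F'\<close> again vanishes off \<open>K\<close>, lets integration
  by parts be iterated.\<close>

lemma integral_directional_derivative_eq_0:
  fixes F F' :: "'a::euclidean_space \<Rightarrow> complex"
  assumes K: "compact K" "K \<subseteq> W" and W: "open W" and F0: "\<And>y. y \<notin> K \<Longrightarrow> F y = 0"
    and d: "\<And>y. y \<in> W \<Longrightarrow> ((\<lambda>t. F (y + t *\<^sub>R e)) has_vector_derivative F' y) (at 0)"
    and cF: "continuous_on W F" and cF': "continuous_on W F'" and F'0: "\<And>y. y \<notin> W \<Longrightarrow> F' y = 0"
  shows "integrable lborel F" "integrable lborel F'" "(\<integral>y. F' y \<partial>lborel) = 0" "\<And>y. y \<notin> K \<Longrightarrow> F' y = 0"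
proof -
  have "closed K" using K compact_imp_closed by auto
  have z: "((\<lambda>t. F (y + t *\<^sub>R e)) has_vector_derivative 0) (at 0)" if "y \<notin> K" for y
  proof -
    have "open ((\<lambda>t. y + t *\<^sub>R e) -` (- K))"
      by (intro open_vimage continuous_intros) (use \<open>closed K\<close> in auto)
    then show ?thesis
      using that F0
      by - (rule has_vector_derivative_transform_within_open[where f="\<lambda>_. 0" and S="(\<lambda>t. y + t *\<^sub>R e) -` (- K)"], auto)
  qed
  show F'K: "F' y = 0" if "y \<notin> K" for y
    using vector_derivative_unique_at[OF d z[OF that]] F'0 by (cases "y \<in> W") auto
  have dd: "((\<lambda>t. F (y + t *\<^sub>R e)) has_vector_derivative F' y) (at 0)" for y
    using d z[of y] F'0 K by (cases "y \<in> W") auto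
  have "integrable lborel (\<lambda>y. indicator K y *\<^sub>R F y)"
    by (rule borel_integrable_compact[OF K(1) continuous_on_subset[OF cF K(2)]])
  also have "(\<lambda>y. indicator K y *\<^sub>R F y) = F" using F0 by (auto simp: indicator_def)
  finally show iF: "integrable lborel F" .
  have "integrable lborel (\<lambda>y. indicator K y *\<^sub>R F' y)"
    by (rule borel_integrable_compact[OF K(1) continuous_on_subset[OF cF' K(2)]])
  also have "(\<lambda>y. indicator K y *\<^sub>R F' y) = F'" using F'K by (auto simp: indicator_def)
  finally show iF': "integrable lborel F'" .
  have "bounded (F' ` K)"
    by (intro compact_imp_bounded compact_continuous_image K continuous_on_subset[OF cF'])
  then obtain B where B: "B > 0" "\<And>y. y \<in> K \<Longrightarrow> norm (F' y) \<le> B"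
    unfolding bounded_pos by auto
  have B': "norm (F' y) \<le> B" for y using B F'K by (cases "y \<in> K") auto
  have dt: "((\<lambda>s. F (y + s *\<^sub>R e)) has_vector_derivative F' (y + t *\<^sub>R e)) (at t)" for y t
  proof -
    have "((\<lambda>s. F ((y + t *\<^sub>R e) + s *\<^sub>R e)) has_vector_derivative F' (y + t *\<^sub>R e)) (at 0)" by (rule dd)
    then have "((\<lambda>s. F (y + (t + s) *\<^sub>R e)) has_vector_derivative F' (y + t *\<^sub>R e)) (at (t - t))"
      by (simp add: algebra_simps)
    moreover have "((\<lambda>s. s - t) has_vector_derivative 1) (at t)"
      by (auto intro!: derivative_eq_intros)
    ultimately have "((\<lambda>s. F (y + (t + s) *\<^sub>R e)) \<circ> (\<lambda>s. s - t) has_vector_derivative 1 *\<^sub>R F' (y + t *\<^sub>R e)) (at t)"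
      using vector_diff_chain_at by blast
    then show ?thesis by (simp add: o_def)
  qed
  have lip: "norm (F (y + h *\<^sub>R e) - F y) \<le> B * h" if "0 \<le> h" for y h
  proof -
    have "norm (F (y + h *\<^sub>R e) - F (y + 0 *\<^sub>R e)) \<le> B * norm (h - 0)"
    proof (rule differentiable_bound[where S="{0..h}" and f="\<lambda>s. F (y + s *\<^sub>R e)"
          and f'="\<lambda>t s. s *\<^sub>R F' (y + t *\<^sub>R e)"])
      show "((\<lambda>s. F (y + s *\<^sub>R e)) has_derivative (\<lambda>s. s *\<^sub>R F' (y + t *\<^sub>R e))) (at t within {0..h})" for t
        using has_vector_derivative_at_within[OF dt] unfolding has_vector_derivative_def by blast
      show "onorm (\<lambda>s. s *\<^sub>R F' (y + t *\<^sub>R e)) \<le> B" for t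
        by (rule onorm_le) (use mult_right_mono[OF B' abs_ge_zero] in \<open>simp add: mult.commute\<close>)
    qed (use that in auto)
    then show ?thesis using that by simp
  qed
  define q where "q = (\<lambda>(n::nat) y. of_nat (Suc n) * (F (y + (1 / real (Suc n)) *\<^sub>R e) - F y))"
  \<comment> \<open>For steps in \<open>(0, 1]\<close> the quotients vanish off \<open>K'\<close>,
    the set swept out by moving \<open>K\<close> back along \<open>e\<close>; it is compact, so
    \<open>B * indicator K'\<close> is an integrable majorant.\<close>
  define K' where "K' = (\<lambda>(k,t). k - t *\<^sub>R e) ` (K \<times> {0..1::real})"
  have K': "compact K'" unfolding K'_def
    by (intro compact_continuous_image compact_Times K compact_Icc)
       (auto intro!: continuous_intros simp: case_prod_unfold)
  have mF[measurable]: "F \<in> borel_measurable borel" using iF by auto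
  have "(\<lambda>n. integral\<^sup>L lborel (q n)) \<longlonglongrightarrow> integral\<^sup>L lborel F'"
  proof (rule integral_dominated_convergence[where w="\<lambda>y. B * indicator K' y"])
    show "F' \<in> borel_measurable lborel" using iF' by auto
    show "q n \<in> borel_measurable lborel" for n unfolding q_def by measurable
    show "integrable lborel (\<lambda>y. B * indicator K' y)"
      using emeasure_compact_finite[OF K'] K'
      by (intro integrable_mult_right integrable_real_indicator) (auto intro: borel_compact)
    show "AE y in lborel. (\<lambda>n. q n y) \<longlonglongrightarrow> F' y"
    proof (rule AE_I2)
      fix y
      have "(\<lambda>h. norm (F (y + h *\<^sub>R e) - F y - h *\<^sub>R F' y) / norm h) \<midarrow>0\<rightarrow> 0"
        using dd[of y] unfolding has_vector_derivative_def has_derivative_at by simp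
      moreover have "filterlim (\<lambda>n. 1 / real (Suc n)) (at 0) sequentially"
        unfolding filterlim_at using LIMSEQ_inverse_real_of_nat
        by (simp add: inverse_eq_divide)
      ultimately have "(\<lambda>n. norm (F (y + (1 / real (Suc n)) *\<^sub>R e) - F y - (1 / real (Suc n)) *\<^sub>R F' y) / norm (1 / real (Suc n))) \<longlonglongrightarrow> 0"
        by (rule filterlim_compose)
      also have "(\<lambda>n. norm (F (y + (1 / real (Suc n)) *\<^sub>R e) - F y - (1 / real (Suc n)) *\<^sub>R F' y) / norm (1 / real (Suc n)))
          = (\<lambda>n. norm (q n y - F' y))"
      proof
        fix n
        have "q n y - F' y = of_nat (Suc n) * (F (y + (1 / real (Suc n)) *\<^sub>R e) - F y - (1 / real (Suc n)) *\<^sub>R F' y)"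
          by (simp add: q_def right_diff_distrib scaleR_conv_of_real del: of_nat_Suc)
        then show "norm (F (y + (1 / real (Suc n)) *\<^sub>R e) - F y - (1 / real (Suc n)) *\<^sub>R F' y) / norm (1 / real (Suc n)) = norm (q n y - F' y)"
          by (simp only: norm_mult norm_of_nat) simp
      qed
      finally show "(\<lambda>n. q n y) \<longlonglongrightarrow> F' y"
        by (rule LIM_zero_cancel[OF tendsto_norm_zero_cancel])
    qed
    fix n
    show "AE y in lborel. norm (q n y) \<le> B * indicator K' y"
    proof (rule AE_I2)
      fix y
      show "norm (q n y) \<le> B * indicator K' y"
      proof (cases "y \<in> K'")
        case True
        have "norm (q n y) \<le> real (Suc n) * (B * (1 / real (Suc n)))"
          unfolding q_def norm_mult norm_of_nat by (intro mult_left_mono lip) auto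
        with True show ?thesis by simp
      next
        case False
        have "y \<notin> K" using False unfolding K'_def by (force intro: image_eqI[of _ _ "(y, 0)"])
        moreover have "y + (1 / real (Suc n)) *\<^sub>R e \<notin> K"
          using False unfolding K'_def
          by (force intro: image_eqI[of _ _ "(y + (1 / real (Suc n)) *\<^sub>R e, 1 / real (Suc n))"])
        ultimately show ?thesis using F0 False by (simp add: q_def)
      qed
    qed
  qed
  moreover have "integral\<^sup>L lborel (q n) = 0" for n
  proof -
    have "integrable lborel (\<lambda>y. F (y + c))" for c
    proof -
      have "integrable (distr lborel borel ((+) c)) F" unfolding lborel_distr_plus by (rule iF)
      then have "integrable lborel (\<lambda>y. F (c + y))" by (subst (asm) integrable_distr_eq) auto
      then show ?thesis by (simp add: add.commute)
    qed
    then show ?thesis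
      using iF by (simp add: q_def integral_translation_lborel)
  qed
  ultimately show "integral\<^sup>L lborel F' = 0" by (simp add: LIMSEQ_const_iff)
qed

lemma dir_Ck_cong:
  assumes "open W" "\<And>y. y \<in> W \<Longrightarrow> f y = g y" "dir_Ck e W B k f"
  shows "dir_Ck e W B k g"
proof (cases k)
  case 0
  then show ?thesis using assms continuous_on_cong[of W W f g] by auto
next
  case (Suc l)
  then obtain f' where f': "\<And>y. y \<in> W \<Longrightarrow> ((\<lambda>t. f (y + t *\<^sub>R e)) has_vector_derivative f' y) (at 0)"
    "dir_Ck e W B l f'" using assms(3) by auto
  have "((\<lambda>t. g (y + t *\<^sub>R e)) has_vector_derivative f' y) (at 0)" if "y \<in> W" for y
  proof -
    have "open ((\<lambda>t. y + t *\<^sub>R e) -` W)"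
      by (intro open_vimage continuous_intros assms)
    then show ?thesis
      using that assms(2)
      by - (rule has_vector_derivative_transform_within_open[where S="(\<lambda>t. y + t *\<^sub>R e) -` W", OF f'(1)], auto)
  qed
  then show ?thesis
    using Suc f'(2) assms continuous_on_cong[of W W f g] by auto
qed

lemma integrable_compact_support:
  fixes F :: "'a::euclidean_space \<Rightarrow> complex"
  assumes "compact K" "K \<subseteq> W" "\<And>y. y \<notin> K \<Longrightarrow> F y = 0" "continuous_on W F"
  shows "integrable lborel F"
proof -
  have "integrable lborel (\<lambda>y. indicator K y *\<^sub>R F y)"
    by (rule borel_integrable_compact[OF assms(1) continuous_on_subset[OF assms(4,2)]])
  also have "(\<lambda>y. indicator K y *\<^sub>R F y) = F" using assms(3) by (auto simp: indicator_def)
  finally show ?thesis .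
qed

lemma integral_norm_bound_compact_support:
  fixes F :: "'a::euclidean_space \<Rightarrow> complex"
  assumes K: "compact K" and F0: "\<And>y. y \<notin> K \<Longrightarrow> F y = 0" and B: "\<And>y. y \<in> K \<Longrightarrow> norm (F y) \<le> B"
    and "0 \<le> B" "measure lborel K \<le> V"
  shows "norm (\<integral>y. F y \<partial>lborel) \<le> B * V"
proof -
  have iK: "integrable lborel (\<lambda>y. B * indicator K y)"
    using emeasure_compact_finite[OF K] K
    by (intro integrable_mult_right integrable_real_indicator) (auto intro: borel_compact)
  have "norm (\<integral>y. F y \<partial>lborel) \<le> (\<integral>y. B * indicator K y \<partial>lborel)"
    by (rule order_trans[OF integral_norm_bound integral_mono'])
       (use assms iK in \<open>auto simp: indicator_def\<close>)
  also have "\<dots> = B * measure lborel K"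
    using K by (simp add: borel_compact)
  also have "\<dots> \<le> B * V" using assms by (intro mult_left_mono)
  finally show ?thesis .
qed

section \<open>Repeated integration by parts\<close>

text \<open>The class over which the constant of \<open>nonstationary_phase\<close> is uniform. The
  large parameter \<open>r\<close> is kept outside the phase, so that
  \<open>\<bar>\<theta>' y\<bar>\<close> lies between the fixed bounds \<open>c\<close> and
  \<open>B\<close>; \<open>V\<close> bounds the volume of the support.\<close>

definition nonstationary ::
    "'a::euclidean_space \<Rightarrow> real \<Rightarrow> real \<Rightarrow> real \<Rightarrow> nat \<Rightarrow> 'a set \<Rightarrow> 'a set \<Rightarrow>
      ('a \<Rightarrow> complex) \<Rightarrow> ('a \<Rightarrow> real) \<Rightarrow> ('a \<Rightarrow> real) \<Rightarrow> bool" where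
  "nonstationary e c V B k W K a \<theta> \<theta>' \<longleftrightarrow>
     open W \<and> compact K \<and> K \<subseteq> W \<and> measure lborel K \<le> V \<and> (\<forall>y. y \<notin> K \<longrightarrow> a y = 0) \<and>
     dir_Ck e W B k a \<and> continuous_on W \<theta> \<and>
     (\<forall>y\<in>W. ((\<lambda>t. \<theta> (y + t *\<^sub>R e)) has_vector_derivative \<theta>' y) (at 0)) \<and>
     dir_Ck e W B k (\<lambda>y. complex_of_real (\<theta>' y)) \<and> (\<forall>y\<in>W. c \<le> \<bar>\<theta>' y\<bar>)"

text \<open>Each integration by parts replaces the amplitude \<open>a\<close> by the derivative of
  \<open>a / \<theta>'\<close> and gains a factor \<open>1 / r\<close>. The bound for the amplitude
  grows on the way, so the induction is over all \<open>B\<close>.\<close>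

lemma nonstationary_phase:
  fixes B c V :: real
  assumes "0 < c" "0 \<le> V" "0 \<le> B"
  shows "\<exists>C\<ge>0. \<forall>(e::'a::euclidean_space) W K a \<theta> \<theta>' r. nonstationary e c V B k W K a \<theta> \<theta>' \<longrightarrow> 0 < r \<longrightarrow>
     norm (\<integral>y. exp (\<i> * complex_of_real (r * \<theta> y)) * a y \<partial>lborel) \<le> C * (1 / r) ^ k"
  using \<open>0 \<le> B\<close>
proof (induction k arbitrary: B)
  case 0
  have "norm (\<integral>y. exp (\<i> * complex_of_real (r * \<theta> y)) * a y \<partial>lborel) \<le> B * V"
    if "nonstationary e c V B 0 W K a \<theta> \<theta>'" for e :: 'a and W K a \<theta> \<theta>' r
    using that 0 unfolding nonstationary_def
    by (intro integral_norm_bound_compact_support[where K=K]) (auto simp: norm_mult)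
  then show ?case using 0 \<open>0 \<le> V\<close> by (intro exI[of _ "B * V"]) auto
next
  case (Suc k)
  obtain D where D: "0 \<le> D" "\<And>(e::'a) W g. dir_Ck e W B (Suc k) g \<Longrightarrow> (\<forall>y\<in>W. c \<le> norm (g y)) \<Longrightarrow>
    dir_Ck e W D (Suc k) (\<lambda>y. inverse (g y))"
    using dir_Ck_inverse[OF Suc.prems \<open>0 < c\<close>, of "Suc k", where 'a='a] by metis
  \<comment> \<open>The bound of \<open>dir_Ck_mult\<close> for \<open>a\<close> times the
    reciprocal of \<open>\<theta>'\<close>.\<close>
  define B2 where "B2 = 2 ^ Suc k * B * D"
  define B' where "B' = max B B2"
  have "0 \<le> B'" using Suc.prems by (simp add: B'_def max.coboundedI1)
  from Suc.IH[OF this] obtain C where C: "0 \<le> C" "\<And>(e::'a) W K a \<theta> \<theta>' r.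
     nonstationary e c V B' k W K a \<theta> \<theta>' \<Longrightarrow> 0 < r \<Longrightarrow>
     norm (\<integral>y. exp (\<i> * complex_of_real (r * \<theta> y)) * a y \<partial>lborel) \<le> C * (1 / r) ^ k"
    by blast
  have "norm (\<integral>y. exp (\<i> * complex_of_real (r * \<theta> y)) * a y \<partial>lborel) \<le> C * (1 / r) ^ Suc k"
    if ns: "nonstationary e c V B (Suc k) W K a \<theta> \<theta>'" and r: "0 < r" for e :: 'a and W K a \<theta> \<theta>' r
  proof -
    have W: "open W" and K: "compact K" "K \<subseteq> W" "measure lborel K \<le> V" and a0: "\<forall>y. y \<notin> K \<longrightarrow> a y = 0"
      and a: "dir_Ck e W B (Suc k) a" and c\<theta>: "continuous_on W \<theta>"
      and d\<theta>: "\<forall>y\<in>W. ((\<lambda>t. \<theta> (y + t *\<^sub>R e)) has_vector_derivative \<theta>' y) (at 0)"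
      and \<theta>': "dir_Ck e W B (Suc k) (\<lambda>y. complex_of_real (\<theta>' y))"
      and lb: "\<forall>y\<in>W. c \<le> \<bar>\<theta>' y\<bar>"
      using ns unfolding nonstationary_def by blast+
    define w where "w = (\<lambda>y. a y * inverse (complex_of_real (\<theta>' y)))"
    have "dir_Ck e W B2 (Suc k) w"
      unfolding w_def B2_def by (intro dir_Ck_mult a D Suc.prems \<theta>') (use lb in auto)
    then obtain w1 where w1: "\<And>y. y \<in> W \<Longrightarrow> ((\<lambda>t. w (y + t *\<^sub>R e)) has_vector_derivative w1 y) (at 0)"
      "dir_Ck e W B2 k w1" and cw: "continuous_on W w" by auto
    \<comment> \<open>Off \<open>W\<close> the function \<open>w1\<close> is arbitrary, while the
      integrals run over the whole space; it is set to 0 there.\<close>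
    define w' where "w' = (\<lambda>y. if y \<in> W then w1 y else 0)"
    have w': "dir_Ck e W B2 k w'" by (rule dir_Ck_cong[OF W _ w1(2)]) (simp add: w'_def)
    have dw: "((\<lambda>t. w (y + t *\<^sub>R e)) has_vector_derivative w' y) (at 0)" if "y \<in> W" for y
      using w1(1)[OF that] that by (simp add: w'_def)
    have w0: "w y = 0" if "y \<notin> K" for y using a0 that by (simp add: w_def)
    have w'0: "w' y = 0" if "y \<notin> K" for y
      by (rule integral_directional_derivative_eq_0(4)[OF K(1,2) W w0 dw cw dir_Ck_continuous[OF w'] _ that])
         (simp_all add: w'_def)
    define E where "E = (\<lambda>y. exp (\<i> * complex_of_real (r * \<theta> y)))"
    have cE: "continuous_on W E" unfolding E_def by (intro continuous_intros c\<theta>)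
    have dE: "((\<lambda>t. E (y + t *\<^sub>R e)) has_vector_derivative \<i> * complex_of_real (r * \<theta>' y) * E y) (at 0)"
      if "y \<in> W" for y
    proof -
      have "((\<lambda>t. \<i> * complex_of_real (r * \<theta> (y + t *\<^sub>R e))) has_vector_derivative \<i> * complex_of_real (r * \<theta>' y)) (at 0)"
        using d\<theta> that
        by (auto intro!: derivative_eq_intros has_vector_derivative_mult_right has_vector_derivative_of_real
            simp: has_real_derivative_iff_has_vector_derivative)
      from field_vector_diff_chain_at[OF this DERIV_exp] show ?thesis
        by (simp add: o_def E_def)
    qed
    have Ea: "integrable lborel (\<lambda>y. E y * a y)"
      by (rule integrable_compact_support[OF K(1,2)]) (use a0 in \<open>auto intro!: continuous_intros cE dir_Ck_continuous[OF a]\<close>)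
    have Ew': "integrable lborel (\<lambda>y. E y * w' y)"
      by (rule integrable_compact_support[OF K(1,2)]) (use w'0 in \<open>auto intro!: continuous_intros cE dir_Ck_continuous[OF w']\<close>)
    have aW: "a y = 0" and w'W: "w' y = 0" if "y \<notin> W" for y
      using a0 w'0 K(2) that by auto
    \<comment> \<open>Since \<open>w * \<theta>' = a\<close> on \<open>W\<close>, the integrand is
      the derivative of \<open>E * w\<close> along \<open>e\<close>; solving for its first term
      gives the factor \<open>1 / r\<close>.\<close>
    have "(\<integral>y. \<i> * complex_of_real r * (E y * a y) + E y * w' y \<partial>lborel) = 0"
    proof (rule integral_directional_derivative_eq_0(3)[OF K(1,2) W, where F="\<lambda>y. E y * w y" and e=e])
      fix y assume y: "y \<in> W"
      have nz: "\<theta>' y \<noteq> 0" using lb y \<open>0 < c\<close> by force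
      have "((\<lambda>t. E (y + t *\<^sub>R e) * w (y + t *\<^sub>R e)) has_vector_derivative
          E y * w' y + \<i> * complex_of_real (r * \<theta>' y) * E y * w y) (at 0)"
        using has_vector_derivative_mult[OF dE[OF y] dw[OF y]] by simp
      also have "E y * w' y + \<i> * complex_of_real (r * \<theta>' y) * E y * w y
          = \<i> * complex_of_real r * (E y * a y) + E y * w' y"
        using nz by (simp add: w_def)
      finally show "((\<lambda>t. E (y + t *\<^sub>R e) * w (y + t *\<^sub>R e)) has_vector_derivative
          \<i> * complex_of_real r * (E y * a y) + E y * w' y) (at 0)" .
    qed (use w0 aW w'W in \<open>auto intro!: continuous_intros cE cw dir_Ck_continuous[OF a] dir_Ck_continuous[OF w']\<close>)
    then have "\<i> * complex_of_real r * (\<integral>y. E y * a y \<partial>lborel) = - (\<integral>y. E y * w' y \<partial>lborel)"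
      using Ea Ew' by (simp add: eq_neg_iff_add_eq_0)
    then have "norm (\<i> * complex_of_real r * (\<integral>y. E y * a y \<partial>lborel)) = norm (\<integral>y. E y * w' y \<partial>lborel)"
      by simp
    also have "\<dots> \<le> C * (1 / r) ^ k"
      unfolding E_def
    proof (rule C(2)[OF _ r])
      show "nonstationary e c V B' k W K w' \<theta> \<theta>'"
        unfolding nonstationary_def using W K w'0 c\<theta> d\<theta> lb
          dir_Ck_mono[OF w', of B'] dir_Ck_mono[OF dir_Ck_SucD[OF \<theta>'], of B'] by (simp add: B'_def)
    qed
    finally have "r * norm (\<integral>y. E y * a y \<partial>lborel) \<le> C * (1 / r) ^ k"
      using r by (simp add: norm_mult)
    then show ?thesis
      using r by (simp add: E_def field_simps)
  qed
  then show ?case using C(1) by blast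
qed

section \<open>A bump function of finite smoothness\<close>

lemma dir_Ck_const: "norm c \<le> B \<Longrightarrow> dir_Ck e W B k (\<lambda>_. c)"
proof -
  assume c: "norm c \<le> B"
  have B: "0 \<le> B" using norm_ge_zero c by (rule order_trans)
  have z: "dir_Ck e W B l (\<lambda>_. 0)" for l
    using B by (induction l) (auto intro!: exI[of _ "\<lambda>_. 0"])
  show ?thesis using c z by (cases k) (auto intro!: exI[of _ "\<lambda>_. 0"])
qed

lemma dir_Ck_shift:
  "dir_Ck e W B k f \<Longrightarrow> dir_Ck e {y. y + h \<in> W} B k (\<lambda>y. f (y + h))"
proof (induction k arbitrary: f)
  case 0
  have "continuous_on {y. y + h \<in> W} (\<lambda>y. f (y + h))"
    by (rule continuous_on_compose2[of W f]) (use 0 in \<open>auto intro!: continuous_on_add continuous_on_id continuous_on_const\<close>)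
  with 0 show ?case by auto
next
  case (Suc k)
  obtain f' where f': "\<And>y. y \<in> W \<Longrightarrow> ((\<lambda>t. f (y + t *\<^sub>R e)) has_vector_derivative f' y) (at 0)"
    "dir_Ck e W B k f'" using Suc.prems by auto
  have "((\<lambda>t. f (y + t *\<^sub>R e + h)) has_vector_derivative f' (y + h)) (at 0)" if "y + h \<in> W" for y
  proof -
    have eq: "(\<lambda>t. f (y + t *\<^sub>R e + h)) = (\<lambda>t. f ((y + h) + t *\<^sub>R e))"
      by (simp add: algebra_simps)
    show ?thesis unfolding eq by (rule f'(1)[OF that])
  qed
  moreover have "continuous_on {y. y + h \<in> W} (\<lambda>y. f (y + h))"
    by (rule continuous_on_compose2[OF dir_Ck_continuous[OF Suc.prems]])
       (auto intro!: continuous_on_add continuous_on_id continuous_on_const)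
  ultimately show ?case
    by (intro dir_Ck_SucI[where f'="\<lambda>y. f' (y + h)"] Suc.IH[OF f'(2)] dir_Ck_bound[OF Suc.prems]) auto
qed

lemma dir_Ck_prod:
  assumes "finite I" "\<And>i. i \<in> I \<Longrightarrow> \<exists>B\<ge>0. dir_Ck e W B k (f i)"
  shows "\<exists>B\<ge>0. dir_Ck e W B k (\<lambda>y. \<Prod>i\<in>I. f i y)"
  using assms
proof (induction I)
  case empty
  then show ?case by (intro exI[of _ 1]) (auto intro: dir_Ck_const)
next
  case (insert i I)
  obtain B where B: "0 \<le> B" "dir_Ck e W B k (\<lambda>y. \<Prod>i\<in>I. f i y)" using insert by auto
  obtain B' where B': "0 \<le> B'" "dir_Ck e W B' k (f i)" using insert.prems by auto
  have "dir_Ck e W (2 ^ k * B' * B) k (\<lambda>y. f i y * (\<Prod>i\<in>I. f i y))"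
    by (intro dir_Ck_mult B B')
  with insert B B' show ?case by (auto intro!: exI[of _ "2 ^ k * B' * B"])
qed

lemma DERIV_max_0_power:
  "((\<lambda>s::real. max 0 s ^ Suc (Suc m)) has_real_derivative real (Suc (Suc m)) * max 0 s ^ Suc m) (at s)"
proof -
  consider "s > 0" | "s < 0" | "s = 0" by linarith
  then show ?thesis
  proof cases
    case 1
    have "((\<lambda>s. s ^ Suc (Suc m)) has_real_derivative real (Suc (Suc m)) * s ^ Suc m) (at s)"
      using DERIV_pow[of "Suc (Suc m)" s UNIV] by simp
    from has_field_derivative_transform_within_open[OF this, of "{0<..}"] 1
    show ?thesis by (simp add: max_def)
  next
    case 2
    have "((\<lambda>s::real. 0) has_real_derivative 0) (at s)" by simp
    from has_field_derivative_transform_within_open[OF this, of "{..<0}"] 2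
    show ?thesis by (simp add: max_def)
  next
    case 3
    have "max 0 z ^ Suc (Suc m) - max 0 0 ^ Suc (Suc m) = max 0 z ^ Suc m * (z - 0)" for z :: real
      by (cases "z \<ge> 0") (auto simp: max_def)
    moreover have "isCont (\<lambda>z::real. max 0 z ^ Suc m) 0" by (intro continuous_intros)
    ultimately show ?thesis unfolding CARAT_DERIV 3
      by (intro exI[of _ "\<lambda>z. max 0 z ^ Suc m"]) auto
  qed
qed

text \<open>Differentiating the truncated power of order \<open>M\<close> gives a linear factor
  times the truncated power of order \<open>M - 1\<close>; the induction therefore lowers
  \<open>M\<close> together with \<open>k\<close>.\<close>

lemma dir_Ck_bump_factor:
  fixes q :: "real^'n"
  assumes "0 < \<delta>"
  shows "k < M \<Longrightarrow> \<exists>B\<ge>0. dir_Ck (axis i 1) {y. \<forall>i. \<bar>y $ i - q $ i\<bar> < 2 * \<delta>} B k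
    (\<lambda>y. complex_of_real (max 0 (\<delta>\<^sup>2 - (y $ l - q $ l)\<^sup>2) ^ M))"
proof (induction k arbitrary: M)
  case 0
  have "max 0 (\<delta>\<^sup>2 - (y $ l - q $ l)\<^sup>2) ^ M \<le> (\<delta>\<^sup>2) ^ M" for y :: "real^'n"
    by (intro power_mono) auto
  then show ?case
    by (intro exI[of _ "(\<delta>\<^sup>2) ^ M"]) (auto intro!: continuous_intros simp: norm_power)
next
  case (Suc k)
  let ?W = "{y. \<forall>i. \<bar>y $ i - q $ i\<bar> < 2 * \<delta>}" and ?e = "axis i 1 :: real^'n"
  obtain m where M: "M = Suc (Suc m)" using Suc.prems that[of "M - 2"] by auto
  obtain B where B: "0 \<le> B" "dir_Ck ?e ?W B k
    (\<lambda>y. complex_of_real (max 0 (\<delta>\<^sup>2 - (y $ l - q $ l)\<^sup>2) ^ Suc m))"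
    using Suc.IH[of "Suc m"] Suc.prems M by auto
  \<comment> \<open>The summand 1 bounds the derivative of the linear function, a component of a
    unit vector.\<close>
  have lin: "dir_Ck ?e ?W (2 * \<delta> + 1) k (\<lambda>y. complex_of_real (y $ l - q $ l))"
  proof (cases k)
    case 0
    have "norm (complex_of_real (y $ l - q $ l)) \<le> 2 * \<delta> + 1" if "y \<in> ?W" for y
    proof -
      have "\<bar>y $ l - q $ l\<bar> < 2 * \<delta>" using that by blast
      then show ?thesis unfolding norm_of_real by linarith
    qed
    with 0 show ?thesis by (auto intro!: continuous_intros)
  next
    case (Suc k')
    have "((\<lambda>t. complex_of_real ((y + t *\<^sub>R ?e) $ l - q $ l)) has_vector_derivative complex_of_real (?e $ l)) (at 0)"
      for y :: "real^'n"
      by (rule has_vector_derivative_of_real)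
         (auto intro!: derivative_eq_intros simp: has_real_derivative_iff_has_vector_derivative[symmetric])
    moreover have "dir_Ck ?e ?W (2 * \<delta> + 1) k' (\<lambda>y. complex_of_real (?e $ l))"
      by (rule dir_Ck_const) (use assms in \<open>auto simp: axis_def\<close>)
    ultimately show ?thesis unfolding Suc
    proof (intro dir_Ck_SucI)
      show "norm (complex_of_real (y $ l - q $ l)) \<le> 2 * \<delta> + 1" if "y \<in> ?W" for y
      proof -
        have "\<bar>y $ l - q $ l\<bar> < 2 * \<delta>" using that by blast
        then show ?thesis unfolding norm_of_real by linarith
      qed
    qed (auto intro!: continuous_intros)
  qed
  define f' where "f' = (\<lambda>y::real^'n. (complex_of_real (- 2 * real M * ?e $ l) *
      (complex_of_real (y $ l - q $ l) * complex_of_real (max 0 (\<delta>\<^sup>2 - (y $ l - q $ l)\<^sup>2) ^ Suc m))))"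
  define B' where "B' = norm (complex_of_real (- 2 * real M * ?e $ l)) * (2 ^ k * (2 * \<delta> + 1) * B)"
  have f': "dir_Ck ?e ?W B' k f'"
    unfolding f'_def B'_def using assms by (intro dir_Ck_cmult dir_Ck_mult lin B) auto
  have "((\<lambda>t. complex_of_real (max 0 (\<delta>\<^sup>2 - ((y + t *\<^sub>R ?e) $ l - q $ l)\<^sup>2) ^ M)) has_vector_derivative f' y) (at 0)"
    for y
  proof -
    have d: "((\<lambda>t. \<delta>\<^sup>2 - ((y + t *\<^sub>R ?e) $ l - q $ l)\<^sup>2) has_real_derivative - 2 * (y $ l - q $ l) * ?e $ l) (at 0)"
      by (auto intro!: derivative_eq_intros simp: algebra_simps)
    have "((\<lambda>t. max 0 (\<delta>\<^sup>2 - ((y + t *\<^sub>R ?e) $ l - q $ l)\<^sup>2) ^ M) has_real_derivative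
       (real (Suc (Suc m)) * max 0 (\<delta>\<^sup>2 - ((y + 0 *\<^sub>R ?e) $ l - q $ l)\<^sup>2) ^ Suc m) * (- 2 * (y $ l - q $ l) * ?e $ l)) (at 0)"
      unfolding M by (rule DERIV_chain2[OF DERIV_max_0_power d])
    also have "(real (Suc (Suc m)) * max 0 (\<delta>\<^sup>2 - ((y + 0 *\<^sub>R ?e) $ l - q $ l)\<^sup>2) ^ Suc m) * (- 2 * (y $ l - q $ l) * ?e $ l)
        = - 2 * real M * ?e $ l * ((y $ l - q $ l) * max 0 (\<delta>\<^sup>2 - (y $ l - q $ l)\<^sup>2) ^ Suc m)"
      by (simp add: M algebra_simps del: of_nat_Suc power_Suc)
    finally have "((\<lambda>t. complex_of_real (max 0 (\<delta>\<^sup>2 - ((y + t *\<^sub>R ?e) $ l - q $ l)\<^sup>2) ^ M)) has_vector_derivative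
        complex_of_real (- 2 * real M * ?e $ l * ((y $ l - q $ l) * max 0 (\<delta>\<^sup>2 - (y $ l - q $ l)\<^sup>2) ^ Suc m))) (at 0)"
      by (rule has_vector_derivative_of_real)
    then show ?thesis by (simp only: f'_def of_real_mult of_real_power)
  qed
  moreover have "max 0 (\<delta>\<^sup>2 - (y $ l - q $ l)\<^sup>2) ^ M \<le> (\<delta>\<^sup>2) ^ M" for y :: "real^'n"
    by (intro power_mono) auto
  moreover have "0 \<le> B'" unfolding B'_def using B assms by auto
  ultimately have "dir_Ck ?e ?W (max B' ((\<delta>\<^sup>2) ^ M)) (Suc k)
     (\<lambda>y. complex_of_real (max 0 (\<delta>\<^sup>2 - (y $ l - q $ l)\<^sup>2) ^ M))" "0 \<le> max B' ((\<delta>\<^sup>2) ^ M)"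
    by (intro dir_Ck_SucI[where f'=f'] dir_Ck_mono[OF f'])
       (auto intro!: continuous_intros simp: norm_power max.coboundedI1 max.coboundedI2)
  then show ?case by blast
qed

text \<open>The power \<open>M\<close> provides \<open>M - 1\<close> continuous derivatives across
  the boundary of the support \<open>cube q (2 * \<delta>)\<close>. The product runs over the dummy
  coordinate too, so that the support is compact in the whole space.\<close>

definition bump :: "real^'n \<Rightarrow> real \<Rightarrow> nat \<Rightarrow> real^'n \<Rightarrow> real" where
  "bump q \<delta> M y = (\<Prod>l\<in>UNIV. max 0 (\<delta>\<^sup>2 - (y $ l - q $ l)\<^sup>2) ^ M)"

lemma dir_Ck_bump:
  assumes "0 < \<delta>" "k < M"
  shows "\<exists>B\<ge>0. dir_Ck (axis i 1) {y. \<forall>i. \<bar>y $ i - q $ i\<bar> < 2 * \<delta>} B k (\<lambda>y. complex_of_real (bump q \<delta> M y))"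
  using dir_Ck_prod[OF finite dir_Ck_bump_factor[OF assms]] by (simp add: bump_def)

lemma bump_nonneg: "0 \<le> bump q \<delta> M y"
  by (auto simp: bump_def intro: prod_nonneg)

lemma bump_eq_0:
  assumes "0 < \<delta>" "0 < M" "y \<notin> cube q (2 * \<delta>)"
  shows "bump q \<delta> M y = 0"
proof -
  obtain i where "\<delta> < \<bar>y $ i - q $ i\<bar>" using assms(3) by (auto simp: cube_def not_le)
  then have "\<delta>\<^sup>2 < (y $ i - q $ i)\<^sup>2" using assms(1) abs_le_square_iff[of "y $ i - q $ i" \<delta>] by (simp add: not_le)
  then show ?thesis unfolding bump_def using assms(2) by (intro prod_zero bexI[of _ i]) auto
qed

lemma continuous_on_bump: "continuous_on A (bump q \<delta> M)"
  unfolding bump_def by (intro continuous_intros)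

text \<open>On the cube of half the side every quadratic is at least
  \<open>\<delta>^2 - (\<delta> / 2)^2\<close>. This lower bound is what lets a multiple of the
  image measure dominate the Hausdorff measure.\<close>

lemma bump_ge:
  assumes "y \<in> cube q \<delta>" "0 < \<delta>"
  shows "((3 / 4 * \<delta>\<^sup>2) ^ M) ^ CARD('n) \<le> bump q \<delta> M (y :: real^'n)"
proof -
  have "(3 / 4 * \<delta>\<^sup>2) ^ M \<le> max 0 (\<delta>\<^sup>2 - (y $ l - q $ l)\<^sup>2) ^ M" for l
  proof (rule power_mono)
    have "\<bar>y $ l - q $ l\<bar> \<le> \<bar>\<delta> / 2\<bar>" using assms by (auto simp: cube_def)
    then have "(y $ l - q $ l)\<^sup>2 \<le> (\<delta> / 2)\<^sup>2" by (simp only: abs_le_square_iff)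
    then show "3 / 4 * \<delta>\<^sup>2 \<le> max 0 (\<delta>\<^sup>2 - (y $ l - q $ l)\<^sup>2)" by (simp add: power_divide le_max_iff_disj)
  qed (use assms in auto)
  then have "(\<Prod>l\<in>(UNIV::'n set). (3 / 4 * \<delta>\<^sup>2) ^ M) \<le> bump q \<delta> M y"
    unfolding bump_def by (intro prod_mono) auto
  then show ?thesis by simp
qed

section \<open>Autocorrelation of an integral\<close>

lemma nn_integral_lborel_prod_cart:
  fixes f :: "'n::finite \<Rightarrow> real \<Rightarrow> ennreal"
  assumes [measurable]: "\<And>i. f i \<in> borel_measurable borel"
  shows "(\<integral>\<^sup>+y. (\<Prod>i\<in>UNIV. f i ((y::real^'n) $ i)) \<partial>lborel) = (\<Prod>i\<in>UNIV. (\<integral>\<^sup>+t. f i t \<partial>lborel))"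
proof -
  \<comment> \<open>\<open>f\<close> is indexed by coordinates, the product formula by basis
    vectors; \<open>g\<close> recovers the index of a unit vector.\<close>
  define g where "g = (\<lambda>b::real^'n. f (SOME i. axis i 1 = b))"
  have g: "g (axis i 1) = f i" for i by (simp add: g_def axis_eq_axis)
  have B: "(Basis :: (real^'n) set) = range (\<lambda>i. axis i 1)" by (auto simp: Basis_vec_def)
  have inj: "inj (\<lambda>i. axis i (1::real) :: real^'n)" by (auto simp: inj_def axis_eq_axis)
  have "(\<integral>\<^sup>+y. (\<Prod>b\<in>Basis. g b ((y::real^'n) \<bullet> b)) \<partial>lborel) = (\<Prod>b\<in>Basis. (\<integral>\<^sup>+t. g b t \<partial>lborel))"
    by (rule nn_integral_lborel_prod) (auto simp: g_def)
  then show ?thesis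
    unfolding B prod.reindex[OF inj] by (simp add: g inner_axis)
qed

lemma nn_integral_inverse_square_decay:
  assumes "0 < r"
  shows "(\<integral>\<^sup>+t. ennreal ((1 / (1 + r * \<bar>t\<bar>))\<^sup>2) \<partial>lborel) \<le> ennreal (2 / r)"
proof -
  let ?f = "\<lambda>t::real. ennreal ((1 / (1 + r * \<bar>t\<bar>))\<^sup>2)"
  define G where "G = (\<lambda>t. - (1 / r) * inverse (1 + r * t))"
  have "(\<integral>\<^sup>+t. ennreal ((1 / (1 + r * \<bar>t\<bar>))\<^sup>2) * indicator {0..} t \<partial>lborel) = ennreal (0 - G 0)"
  proof (rule nn_integral_FTC_atLeast)
    show "DERIV G t :> (1 / (1 + r * \<bar>t\<bar>))\<^sup>2" if "0 \<le> t" for t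
    proof -
      have "1 + r * t > 0" using assms that by (simp add: add_pos_nonneg)
      then show ?thesis unfolding G_def using assms that
        by (auto intro!: derivative_eq_intros simp: power2_eq_square inverse_eq_divide)
    qed
    show "(G \<longlongrightarrow> 0) at_top" unfolding G_def using assms by real_asymp
  qed auto
  then have A: "(\<integral>\<^sup>+t. ?f t * indicator {0..} t \<partial>lborel) = ennreal (1 / r)"
    by (simp add: G_def)
  have "(\<integral>\<^sup>+t. ?f t \<partial>lborel) \<le> (\<integral>\<^sup>+t. ?f t * indicator {0..} t + ?f t * indicator {0..} (- t) \<partial>lborel)"
    by (intro nn_integral_mono) (auto simp: indicator_def)
  also have "\<dots> = (\<integral>\<^sup>+t. ?f t * indicator {0..} t \<partial>lborel) + (\<integral>\<^sup>+t. ?f t * indicator {0..} (- t) \<partial>lborel)"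
    by (intro nn_integral_add) auto
  also have "(\<integral>\<^sup>+t. ?f t * indicator {0..} (- t) \<partial>lborel) = (\<integral>\<^sup>+t. ?f t * indicator {0..} t \<partial>lborel)"
    by (subst nn_integral_real_affine[of _ "-1" 0]) auto
  also have "(\<integral>\<^sup>+t. ?f t * indicator {0..} t \<partial>lborel) + (\<integral>\<^sup>+t. ?f t * indicator {0..} t \<partial>lborel) = ennreal (2 / r)"
    unfolding A using assms by (subst ennreal_plus[symmetric]) auto
  finally show ?thesis .
qed

text \<open>The integral over the shifts: the dummy coordinate is confined to an interval of length
  \<open>4 * \<delta>\<close>, and each of the other coordinates contributes at most
  \<open>2 / r\<close>.\<close>

lemma nn_integral_decay_product:
  fixes j :: "'n::finite"
  assumes "0 < r" "0 < \<delta>"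
  shows "(\<integral>\<^sup>+h. ennreal (indicator {- 2 * \<delta>..2 * \<delta>} (h $ j) * (\<Prod>i\<in>UNIV - {j}. (1 / (1 + r * \<bar>h $ i\<bar>))\<^sup>2))
      \<partial>(lborel :: (real^'n) measure)) \<le> ennreal (4 * \<delta> * (2 / r) ^ (CARD('n) - 1))"
proof -
  define f :: "'n \<Rightarrow> real \<Rightarrow> ennreal" where
    "f = (\<lambda>i t. if i = j then indicator {- 2 * \<delta>..2 * \<delta>} t else ennreal ((1 / (1 + r * \<bar>t\<bar>))\<^sup>2))"
  have fm[measurable]: "f i \<in> borel_measurable borel" for i
    unfolding f_def by (cases "i = j") auto
  have split: "(\<Prod>i\<in>UNIV. g i) = g j * (\<Prod>i\<in>UNIV - {j}. g i)" for g :: "'n \<Rightarrow> ennreal"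
    by (rule prod.remove) auto
  have "ennreal (indicator {- 2 * \<delta>..2 * \<delta>} (h $ j) * (\<Prod>i\<in>UNIV - {j}. (1 / (1 + r * \<bar>h $ i\<bar>))\<^sup>2))
      = (\<Prod>i\<in>UNIV. f i (h $ i))" for h :: "real^'n"
    unfolding split by (simp add: f_def ennreal_mult prod_nonneg prod_ennreal[symmetric] ennreal_indicator)
  then have "(\<integral>\<^sup>+h. ennreal (indicator {- 2 * \<delta>..2 * \<delta>} (h $ j) * (\<Prod>i\<in>UNIV - {j}. (1 / (1 + r * \<bar>h $ i\<bar>))\<^sup>2))
      \<partial>(lborel :: (real^'n) measure)) = (\<Prod>i\<in>UNIV. (\<integral>\<^sup>+t. f i t \<partial>lborel))"
    by (simp add: nn_integral_lborel_prod_cart[OF fm])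
  also have "\<dots> = (\<integral>\<^sup>+t. indicator {- 2 * \<delta>..2 * \<delta>} t \<partial>(lborel::real measure)) *
      (\<Prod>i\<in>UNIV - {j}. (\<integral>\<^sup>+t. ennreal ((1 / (1 + r * \<bar>t\<bar>))\<^sup>2) \<partial>lborel))"
    unfolding split by (simp add: f_def)
  also have "\<dots> \<le> ennreal (4 * \<delta>) * (\<Prod>i\<in>UNIV - {j}. ennreal (2 / r))"
    unfolding prod_constant using assms
    by (intro mult_mono power_mono nn_integral_inverse_square_decay) auto
  also have "\<dots> = ennreal (4 * \<delta> * (2 / r) ^ (CARD('n) - 1))"
    using assms by (simp add: ennreal_mult ennreal_power card_Diff_singleton)
  finally show ?thesis .
qed

text \<open>Expand the squared modulus as a double integral and substitute \<open>y + h\<close> for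
  one of the variables; Fubini leaves the autocorrelation, integrated over \<open>h\<close>.\<close>

lemma norm_integral_autocorrelation:
  fixes F :: "'a::euclidean_space \<Rightarrow> complex"
  assumes [measurable]: "F \<in> borel_measurable borel" and F: "\<And>y. y \<notin> K \<Longrightarrow> F y = 0" "\<And>y. norm (F y) \<le> B"
    and K: "compact K"
    and J: "\<And>h. norm (\<integral>y. F (y + h) * cnj (F y) \<partial>lborel) \<le> b h"
  shows "ennreal ((norm (\<integral>y. F y \<partial>lborel))\<^sup>2) \<le> (\<integral>\<^sup>+h. ennreal (b h) \<partial>lborel)"
proof -
  \<comment> \<open>The difference set of \<open>K\<close>: the integrand vanishes unless
    \<open>h\<close> lies in it, which makes it integrable on the product.\<close>
  define D where "D = (\<lambda>(a, b). a - b) ` (K \<times> K)"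
  have D: "compact D" unfolding D_def
    by (intro compact_continuous_image compact_Times K) (auto intro!: continuous_intros simp: case_prod_unfold)
  have [measurable]: "K \<in> sets borel" "D \<in> sets borel" using K D by (auto intro: borel_compact)
  have [measurable]: "cnj \<in> borel_measurable borel"
    by (intro borel_measurable_continuous_onI continuous_intros)
  have "0 \<le> B" using order_trans[OF norm_ge_zero F(2)] by blast
  have i: "integrable (lborel \<Otimes>\<^sub>M lborel) (\<lambda>(y, h). F (y + h) * cnj (F y))"
  proof (rule integrableI_bounded_set[where A="K \<times> D" and B="B * B"])
    show "emeasure (lborel \<Otimes>\<^sub>M lborel) (K \<times> D) < \<infinity>"
      using emeasure_compact_finite[OF K] emeasure_compact_finite[OF D]
      by (subst lborel.emeasure_pair_measure_Times) (auto simp: ennreal_mult_less_top)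
    show "AE p in lborel \<Otimes>\<^sub>M lborel. p \<in> K \<times> D \<longrightarrow> norm (case p of (y, h) \<Rightarrow> F (y + h) * cnj (F y)) \<le> B * B"
      using F(2) \<open>0 \<le> B\<close> by (intro AE_I2) (auto simp: norm_mult intro!: mult_mono)
    show "AE p in lborel \<Otimes>\<^sub>M lborel. p \<notin> K \<times> D \<longrightarrow> (case p of (y, h) \<Rightarrow> F (y + h) * cnj (F y)) = 0"
    proof (intro AE_I2 impI)
      fix p assume "p \<notin> K \<times> D"
      then obtain y h where p: "p = (y, h)" and n: "(y, h) \<notin> K \<times> D" by (cases p) auto
      have "F (y + h) * cnj (F y) = 0"
      proof (rule ccontr)
        assume "F (y + h) * cnj (F y) \<noteq> 0"
        then have "y \<in> K" "y + h \<in> K" using F(1) by fastforce+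
        then have "h \<in> D" unfolding D_def by (intro image_eqI[of _ _ "(y + h, y)"]) auto
        with \<open>y \<in> K\<close> n show False by simp
      qed
      then show "(case p of (y, h) \<Rightarrow> F (y + h) * cnj (F y)) = 0" by (simp add: p)
    qed
  qed measurable
  have "(\<integral>y. F y \<partial>lborel) * cnj (\<integral>y. F y \<partial>lborel) = (\<integral>y. (\<integral>h. F (y + h) \<partial>lborel) * cnj (F y) \<partial>lborel)"
    using integral_translation_lborel[of F] by (simp add: add.commute)
  also have "\<dots> = (\<integral>y. (\<integral>h. F (y + h) * cnj (F y) \<partial>lborel) \<partial>lborel)"
    by simp
  also have "\<dots> = (\<integral>h. (\<integral>y. F (y + h) * cnj (F y) \<partial>lborel) \<partial>lborel)"
    using lborel_pair.Fubini_integral[OF i] by simp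
  finally have "(norm (\<integral>y. F y \<partial>lborel))\<^sup>2 = norm (\<integral>h. (\<integral>y. F (y + h) * cnj (F y) \<partial>lborel) \<partial>lborel)"
    by (metis complex_mod_cnj norm_mult power2_eq_square)
  also have "ennreal \<dots> \<le> (\<integral>\<^sup>+h. norm (\<integral>y. F (y + h) * cnj (F y) \<partial>lborel) \<partial>lborel)"
    by (rule integral_norm_bound_ennreal) (use lborel_pair.integrable_snd[OF i] in simp)
  also have "\<dots> \<le> (\<integral>\<^sup>+h. ennreal (b h) \<partial>lborel)"
    by (intro nn_integral_mono ennreal_leI J)
  finally show ?thesis .
qed

section \<open>Fourier decay over nondegenerate graphs\<close>

lemma cube_eq_cbox: "cube q r = cbox (\<chi> i. q $ i - r / 2) (\<chi> i. q $ i + r / 2)"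
proof -
  have "\<bar>a - b\<bar> \<le> r / 2 \<longleftrightarrow> b - r / 2 \<le> a \<and> a \<le> b + r / 2" for a b :: real by linarith
  then show ?thesis by (simp add: set_eq_iff cube_def mem_box_cart)
qed

lemma compact_cube: "compact (cube q r)"
  unfolding cube_eq_cbox by (rule compact_cbox)

text \<open>The inner product of \<open>x\<close> with the point of the graph over \<open>y\<close>,
  whose coordinate \<open>j\<close> is \<open>\<phi> y\<close>.\<close>

definition graph_phase :: "'n \<Rightarrow> (real^'n \<Rightarrow> real) \<Rightarrow> real^'n \<Rightarrow> real^'n \<Rightarrow> real" where
  "graph_phase j \<phi> x y = (\<Sum>i\<in>UNIV - {j}. x $ i * y $ i) + x $ j * \<phi> y"

text \<open>\<open>m i\<close> is the slope of \<open>\<phi>\<close> in direction \<open>i\<close>.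
  \<open>reg_diff\<close> and \<open>nondeg\<close> bound differences of slopes from above and below
  by multiples of the same \<open>size h\<close>, so dividing by it gives phases with bounds uniform
  in \<open>h\<close>. In \<open>nondeg\<close> the direction may depend on \<open>h\<close> but not
  on \<open>y\<close>. \<open>N\<close> is the number of integrations by parts.\<close>

locale nondegenerate_graph =
  fixes j :: "'n::finite" and q :: "real^'n" and \<delta> :: real
    and \<phi> :: "real^'n \<Rightarrow> real" and m :: "'n \<Rightarrow> real^'n \<Rightarrow> real" and c :: real
    and W :: "(real^'n) set" and size :: "real^'n \<Rightarrow> real" and N :: nat
  defines "W \<equiv> {y. \<forall>i. \<bar>y $ i - q $ i\<bar> < 2 * \<delta>}"
    and "size \<equiv> \<lambda>h. \<Sum>i\<in>UNIV - {j}. \<bar>h $ i\<bar>"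
    and "N \<equiv> 2 * (CARD('n) - 1)"
  assumes dim: "2 \<le> CARD('n)" and \<delta>: "0 < \<delta>" and c: "0 < c"
    and cont: "continuous_on W \<phi>"
    and deriv: "\<And>i y. i \<noteq> j \<Longrightarrow> y \<in> W \<Longrightarrow>
      ((\<lambda>t. \<phi> (y + t *\<^sub>R axis i 1)) has_vector_derivative m i y) (at 0)"
    and reg: "\<And>i k. i \<noteq> j \<Longrightarrow> \<exists>B\<ge>0. dir_Ck (axis i 1) W B k (\<lambda>y. complex_of_real (m i y))"
    and reg_diff: "\<And>i k. i \<noteq> j \<Longrightarrow> \<exists>B\<ge>0. \<forall>h. dir_Ck (axis i 1) (W \<inter> {y. y + h \<in> W}) (B * size h) k
        (\<lambda>y. complex_of_real (m i (y + h) - m i y))"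
    and nondeg: "\<And>h. \<exists>i. i \<noteq> j \<and> (\<forall>y\<in>W. y + h \<in> W \<longrightarrow> c * size h \<le> \<bar>m i (y + h) - m i y\<bar>)"
begin

text \<open>The power exceeds \<open>N\<close> by one because \<open>dir_Ck_bump\<close> requires
  \<open>k < M\<close>.\<close>

abbreviation (input) \<psi> :: "real^'n \<Rightarrow> real" where "\<psi> \<equiv> bump q \<delta> (Suc N)"

lemma open_W: "open W"
proof -
  have "W = (\<Inter>i\<in>UNIV. (\<lambda>y. \<bar>y $ i - q $ i\<bar>) -` {..< 2 * \<delta>})" by (auto simp: W_def)
  moreover have "open ((\<lambda>y::real^'n. \<bar>y $ i - q $ i\<bar>) -` {..< 2 * \<delta>})" for i
    by (intro open_vimage continuous_intros)
  ultimately show ?thesis by auto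
qed

lemma cube_subset_W: "cube q (2 * \<delta>) \<subseteq> W"
  using \<delta> by (auto simp: cube_def W_def intro: le_less_trans)

lemma \<psi>_eq_0: "y \<notin> cube q (2 * \<delta>) \<Longrightarrow> \<psi> y = 0"
  using bump_eq_0[OF \<delta>, of "Suc N"] by auto

lemma \<psi>_reg: "\<exists>B\<ge>0. dir_Ck (axis i 1) W B N (\<lambda>y. complex_of_real (\<psi> y))"
  using dir_Ck_bump[OF \<delta>, of N "Suc N" i q] by (simp add: W_def)

lemma phase_deriv:
  assumes "i \<noteq> j" "y \<in> W"
  shows "((\<lambda>t. graph_phase j \<phi> x (y + t *\<^sub>R axis i 1)) has_vector_derivative x $ i + x $ j * m i y) (at 0)"
proof -
  have "((\<lambda>t. \<Sum>l\<in>UNIV - {j}. x $ l * (y + t *\<^sub>R axis i 1) $ l) has_vector_derivative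
      (\<Sum>l\<in>UNIV - {j}. x $ l * (axis i 1 :: real^'n) $ l)) (at 0)"
    by (intro has_vector_derivative_sum)
       (auto intro!: derivative_eq_intros simp: has_real_derivative_iff_has_vector_derivative[symmetric])
  also have "(\<Sum>l\<in>UNIV - {j}. x $ l * (axis i 1 :: real^'n) $ l) = x $ i"
    using assms(1) by (simp add: axis_def if_distrib cong: if_cong)
  finally have "((\<lambda>t. \<Sum>l\<in>UNIV - {j}. x $ l * (y + t *\<^sub>R axis i 1) $ l) has_vector_derivative x $ i) (at 0)" .
  then show ?thesis
    unfolding graph_phase_def
    by (intro has_vector_derivative_add has_vector_derivative_mult_right deriv[OF assms])
qed

lemma phase_cont: "continuous_on W (graph_phase j \<phi> x)"
  unfolding graph_phase_def by (intro continuous_intros cont)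

definition F :: "real^'n \<Rightarrow> real^'n \<Rightarrow> complex" where
  "F x y = exp (\<i> * complex_of_real (- 2 * pi * graph_phase j \<phi> x y)) * complex_of_real (\<psi> y)"

lemma F_eq_0: "y \<notin> cube q (2 * \<delta>) \<Longrightarrow> F x y = 0"
  by (simp add: F_def \<psi>_eq_0)

lemma F_measurable: "F x \<in> borel_measurable borel"
proof -
  have "integrable lborel (F x)"
    unfolding F_def
    by (rule integrable_compact_support[OF compact_cube cube_subset_W])
       (auto simp: \<psi>_eq_0 intro!: continuous_intros phase_cont continuous_on_bump)
  then show ?thesis by auto
qed

lemma F_bound: "\<exists>B\<ge>0. \<forall>x y. norm (F x y) \<le> B"
proof -
  obtain B where B: "0 \<le> B" "dir_Ck (axis j 1) W B N (\<lambda>y. complex_of_real (\<psi> y))"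
    using \<psi>_reg by blast
  have "norm (F x y) \<le> B" for x y
  proof (cases "y \<in> W")
    case True
    have "norm (F x y) = norm (complex_of_real (\<psi> y))"
      by (simp add: F_def norm_mult)
    then show ?thesis using dir_Ck_bound[OF B(2) True] by simp
  next
    case False
    then have "y \<notin> cube q (2 * \<delta>)" using cube_subset_W by blast
    then show ?thesis using F_eq_0 B(1) by simp
  qed
  with B(1) show ?thesis by blast
qed

section \<open>Nonstationary directions of the phase and of its differences\<close>

text \<open>When \<open>x $ j\<close> is small and \<open>x $ i\<close> carries a fixed share of
  \<open>norm x\<close>, the derivative \<open>x $ i + x $ j * m i y\<close> stays away from 0, so
  the phase itself has no stationary point.\<close>

lemma steep_decay_direction:
  assumes i: "i \<noteq> j"
  shows "\<exists>\<kappa>>0. \<exists>C\<ge>0. \<forall>x. x \<noteq> 0 \<longrightarrow> \<bar>x $ j\<bar> \<le> \<kappa> * norm x \<longrightarrow> norm x \<le> 2 * CARD('n) * \<bar>x $ i\<bar> \<longrightarrow>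
    norm (\<integral>y. F x y \<partial>lborel) \<le> C * (1 / norm x) ^ N"
proof -
  define n where "n = real CARD('n)"
  have n: "n > 0" by (simp add: n_def)
  then have n4: "0 < 1 / (4 * n)" by simp
  obtain B1 where B1: "0 \<le> B1" "dir_Ck (axis i 1) W B1 N (\<lambda>y. complex_of_real (m i y))"
    using reg[OF i] by blast
  obtain B2 where B2: "0 \<le> B2" "dir_Ck (axis i 1) W B2 N (\<lambda>y. complex_of_real (\<psi> y))"
    using \<psi>_reg by blast
  \<comment> \<open>With this choice \<open>x $ j * m i y\<close> is at most
    \<open>norm x / (4 * n)\<close>, half of the lower bound for \<open>\<bar>x $ i\<bar>\<close>.
    The summand 1 keeps the denominator positive.\<close>
  define \<kappa> where "\<kappa> = 1 / (4 * n * (B1 + 1))"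
  have \<kappa>: "\<kappa> > 0" using n B1 by (simp add: \<kappa>_def)
  define B where "B = max (1 + B1) B2"
  have B: "0 \<le> B" using B1 B2 by (simp add: B_def)
  obtain C where C: "0 \<le> C" "\<And>W K a \<theta> \<theta>' r.
     nonstationary (axis i 1 :: real^'n) (1 / (4 * n)) (measure lborel (cube q (2 * \<delta>))) B N W K a \<theta> \<theta>' \<Longrightarrow> 0 < r \<Longrightarrow>
     norm (\<integral>y. exp (\<i> * complex_of_real (r * \<theta> y)) * a y \<partial>lborel) \<le> C * (1 / r) ^ N"
    using nonstationary_phase[OF n4 measure_nonneg B, of lborel "cube q (2 * \<delta>)" N, where 'a="real^'n"]
    by blast
  have "norm (\<integral>y. F x y \<partial>lborel) \<le> C * (1 / norm x) ^ N"
    if x: "x \<noteq> 0" "\<bar>x $ j\<bar> \<le> \<kappa> * norm x" "norm x \<le> 2 * CARD('n) * \<bar>x $ i\<bar>" for x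
  proof -
    have nx: "norm x > 0" using x by simp
    define \<theta> where "\<theta> = (\<lambda>y. - (1 / norm x) * graph_phase j \<phi> x y)"
    define \<theta>' where "\<theta>' = (\<lambda>y. - (1 / norm x) * (x $ i + x $ j * m i y))"
    have d: "\<forall>y\<in>W. ((\<lambda>t. \<theta> (y + t *\<^sub>R axis i 1)) has_vector_derivative \<theta>' y) (at 0)"
      unfolding \<theta>_def \<theta>'_def by (intro ballI has_vector_derivative_mult_right phase_deriv i)
    have c\<theta>: "continuous_on W \<theta>" unfolding \<theta>_def by (intro continuous_intros phase_cont)
    have "dir_Ck (axis i 1) W (1 + B1) N
       (\<lambda>y. complex_of_real (- (1 / norm x) * x $ i) + complex_of_real (- (1 / norm x) * x $ j) * complex_of_real (m i y))"
    proof (rule dir_Ck_add)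
      show "dir_Ck (axis i 1) W 1 N (\<lambda>y. complex_of_real (- (1 / norm x) * x $ i))"
        using component_le_norm_cart[of x i] nx by (intro dir_Ck_const) (simp add: norm_mult norm_divide)
      show "dir_Ck (axis i 1) W B1 N (\<lambda>y. complex_of_real (- (1 / norm x) * x $ j) * complex_of_real (m i y))"
      proof (rule dir_Ck_mono[OF dir_Ck_cmult[OF B1(2)]])
        have "norm (complex_of_real (- (1 / norm x) * x $ j)) \<le> 1"
          using component_le_norm_cart[of x j] nx by (simp add: norm_mult norm_divide)
        from mult_right_mono[OF this B1(1)]
        show "norm (complex_of_real (- (1 / norm x) * x $ j)) * B1 \<le> B1" by simp
      qed
    qed
    also have "(\<lambda>y. complex_of_real (- (1 / norm x) * x $ i) + complex_of_real (- (1 / norm x) * x $ j) * complex_of_real (m i y))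
       = (\<lambda>y. complex_of_real (\<theta>' y))"
      by (simp add: \<theta>'_def algebra_simps)
    finally have r\<theta>': "dir_Ck (axis i 1) W B N (\<lambda>y. complex_of_real (\<theta>' y))"
      by (rule dir_Ck_mono) (simp add: B_def)
    have lb: "1 / (4 * n) \<le> \<bar>\<theta>' y\<bar>" if "y \<in> W" for y
    proof -
      have "\<bar>m i y\<bar> \<le> B1" using dir_Ck_bound[OF B1(2) that] by simp
      then have "\<bar>x $ j * m i y\<bar> \<le> (\<kappa> * norm x) * B1"
        unfolding abs_mult using x(2) \<kappa> by (intro mult_mono) auto
      also have "\<dots> \<le> (\<kappa> * norm x) * (B1 + 1)" using \<kappa> by (intro mult_left_mono) auto
      also have "\<dots> = norm x / (4 * n)" using B1(1) n by (simp add: \<kappa>_def)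
      finally have 1: "\<bar>x $ j * m i y\<bar> \<le> norm x / (4 * n)" .
      have 2: "norm x / (2 * n) \<le> \<bar>x $ i\<bar>" using x(3) n by (simp add: n_def field_simps)
      have 3: "norm x / (2 * n) = norm x / (4 * n) + norm x / (4 * n)" by simp
      have "norm x / (4 * n) \<le> \<bar>x $ i + x $ j * m i y\<bar>" using 1 2 unfolding 3 by linarith
      then have "norm x / (4 * n) / norm x \<le> \<bar>x $ i + x $ j * m i y\<bar> / norm x"
        by (rule divide_right_mono) simp
      then show ?thesis using nx by (simp add: \<theta>'_def abs_mult)
    qed
    have "norm (\<integral>y. exp (\<i> * complex_of_real ((2 * pi * norm x) * \<theta> y)) * complex_of_real (\<psi> y) \<partial>lborel)
        \<le> C * (1 / (2 * pi * norm x)) ^ N"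
    proof (rule C(2))
      show "nonstationary (axis i 1) (1 / (4 * n)) (measure lborel (cube q (2 * \<delta>))) B N W (cube q (2 * \<delta>))
          (\<lambda>y. complex_of_real (\<psi> y)) \<theta> \<theta>'"
        unfolding nonstationary_def
        using open_W compact_cube cube_subset_W c\<theta> d r\<theta>' lb \<psi>_eq_0 dir_Ck_mono[OF B2(2), of B]
        by (simp add: B_def)
    qed (use nx in simp)
    also have "(\<lambda>y. exp (\<i> * complex_of_real ((2 * pi * norm x) * \<theta> y)) * complex_of_real (\<psi> y)) = F x"
      using nx by (simp add: fun_eq_iff F_def \<theta>_def mult.assoc)
    also have "C * (1 / (2 * pi * norm x)) ^ N \<le> C * (1 / norm x) ^ N"
    proof (intro mult_left_mono power_mono C(1) divide_left_mono)
      have "1 * norm x \<le> 2 * pi * norm x" using pi_gt3 by (intro mult_right_mono) auto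
      then show "norm x \<le> 2 * pi * norm x" by simp
    qed (use nx in auto)
    finally show ?thesis .
  qed
  then show ?thesis using \<kappa> C(1) by blast
qed

text \<open>In the phase of \<open>F x (y + h) * cnj (F x y)\<close> the linear part is constant in
  \<open>y\<close>, so its derivative along axis \<open>i\<close> is
  \<open>x $ j * (m i (y + h) - m i y)\<close> up to a constant. Taking
  \<open>\<bar>x $ j\<bar> * size h\<close> as the large parameter normalises it.\<close>

lemma flat_decay_direction:
  assumes i: "i \<noteq> j"
  shows "\<exists>C\<ge>0. \<forall>x h. x $ j \<noteq> 0 \<longrightarrow> 0 < size h \<longrightarrow>
    (\<forall>y\<in>W. y + h \<in> W \<longrightarrow> c * size h \<le> \<bar>m i (y + h) - m i y\<bar>) \<longrightarrow>
    norm (\<integral>y. F x (y + h) * cnj (F x y) \<partial>lborel) \<le> C * (1 / (\<bar>x $ j\<bar> * size h)) ^ N"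
proof -
  obtain B1 where B1: "0 \<le> B1" "\<And>h. dir_Ck (axis i 1) (W \<inter> {y. y + h \<in> W}) (B1 * size h) N
        (\<lambda>y. complex_of_real (m i (y + h) - m i y))"
    using reg_diff[OF i] by blast
  obtain B2 where B2: "0 \<le> B2" "dir_Ck (axis i 1) W B2 N (\<lambda>y. complex_of_real (\<psi> y))"
    using \<psi>_reg by blast
  define B where "B = max B1 (2 ^ N * B2 * B2)"
  have B: "0 \<le> B" using B1 B2 by (simp add: B_def)
  obtain C where C: "0 \<le> C" "\<And>W K a \<theta> \<theta>' r.
     nonstationary (axis i 1 :: real^'n) (c) (measure lborel (cube q (2 * \<delta>))) B N W K a \<theta> \<theta>' \<Longrightarrow> 0 < r \<Longrightarrow>
     norm (\<integral>y. exp (\<i> * complex_of_real (r * \<theta> y)) * a y \<partial>lborel) \<le> C * (1 / r) ^ N"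
    using nonstationary_phase[OF c measure_nonneg B, of lborel "cube q (2 * \<delta>)" N, where 'a="real^'n"]
    by blast
  have "norm (\<integral>y. F x (y + h) * cnj (F x y) \<partial>lborel) \<le> C * (1 / (\<bar>x $ j\<bar> * size h)) ^ N"
    if x: "x $ j \<noteq> 0" and h: "0 < size h"
      and nd: "\<forall>y\<in>W. y + h \<in> W \<longrightarrow> c * size h \<le> \<bar>m i (y + h) - m i y\<bar>" for x h
  proof -
    define r where "r = \<bar>x $ j\<bar> * size h"
    have r: "r > 0" using x h by (simp add: r_def)
    define Wh where "Wh = W \<inter> {y. y + h \<in> W}"
    define Kh where "Kh = cube q (2 * \<delta>) \<inter> {y. y + h \<in> cube q (2 * \<delta>)}"
    have sh: "{y. y + h \<in> A} = (\<lambda>y. y + h) -` A" for A by auto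
    have Wh: "open Wh" unfolding Wh_def sh
      by (intro open_Int open_vimage open_W continuous_intros)
    have cl: "closed {y. y + h \<in> cube q (2 * \<delta>)}" unfolding sh
      by (intro closed_vimage compact_imp_closed compact_cube continuous_intros)
    have Kh: "compact Kh" unfolding Kh_def
      by (intro compact_Int_closed compact_cube cl)
    have KW: "Kh \<subseteq> Wh" using cube_subset_W by (auto simp: Kh_def Wh_def)
    have mK: "measure lborel Kh \<le> measure lborel (cube q (2 * \<delta>))"
      using Kh compact_cube[of q "2 * \<delta>"] unfolding Kh_def
      by (intro measure_mono_fmeasurable) (auto intro: borel_compact fmeasurable_compact)
    define a where "a = (\<lambda>y. complex_of_real (\<psi> (y + h)) * complex_of_real (\<psi> y))"
    have a: "dir_Ck (axis i 1) Wh B N a"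
      unfolding a_def
      by (rule dir_Ck_mono[OF dir_Ck_mult[OF B2(1) B2(1)
            dir_Ck_subset[OF dir_Ck_shift[OF B2(2)]] dir_Ck_subset[OF B2(2)]]])
         (auto simp: Wh_def B_def)
    have a0: "\<forall>y. y \<notin> Kh \<longrightarrow> a y = 0"
      using \<psi>_eq_0 by (auto simp: a_def Kh_def)
    define \<theta> where "\<theta> = (\<lambda>y. - (1 / r) * (graph_phase j \<phi> x (y + h) - graph_phase j \<phi> x y))"
    define \<theta>' where "\<theta>' = (\<lambda>y. - (1 / r) * (x $ j * (m i (y + h) - m i y)))"
    have cs: "continuous_on Wh (\<lambda>y. graph_phase j \<phi> x (y + h))"
      by (rule continuous_on_compose2[OF phase_cont, of _ "\<lambda>y. y + h"])
         (auto simp: Wh_def intro!: continuous_on_add continuous_on_id continuous_on_const)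
    have c\<theta>: "continuous_on Wh \<theta>"
      unfolding \<theta>_def
      by (intro continuous_on_mult_left continuous_on_diff cs continuous_on_subset[OF phase_cont]) (auto simp: Wh_def)
    have d: "\<forall>y\<in>Wh. ((\<lambda>t. \<theta> (y + t *\<^sub>R axis i 1)) has_vector_derivative \<theta>' y) (at 0)"
    proof
      fix y assume y: "y \<in> Wh"
      have eq: "(\<lambda>t. graph_phase j \<phi> x (y + t *\<^sub>R axis i 1 + h)) = (\<lambda>t. graph_phase j \<phi> x ((y + h) + t *\<^sub>R axis i 1))"
        by (simp add: algebra_simps)
      have 1: "((\<lambda>t. graph_phase j \<phi> x (y + t *\<^sub>R axis i 1 + h)) has_vector_derivative x $ i + x $ j * m i (y + h)) (at 0)"
        unfolding eq by (rule phase_deriv[OF i]) (use y in \<open>simp add: Wh_def\<close>)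
      have 2: "((\<lambda>t. graph_phase j \<phi> x (y + t *\<^sub>R axis i 1)) has_vector_derivative x $ i + x $ j * m i y) (at 0)"
        by (rule phase_deriv[OF i]) (use y in \<open>simp add: Wh_def\<close>)
      have "x $ i + x $ j * m i (y + h) - (x $ i + x $ j * m i y) = x $ j * (m i (y + h) - m i y)"
        by (simp add: algebra_simps)
      with has_vector_derivative_mult_right[OF has_vector_derivative_diff[OF 1 2], of "- (1 / r)"]
      show "((\<lambda>t. \<theta> (y + t *\<^sub>R axis i 1)) has_vector_derivative \<theta>' y) (at 0)"
        by (simp add: \<theta>_def \<theta>'_def)
    qed
    have nc: "norm (complex_of_real (- (1 / r) * x $ j)) = 1 / size h"
      using x h by (simp add: r_def norm_mult norm_divide)
    \<comment> \<open>The factor \<open>1 / size h\<close> cancels the \<open>size h\<close> of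
      \<open>reg_diff\<close>, which leaves a bound independent of \<open>h\<close>.\<close>
    have "dir_Ck (axis i 1) Wh (1 / size h * (B1 * size h)) N
       (\<lambda>y. complex_of_real (- (1 / r) * x $ j) * complex_of_real (m i (y + h) - m i y))"
      using dir_Ck_cmult[OF B1(2)[of h], where c="complex_of_real (- (1 / r) * x $ j)"] unfolding nc Wh_def .
    then have "dir_Ck (axis i 1) Wh B1 N (\<lambda>y. complex_of_real (\<theta>' y))"
      using h by (simp add: \<theta>'_def mult.assoc)
    then have r\<theta>': "dir_Ck (axis i 1) Wh B N (\<lambda>y. complex_of_real (\<theta>' y))"
      by (rule dir_Ck_mono) (simp add: B_def)
    have lb: "\<forall>y\<in>Wh. c \<le> \<bar>\<theta>' y\<bar>"
    proof
      fix y assume "y \<in> Wh"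
      then have "c * size h \<le> \<bar>m i (y + h) - m i y\<bar>" using nd by (auto simp: Wh_def)
      moreover have "\<bar>\<theta>' y\<bar> = \<bar>m i (y + h) - m i y\<bar> / size h"
        using x h by (simp add: \<theta>'_def r_def abs_mult)
      ultimately show "c \<le> \<bar>\<theta>' y\<bar>"
        using h by (simp add: pos_le_divide_eq)
    qed
    have "norm (\<integral>y. exp (\<i> * complex_of_real ((2 * pi * r) * \<theta> y)) * a y \<partial>lborel)
        \<le> C * (1 / (2 * pi * r)) ^ N"
      by (rule C(2)) (use Wh Kh KW mK a0 a c\<theta> d r\<theta>' lb r in \<open>simp_all add: nonstationary_def\<close>)
    also have "(\<lambda>y. exp (\<i> * complex_of_real ((2 * pi * r) * \<theta> y)) * a y)
        = (\<lambda>y. F x (y + h) * cnj (F x y))"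
    proof
      fix y
      have "exp (\<i> * complex_of_real ((2 * pi * r) * \<theta> y))
        = exp (\<i> * complex_of_real (- 2 * pi * graph_phase j \<phi> x (y + h))) *
          cnj (exp (\<i> * complex_of_real (- 2 * pi * graph_phase j \<phi> x y)))"
        using r unfolding exp_cnj exp_add[symmetric] by (simp add: \<theta>_def algebra_simps)
      then show "exp (\<i> * complex_of_real ((2 * pi * r) * \<theta> y)) * a y = F x (y + h) * cnj (F x y)"
        by (simp add: F_def a_def)
    qed
    also have "C * (1 / (2 * pi * r)) ^ N \<le> C * (1 / r) ^ N"
    proof (intro mult_left_mono power_mono C(1) divide_left_mono)
      have "1 * r \<le> 2 * pi * r" using pi_gt3 r by (intro mult_right_mono) auto
      then show "r \<le> 2 * pi * r" by simp
    qed (use r in auto)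
    finally show ?thesis by (simp add: r_def)
  qed
  then show ?thesis using C(1) by blast
qed

lemma trivial_bounds:
  "\<exists>D\<ge>0. \<forall>x. norm (\<integral>y. F x y \<partial>lborel) \<le> D \<and> (\<forall>h. norm (\<integral>y. F x (y + h) * cnj (F x y) \<partial>lborel) \<le> D)"
proof -
  obtain B where B: "0 \<le> B" "\<And>x y. norm (F x y) \<le> B" using F_bound by blast
  let ?V = "measure lborel (cube q (2 * \<delta>))"
  have "norm (\<integral>y. F x y \<partial>lborel) \<le> B * ?V" for x
    by (rule integral_norm_bound_compact_support[OF compact_cube F_eq_0]) (use B in auto)
  moreover have "norm (\<integral>y. F x (y + h) * cnj (F x y) \<partial>lborel) \<le> (B * B) * ?V" for x h
    by (rule integral_norm_bound_compact_support[OF compact_cube])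
       (use B F_eq_0 in \<open>auto simp: norm_mult intro!: mult_mono\<close>)
  moreover have "0 \<le> ?V" by simp
  ultimately show ?thesis using B(1)
    by (intro exI[of _ "max (B * ?V) ((B * B) * ?V)"]) (auto intro: max.coboundedI1 max.coboundedI2)
qed

text \<open>\<open>N\<close> is twice the number of coordinates other than \<open>j\<close>: each of
  them receives one square, in which \<open>size h\<close> is replaced by the smaller
  \<open>\<bar>h $ i\<bar>\<close>. The product can be integrated coordinate by coordinate.\<close>

lemma decay_power_le_product:
  assumes "0 \<le> r"
  shows "(1 / (1 + r * size h)) ^ N \<le> (\<Prod>i\<in>UNIV - {j}. (1 / (1 + r * \<bar>h $ i\<bar>))\<^sup>2)"
proof -
  have s: "0 \<le> size h" by (simp add: size_def sum_nonneg)
  have "(1 / (1 + r * size h)) ^ N = (\<Prod>i\<in>UNIV - {j}. (1 / (1 + r * size h))\<^sup>2)"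
    by (simp add: N_def power_mult card_Diff_singleton)
  also have "\<dots> \<le> (\<Prod>i\<in>UNIV - {j}. (1 / (1 + r * \<bar>h $ i\<bar>))\<^sup>2)"
  proof (intro prod_mono conjI power_mono divide_left_mono)
    fix i assume "i \<in> UNIV - {j}"
    then have "\<bar>h $ i\<bar> \<le> size h"
      unfolding size_def by (intro member_le_sum) auto
    then show "1 + r * \<bar>h $ i\<bar> \<le> 1 + r * size h" using assms by (simp add: mult_left_mono)
  qed (use assms s in \<open>auto intro!: mult_pos_pos add_pos_nonneg\<close>)
  finally show ?thesis .
qed

text \<open>There are three regimes: the trivial bound for \<open>norm x \<le> 1\<close>; a phase
  without stationary points when \<open>x $ j\<close> is small relative to \<open>norm x\<close>;
  and otherwise \<open>\<bar>x $ j\<bar>\<close> comparable to \<open>norm x\<close>, where the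
  autocorrelation is integrated over \<open>h\<close>.\<close>

theorem fourier_decay:
  "\<exists>C\<ge>0. \<forall>x. (norm (\<integral>y. F x y \<partial>lborel))\<^sup>2 \<le> C * (1 / (1 + norm x)) ^ (CARD('n) - 1)"
proof -
  define d where "d = CARD('n) - 1"
  have Nd: "N = d + d" by (simp add: N_def d_def)
  define Q1 where "Q1 = (\<lambda>i \<kappa> C. \<forall>x. x \<noteq> 0 \<longrightarrow> \<bar>x $ j\<bar> \<le> \<kappa> * norm x \<longrightarrow> norm x \<le> 2 * CARD('n) * \<bar>x $ i\<bar> \<longrightarrow>
    norm (\<integral>y. F x y \<partial>lborel) \<le> C * (1 / norm x) ^ N)"
  have "\<forall>i\<in>UNIV - {j}. \<exists>\<kappa>>0. \<exists>C\<ge>0. Q1 i \<kappa> C"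
    unfolding Q1_def using steep_decay_direction by blast
  then obtain \<kappa>' C1 where \<kappa>': "\<And>i. i \<in> UNIV - {j} \<Longrightarrow> \<kappa>' i > 0" and C1: "\<And>i. i \<in> UNIV - {j} \<Longrightarrow> 0 \<le> C1 i"
     and Q1: "\<And>i. i \<in> UNIV - {j} \<Longrightarrow> Q1 i (\<kappa>' i) (C1 i)"
    by metis
  define Q2 where "Q2 = (\<lambda>i C. \<forall>x h. x $ j \<noteq> 0 \<longrightarrow> 0 < size h \<longrightarrow>
    (\<forall>y\<in>W. y + h \<in> W \<longrightarrow> c * size h \<le> \<bar>m i (y + h) - m i y\<bar>) \<longrightarrow>
    norm (\<integral>y. F x (y + h) * cnj (F x y) \<partial>lborel) \<le> C * (1 / (\<bar>x $ j\<bar> * size h)) ^ N)"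
  have "\<forall>i\<in>UNIV - {j}. \<exists>C\<ge>0. Q2 i C"
    unfolding Q2_def using flat_decay_direction by blast
  then obtain C2 where C2: "\<And>i. i \<in> UNIV - {j} \<Longrightarrow> 0 \<le> C2 i" and Q2: "\<And>i. i \<in> UNIV - {j} \<Longrightarrow> Q2 i (C2 i)"
    by metis
  obtain D0 where D0: "0 \<le> D0" "\<And>x. norm (\<integral>y. F x y \<partial>lborel) \<le> D0"
      "\<And>x h. norm (\<integral>y. F x (y + h) * cnj (F x y) \<partial>lborel) \<le> D0"
    using trivial_bounds by blast
  \<comment> \<open>The value \<open>1/2\<close> leaves at least half of \<open>norm x\<close> to
    the other coordinates, so that one of them reaches \<open>norm x / (2 * CARD('n))\<close> in
    absolute value.\<close>
  define \<kappa> where "\<kappa> = Min (insert (1/2) (\<kappa>' ` (UNIV - {j})))"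
  have \<kappa>1: "0 < \<kappa>" unfolding \<kappa>_def using \<kappa>' by simp
  have \<kappa>2: "\<kappa> \<le> 1/2" unfolding \<kappa>_def by (rule Min_le) auto
  have \<kappa>3: "\<kappa> \<le> \<kappa>' i" if "i \<in> UNIV - {j}" for i
    unfolding \<kappa>_def by (rule Min_le) (use that in auto)
  note \<kappa> = \<kappa>1 \<kappa>2 \<kappa>3
  define S1 where "S1 = (\<Sum>i\<in>UNIV - {j}. C1 i)"
  define S2 where "S2 = (\<Sum>i\<in>UNIV - {j}. C2 i)"
  have S: "0 \<le> S1" "0 \<le> S2" using C1 C2 by (auto simp: S1_def S2_def intro!: sum_nonneg)
  have le: "C1 i \<le> S1" "C2 i \<le> S2" if "i \<in> UNIV - {j}" for i
    using that C1 C2 unfolding S1_def S2_def by (auto intro!: member_le_sum)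
  have steep: "norm (\<integral>y. F x y \<partial>lborel) \<le> S1 * (1 / norm x) ^ N"
    if x: "x \<noteq> 0" "\<bar>x $ j\<bar> \<le> \<kappa> * norm x" for x
  proof -
    have "\<exists>i\<in>UNIV - {j}. norm x \<le> 2 * CARD('n) * \<bar>x $ i\<bar>"
    proof (rule ccontr)
      assume "\<not> ?thesis"
      then have "\<bar>x $ i\<bar> \<le> norm x / (2 * CARD('n))" if "i \<in> UNIV - {j}" for i
        using that by (force simp: field_simps not_le)
      then have "(\<Sum>i\<in>UNIV - {j}. \<bar>x $ i\<bar>) \<le> (\<Sum>i\<in>UNIV - {j}. norm x / (2 * CARD('n)))"
        by (intro sum_mono)
      also have "\<dots> = (real CARD('n) - 1) * (norm x / (2 * CARD('n)))"
        by (simp add: card_Diff_singleton of_nat_diff)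
      also have "\<dots> < real CARD('n) * (norm x / (2 * CARD('n)))"
        using x(1) by (intro mult_strict_right_mono) auto
      also have "\<dots> = norm x / 2" by simp
      finally have "(\<Sum>i\<in>UNIV - {j}. \<bar>x $ i\<bar>) < norm x / 2" .
      moreover have "(\<Sum>i\<in>UNIV. \<bar>x $ i\<bar>) = \<bar>x $ j\<bar> + (\<Sum>i\<in>UNIV - {j}. \<bar>x $ i\<bar>)"
        by (rule sum.remove) auto
      moreover have "\<bar>x $ j\<bar> \<le> norm x / 2"
        using x(2) mult_right_mono[OF \<kappa>(2), of "norm x"] by simp
      ultimately show False using norm_le_l1_cart[of x] by linarith
    qed
    then obtain i where i: "i \<in> UNIV - {j}" "norm x \<le> 2 * CARD('n) * \<bar>x $ i\<bar>" by blast
    have "\<bar>x $ j\<bar> \<le> \<kappa>' i * norm x"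
      using x(2) mult_right_mono[OF \<kappa>(3)[OF i(1)], of "norm x"] by simp
    then have "norm (\<integral>y. F x y \<partial>lborel) \<le> C1 i * (1 / norm x) ^ N"
      using Q1[OF i(1)] x(1) i(2) by (simp add: Q1_def)
    also have "\<dots> \<le> S1 * (1 / norm x) ^ N" by (intro mult_right_mono le(1) i) simp
    finally show ?thesis .
  qed
  \<comment> \<open>\<open>D0\<close> serves for \<open>r * size h \<le> 1\<close> and
    \<open>S2\<close> otherwise; the power of 2 pays for writing \<open>1 + r * size h\<close> in
    the denominator in both cases.\<close>
  define D where "D = 2 ^ N * (D0 + S2)"
  have D: "0 \<le> D" using D0(1) S by (simp add: D_def)
  have flat: "(norm (\<integral>y. F x y \<partial>lborel))\<^sup>2 \<le> D * (4 * \<delta> * (2 / \<bar>x $ j\<bar>) ^ d)"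
    if x: "x $ j \<noteq> 0" for x
  proof -
    define r where "r = \<bar>x $ j\<bar>"
    have r: "0 < r" using x by (simp add: r_def)
    \<comment> \<open>The product does not decay in \<open>h $ j\<close>, so integrability rests on
      the cutoff: for \<open>\<bar>h $ j\<bar> > 2 * \<delta>\<close> the function
      \<open>F x\<close> and its translate have disjoint supports.\<close>
    define b where "b = (\<lambda>h::real^'n. D * (indicator {- 2 * \<delta>..2 * \<delta>} (h $ j) * (\<Prod>i\<in>UNIV - {j}. (1 / (1 + r * \<bar>h $ i\<bar>))\<^sup>2)))"
    have J: "norm (\<integral>y. F x (y + h) * cnj (F x y) \<partial>lborel) \<le> b h" for h
    proof (cases "h $ j \<in> {- 2 * \<delta>..2 * \<delta>}")
      case False
      have "F x (y + h) * cnj (F x y) = 0" for y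
      proof (rule ccontr)
        assume "F x (y + h) * cnj (F x y) \<noteq> 0"
        then have "y \<in> cube q (2 * \<delta>)" "y + h \<in> cube q (2 * \<delta>)" using F_eq_0 by fastforce+
        then have "\<bar>y $ j - q $ j\<bar> \<le> \<delta>" "\<bar>y $ j + h $ j - q $ j\<bar> \<le> \<delta>" by (auto simp: cube_def)
        with False show False by auto
      qed
      then have "(\<lambda>y. F x (y + h) * cnj (F x y)) = (\<lambda>_. 0)" by blast
      then show ?thesis using False by (simp only: Bochner_Integration.integral_zero) (simp add: b_def)
    next
      case True
      have s0: "0 \<le> size h" by (simp add: size_def sum_nonneg)
      have pos: "0 < 1 + r * size h" using r s0 by (intro add_pos_nonneg) auto
      have "norm (\<integral>y. F x (y + h) * cnj (F x y) \<partial>lborel) \<le> D * (1 / (1 + r * size h)) ^ N"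
      proof (cases "r * size h \<le> 1")
        case True
        have "1 \<le> 2 * (1 / (1 + r * size h))" using pos True by (simp add: field_simps)
        then have "1 \<le> (2 * (1 / (1 + r * size h))) ^ N" by (rule one_le_power)
        then have "1 \<le> 2 ^ N * (1 / (1 + r * size h)) ^ N" by (simp only: power_mult_distrib)
        from mult_left_mono[OF this, of "D0 + S2"]
        have "D0 + S2 \<le> D * (1 / (1 + r * size h)) ^ N"
          using D0(1) S by (simp add: D_def mult_ac)
        with D0(3)[of x h] S show ?thesis by linarith
      next
        case False
        then have s: "size h > 0" using s0 r by (cases "size h = 0") auto
        obtain i where i: "i \<in> UNIV - {j}" "\<forall>y\<in>W. y + h \<in> W \<longrightarrow> c * size h \<le> \<bar>m i (y + h) - m i y\<bar>"
          using nondeg[of h] by blast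
        have "1 / (r * size h) \<le> 2 * (1 / (1 + r * size h))"
          using False r s pos by (simp add: field_simps)
        then have "(1 / (r * size h)) ^ N \<le> (2 * (1 / (1 + r * size h))) ^ N"
          using r s by (intro power_mono) auto
        then have p: "(1 / (r * size h)) ^ N \<le> 2 ^ N * (1 / (1 + r * size h)) ^ N"
          by (simp only: power_mult_distrib)
        have "norm (\<integral>y. F x (y + h) * cnj (F x y) \<partial>lborel) \<le> C2 i * (1 / (r * size h)) ^ N"
          using Q2[OF i(1)] x s i(2) unfolding Q2_def r_def by blast
        also have "\<dots> \<le> (D0 + S2) * (2 ^ N * (1 / (1 + r * size h)) ^ N)"
          using le(2)[OF i(1)] D0(1) S p r s by (intro mult_mono) auto
        also have "\<dots> = D * (1 / (1 + r * size h)) ^ N" by (simp add: D_def mult_ac)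
        finally show ?thesis .
      qed
      also have "\<dots> \<le> b h"
        using True D r by (auto simp: b_def intro!: mult_left_mono decay_power_le_product)
      finally show ?thesis .
    qed
    obtain B where B: "\<And>y. norm (F x y) \<le> B" using F_bound by blast
    have "ennreal ((norm (\<integral>y. F x y \<partial>lborel))\<^sup>2) \<le> (\<integral>\<^sup>+h. ennreal (b h) \<partial>lborel)"
      by (rule norm_integral_autocorrelation[OF F_measurable F_eq_0 B compact_cube J])
    also have "\<dots> = ennreal D * (\<integral>\<^sup>+h. ennreal (indicator {- 2 * \<delta>..2 * \<delta>} (h $ j) * (\<Prod>i\<in>UNIV - {j}. (1 / (1 + r * \<bar>h $ i\<bar>))\<^sup>2)) \<partial>lborel)"
      unfolding b_def using D by (subst nn_integral_cmult[symmetric]) (auto simp: ennreal_mult prod_nonneg)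
    also have "\<dots> \<le> ennreal D * ennreal (4 * \<delta> * (2 / r) ^ d)"
      unfolding d_def by (intro mult_left_mono nn_integral_decay_product r \<delta>) auto
    also have "\<dots> = ennreal (D * (4 * \<delta> * (2 / r) ^ d))"
      using D \<delta> r by (simp add: ennreal_mult)
    finally show ?thesis
      using D \<delta> r by (subst (asm) ennreal_le_iff) (auto simp: r_def)
  qed
  \<comment> \<open>One summand for each regime; the factors \<open>2 ^ d\<close>, and the 4 in
    place of 2 in the last summand, come from passing to \<open>1 + norm x\<close>.\<close>
  define C where "C = 2 ^ d * D0\<^sup>2 + 2 ^ d * S1\<^sup>2 + D * (4 * \<delta> * (4 / \<kappa>) ^ d)"
  have C: "0 \<le> C" using D \<delta> \<kappa> by (simp add: C_def)
  have "(norm (\<integral>y. F x y \<partial>lborel))\<^sup>2 \<le> C * (1 / (1 + norm x)) ^ d" for x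
  proof (cases "norm x \<le> 1")
    case True
    have "1 \<le> 2 * (1 / (1 + norm x))" using True by (simp add: field_simps add_pos_nonneg)
    then have "1 \<le> (2 * (1 / (1 + norm x))) ^ d" by (rule one_le_power)
    then have "1 \<le> 2 ^ d * (1 / (1 + norm x)) ^ d" by (simp only: power_mult_distrib)
    from mult_left_mono[OF this, of "D0\<^sup>2"]
    have "D0\<^sup>2 \<le> (2 ^ d * D0\<^sup>2) * (1 / (1 + norm x)) ^ d" by (simp add: mult_ac)
    also have "\<dots> \<le> C * (1 / (1 + norm x)) ^ d"
      using D \<delta> \<kappa> by (intro mult_right_mono) (auto simp: C_def)
    finally show ?thesis
      using power_mono[OF D0(2) norm_ge_zero, of x 2] by linarith
  next
    case False
    then have nx: "1 < norm x" and x0: "x \<noteq> 0" by auto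
    have "(1 + norm x) / norm x \<le> 2"
      using nx by (subst pos_divide_le_eq) auto
    then have "1 / norm x \<le> 2 * (1 / (1 + norm x))" using nx by (simp add: field_simps)
    then have "(1 / norm x) ^ d \<le> (2 * (1 / (1 + norm x))) ^ d"
      by (intro power_mono) auto
    then have p: "(1 / norm x) ^ d \<le> 2 ^ d * (1 / (1 + norm x)) ^ d"
      by (simp only: power_mult_distrib)
    have inv1: "1 / norm x \<le> 1" using nx by (subst pos_divide_le_eq) auto
    show ?thesis
    proof (cases "\<bar>x $ j\<bar> \<le> \<kappa> * norm x")
      case True
      have "(1 / norm x) ^ N \<le> (1 / norm x) ^ d"
        using inv1 by (intro power_decreasing) (auto simp: Nd)
      then have "(1 / norm x) ^ N \<le> 1" "(1 / norm x) ^ N \<le> (1 / norm x) ^ d"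
        using inv1 by (auto intro!: power_le_one)
      then have q: "((1 / norm x) ^ N)\<^sup>2 \<le> (1 / norm x) ^ d * 1"
        unfolding power2_eq_square by (intro mult_mono) auto
      have "(norm (\<integral>y. F x y \<partial>lborel))\<^sup>2 \<le> (S1 * (1 / norm x) ^ N)\<^sup>2"
        by (intro power_mono steep True x0) auto
      also have "\<dots> = S1\<^sup>2 * ((1 / norm x) ^ N)\<^sup>2" by (rule power_mult_distrib)
      also have "\<dots> \<le> S1\<^sup>2 * (2 ^ d * (1 / (1 + norm x)) ^ d)"
        using q p by (intro mult_left_mono) auto
      also have "\<dots> = (2 ^ d * S1\<^sup>2) * (1 / (1 + norm x)) ^ d" by simp
      also have "\<dots> \<le> C * (1 / (1 + norm x)) ^ d"
        using D \<delta> \<kappa> by (intro mult_right_mono) (auto simp: C_def)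
      finally show ?thesis .
    next
      case False
      have kx: "0 < \<kappa> * norm x" using \<kappa> nx by (intro mult_pos_pos) auto
      then have "x $ j \<noteq> 0" using False by auto
      from flat[OF this] have "(norm (\<integral>y. F x y \<partial>lborel))\<^sup>2 \<le> D * (4 * \<delta> * (2 / \<bar>x $ j\<bar>) ^ d)" .
      also have "\<dots> \<le> D * (4 * \<delta> * ((2 / \<kappa>) * (1 / norm x)) ^ d)"
      proof (intro mult_left_mono power_mono D)
        have "2 / \<bar>x $ j\<bar> \<le> 2 / (\<kappa> * norm x)" using False kx by (intro divide_left_mono) auto
        then show "2 / \<bar>x $ j\<bar> \<le> (2 / \<kappa>) * (1 / norm x)" by simp
      qed (use \<delta> in auto)
      also have "\<dots> = D * (4 * \<delta> * (2 / \<kappa>) ^ d) * (1 / norm x) ^ d"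
        by (simp only: power_mult_distrib mult.assoc)
      also have "\<dots> \<le> D * (4 * \<delta> * (2 / \<kappa>) ^ d) * (2 ^ d * (1 / (1 + norm x)) ^ d)"
        using D \<delta> \<kappa> p by (intro mult_left_mono) auto
      also have "\<dots> = D * (4 * \<delta> * ((2 / \<kappa>) ^ d * 2 ^ d)) * (1 / (1 + norm x)) ^ d"
        by (simp only: mult_ac)
      also have "(2 / \<kappa>) ^ d * 2 ^ d = (4 / \<kappa>) ^ d"
        by (simp flip: power_mult_distrib)
      also have "D * (4 * \<delta> * (4 / \<kappa>) ^ d) * (1 / (1 + norm x)) ^ d \<le> C * (1 / (1 + norm x)) ^ d"
        by (intro mult_right_mono) (auto simp: C_def)
      finally show ?thesis .
    qed
  qed
  then show ?thesis using C unfolding d_def by blast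
qed

end

section \<open>Smooth functions and level sets\<close>

lemma frechet_derivative_eq: "(f has_derivative f') (at x) \<Longrightarrow> frechet_derivative f (at x) = f'"
  by (rule frechet_derivative_at[symmetric])

text \<open>Used to replace \<open>frechet_derivative\<close>, under the recursion of
  \<open>Ck_on\<close>, by an explicit derivative formula valid on the open set
  \<open>U\<close>.\<close>

lemma Ck_on_cong:
  assumes "open U" "\<And>x. x \<in> U \<Longrightarrow> f x = g x" "Ck_on k U f"
  shows "Ck_on k U g"
  using assms(2,3)
proof (induction k arbitrary: f g)
  case 0
  then show ?case using continuous_on_cong[of U U f g] by simp
next
  case (Suc k)
  have d: "(g has_derivative frechet_derivative f (at x)) (at x)" if "x \<in> U" for x
  proof -
    have "(f has_derivative frechet_derivative f (at x)) (at x)"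
      using Suc.prems(2) that by (simp add: frechet_derivative_works)
    then show ?thesis
      by (rule has_derivative_transform_within_open[OF _ \<open>open U\<close> that Suc.prems(1)])
  qed
  have "Ck_on k U (\<lambda>x. frechet_derivative g (at x) v)" for v
    by (rule Suc.IH[of "\<lambda>x. frechet_derivative f (at x) v"])
       (use Suc.prems(2) frechet_derivative_eq[OF d] in auto)
  with d show ?case by (auto simp: differentiable_def)
qed

lemma Ck_on_SucD: "Ck_on (Suc k) U f \<Longrightarrow> Ck_on k U f"
  by (induction k arbitrary: f)
     (auto intro!: continuous_at_imp_continuous_on differentiable_imp_continuous_within)

lemma Ck_on_const: "Ck_on k U (\<lambda>_. c)"
  by (induction k arbitrary: c) (auto simp: frechet_derivative_const)

lemma Ck_on_add:
  fixes f g :: "'a::real_normed_vector \<Rightarrow> real"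
  assumes "open U"
  shows "Ck_on k U f \<Longrightarrow> Ck_on k U g \<Longrightarrow> Ck_on k U (\<lambda>x. f x + g x)"
proof (induction k arbitrary: f g)
  case 0
  then show ?case by (auto intro: continuous_intros)
next
  case (Suc k)
  have d: "((\<lambda>x. f x + g x) has_derivative (\<lambda>v. frechet_derivative f (at x) v + frechet_derivative g (at x) v)) (at x)"
    if "x \<in> U" for x
    using Suc.prems that by (intro has_derivative_add) (auto simp: frechet_derivative_works)
  have "Ck_on k U (\<lambda>x. frechet_derivative (\<lambda>x. f x + g x) (at x) v)" for v
    by (rule Ck_on_cong[OF assms _ Suc.IH[of "\<lambda>x. frechet_derivative f (at x) v" "\<lambda>x. frechet_derivative g (at x) v"]])
       (use Suc.prems frechet_derivative_eq[OF d] in auto)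
  with d show ?case by (auto simp: differentiable_def)
qed

lemma Ck_on_mult:
  fixes f g :: "'a::real_normed_vector \<Rightarrow> real"
  assumes "open U"
  shows "Ck_on k U f \<Longrightarrow> Ck_on k U g \<Longrightarrow> Ck_on k U (\<lambda>x. f x * g x)"
proof (induction k arbitrary: f g)
  case 0
  then show ?case by (auto intro: continuous_intros)
next
  case (Suc k)
  have d: "((\<lambda>x. f x * g x) has_derivative (\<lambda>v. f x * frechet_derivative g (at x) v + frechet_derivative f (at x) v * g x)) (at x)"
    if "x \<in> U" for x
    using Suc.prems that by (intro has_derivative_mult) (auto simp: frechet_derivative_works)
  have "Ck_on k U (\<lambda>x. frechet_derivative (\<lambda>x. f x * g x) (at x) v)" for v
    by (rule Ck_on_cong[OF assms _ Ck_on_add[OF assms Suc.IH[of f "\<lambda>x. frechet_derivative g (at x) v"]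
        Suc.IH[of "\<lambda>x. frechet_derivative f (at x) v" g]]])
       (use Suc.prems frechet_derivative_eq[OF d] Ck_on_SucD[OF Suc.prems(1)] Ck_on_SucD[OF Suc.prems(2)] in auto)
  with d show ?case by (auto simp: differentiable_def)
qed

lemma Ck_on_inverse:
  fixes f :: "'a::real_normed_vector \<Rightarrow> real"
  assumes "open U" "\<And>x. x \<in> U \<Longrightarrow> f x \<noteq> 0"
  shows "Ck_on k U f \<Longrightarrow> Ck_on k U (\<lambda>x. inverse (f x))"
proof (induction k)
  case 0
  then show ?case using assms by (auto intro!: continuous_intros)
next
  case (Suc k)
  have d: "((\<lambda>x. inverse (f x)) has_derivative (\<lambda>v. - (inverse (f x) * frechet_derivative f (at x) v * inverse (f x)))) (at x)"
    if "x \<in> U" for x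
    using Suc.prems that assms(2) by (intro Deriv.has_derivative_inverse) (auto simp: frechet_derivative_works)
  note IH = Suc.IH[OF Ck_on_SucD[OF Suc.prems]]
  have "Ck_on k U (\<lambda>x. frechet_derivative (\<lambda>x. inverse (f x)) (at x) v)" for v
  proof (rule Ck_on_cong[OF assms(1)])
    show "Ck_on k U (\<lambda>x. - 1 * (inverse (f x) * frechet_derivative f (at x) v * inverse (f x)))"
      by (intro Ck_on_mult Ck_on_const assms IH) (use Suc.prems in auto)
  qed (simp add: frechet_derivative_eq[OF d])
  with d show ?case by (auto simp: differentiable_def)
qed

lemma smooth_onD:
  assumes "smooth_on U f"
  shows "x \<in> U \<Longrightarrow> (f has_derivative frechet_derivative f (at x)) (at x)"
    and "continuous_on U f"
    and "smooth_on U (\<lambda>x. frechet_derivative f (at x) v)"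
  using assms[unfolded smooth_on_def, rule_format, of "Suc _"] assms[unfolded smooth_on_def, rule_format, of 0]
  by (auto simp: smooth_on_def frechet_derivative_works[symmetric])

lemma smooth_on_const: "smooth_on U (\<lambda>_. c)"
  by (simp add: smooth_on_def Ck_on_const)

lemma smooth_on_subset:
  assumes "smooth_on U f" "V \<subseteq> U"
  shows "smooth_on V f"
proof -
  have "Ck_on k U f \<Longrightarrow> Ck_on k V f" for k
    using assms(2) by (induction k arbitrary: f) (auto intro: continuous_on_subset)
  with assms(1) show ?thesis by (simp add: smooth_on_def)
qed

lemma smooth_on_add:
  fixes f g :: "'a::real_normed_vector \<Rightarrow> real"
  shows "open U \<Longrightarrow> smooth_on U f \<Longrightarrow> smooth_on U g \<Longrightarrow> smooth_on U (\<lambda>x. f x + g x)"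
  by (simp add: smooth_on_def Ck_on_add)

lemma smooth_on_mult:
  fixes f g :: "'a::real_normed_vector \<Rightarrow> real"
  shows "open U \<Longrightarrow> smooth_on U f \<Longrightarrow> smooth_on U g \<Longrightarrow> smooth_on U (\<lambda>x. f x * g x)"
  by (simp add: smooth_on_def Ck_on_mult)

lemma smooth_on_inverse:
  fixes f :: "'a::real_normed_vector \<Rightarrow> real"
  shows "open U \<Longrightarrow> (\<And>x. x \<in> U \<Longrightarrow> f x \<noteq> 0) \<Longrightarrow> smooth_on U f \<Longrightarrow> smooth_on U (\<lambda>x. inverse (f x))"
  by (simp add: smooth_on_def Ck_on_inverse)

definition partial :: "'n \<Rightarrow> (real^'n::finite \<Rightarrow> real) \<Rightarrow> real^'n \<Rightarrow> real" where
  "partial i f x = frechet_derivative f (at x) (axis i 1)"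

lemma smooth_on_partial: "smooth_on U f \<Longrightarrow> smooth_on U (partial i f)"
  unfolding partial_def[abs_def] by (rule smooth_onD(3))

lemma linear_eq_sum_axis:
  fixes L :: "real^'n \<Rightarrow> real"
  assumes "linear L"
  shows "L v = (\<Sum>i\<in>UNIV. v $ i * L (axis i 1))"
proof -
  have "L v = L (\<Sum>i\<in>UNIV. v $ i *\<^sub>R axis i 1)"
    using basis_expansion[of v] by (simp add: scalar_mult_eq_scaleR)
  also have "\<dots> = (\<Sum>i\<in>UNIV. v $ i * L (axis i 1))"
    using assms by (simp add: linear_sum linear_cmul)
  finally show ?thesis .
qed

lemma frechet_derivative_eq_sum_partial:
  assumes "(f has_derivative f') (at x)"
  shows "f' v = (\<Sum>i\<in>UNIV. v $ i * partial i f x)"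
  unfolding partial_def frechet_derivative_eq[OF assms]
  by (rule linear_eq_sum_axis) (use assms has_derivative_linear in blast)

lemma grad_nth: "grad g x $ i = partial i g x"
proof -
  have "grad g x $ i = grad g x \<bullet> axis i 1" by (simp add: inner_axis)
  also have "\<dots> = partial i g x"
    unfolding grad_def by (subst inner_sum_left_Basis) (auto simp: partial_def Basis_vec_def)
  finally show ?thesis .
qed

section \<open>Straightening a regular level set\<close>

text \<open>The setting of the implicit function theorem: near \<open>p\<close> the level set
  \<open>g = 0\<close> is a graph over the hyperplane of the coordinates other than
  \<open>j\<close>.\<close>

locale regular_level =
  fixes U :: "(real^'n::finite) set" and g :: "real^'n \<Rightarrow> real" and p :: "real^'n" and j :: 'n
  assumes U: "open U" "p \<in> U" and g: "smooth_on U g" "g p = 0"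
    and dj: "\<And>x. x \<in> U \<Longrightarrow> partial j g x \<noteq> 0"
begin

text \<open>The slopes of the tangent hyperplanes of the level sets of \<open>g\<close>, written as graphs over
  the hyperplane \<open>x\<^sub>j = 0\<close>.\<close>
definition slope :: "'n \<Rightarrow> real^'n \<Rightarrow> real" where
  "slope i x = - 1 * (partial i g x * inverse (partial j g x))"

text \<open>The derivative of \<open>f\<close> along the tangent vector of the level sets that lies
  over axis \<open>i\<close>. In a chart it becomes the ordinary partial derivative. Since it maps
  smooth functions on \<open>U\<close> to smooth functions on \<open>U\<close>, iterating it yields
  all higher derivatives in the chart, while the chart itself is differentiated only once.\<close>

definition tang :: "'n \<Rightarrow> (real^'n \<Rightarrow> real) \<Rightarrow> real^'n \<Rightarrow> real" where
  "tang i f x = partial i f x + slope i x * partial j f x"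

lemma smooth_slope: "smooth_on U (slope i)"
  unfolding slope_def[abs_def]
  by (intro smooth_on_mult smooth_on_const smooth_on_inverse smooth_on_partial g U dj)

lemma smooth_tang: "smooth_on U f \<Longrightarrow> smooth_on U (tang i f)"
  unfolding tang_def[abs_def]
  by (rule smooth_on_add[OF U(1) smooth_on_partial smooth_on_mult[OF U(1) smooth_slope smooth_on_partial]])

definition proj :: "real^'n \<Rightarrow> real^'n" where
  "proj y = y - y $ j *\<^sub>R axis j 1"

lemma proj_nth: "proj y $ i = (if i = j then 0 else y $ i)"
  by (simp add: proj_def axis_def)

lemma linear_proj: "linear proj"
  by (rule linearI) (auto simp: vec_eq_iff proj_nth)

text \<open>Maps the level set into the hyperplane where the coordinate \<open>j\<close> vanishes
  and leaves the other coordinates alone; its local inverse on that hyperplane parametrizes the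
  level set.\<close>

definition straighten :: "real^'n \<Rightarrow> real^'n" where
  "straighten x = x + (g x - x $ j) *\<^sub>R axis j 1"

lemma straighten_nth: "straighten x $ i = (if i = j then g x else x $ i)"
  by (simp add: straighten_def axis_def)

lemma straighten_level: "g x = 0 \<Longrightarrow> straighten x = proj x"
  by (simp add: vec_eq_iff straighten_nth proj_nth)

text \<open>The inverse function theorem applies because the derivative of \<open>straighten\<close>
  at \<open>p\<close> fixes the coordinates other than \<open>j\<close> and acts on the axis
  \<open>j\<close> by the nonzero factor \<open>partial j g p\<close>. First-order differentiability
  of \<open>\<Gamma>\<close> is what the calculus with \<open>tang\<close> starts from.\<close>

lemma local_inverse:
  obtains U' V \<Gamma> where "open U'" "U' \<subseteq> U" "p \<in> U'" "open V" "proj p \<in> V" "homeomorphism U' V straighten \<Gamma>"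
    "\<And>z. z \<in> V \<Longrightarrow> \<Gamma> differentiable (at z)"
proof -
  define T where "T = (\<lambda>x v. v + (frechet_derivative g (at x) v - v $ j) *\<^sub>R axis j 1)"
  have d: "(straighten has_derivative T x) (at x)" if "x \<in> U" for x
    unfolding straighten_def[abs_def] T_def
    using smooth_onD(1)[OF g(1) that]
    by (auto intro!: derivative_eq_intros bounded_linear_imp_has_derivative[OF bounded_linear_vec_nth])
  define f' where "f' = (\<lambda>x. Blinfun (T x))"
  have f': "blinfun_apply (f' x) = T x" if "x \<in> U" for x
    unfolding f'_def by (rule bounded_linear_Blinfun_apply[OF has_derivative_bounded_linear[OF d[OF that]]])
  have cont: "continuous_on U f'"
  proof (rule continuous_on_blinfun_componentwise)
    fix b :: "real^'n"
    have "continuous_on U (\<lambda>x. T x b)"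
      unfolding T_def by (intro continuous_intros smooth_onD(2)[OF smooth_onD(3)[OF g(1)]])
    then show "continuous_on U (\<lambda>x. blinfun_apply (f' x) b)"
      by (simp add: f' cong: continuous_on_cong)
  qed
  have linT: "linear (T p)" using d[OF U(2)] has_derivative_linear by blast
  have "inj (T p)"
  proof (subst linear_injective_0[OF linT], intro allI impI)
    fix v assume T0: "T p v = 0"
    have v: "v $ i = 0" if "i \<noteq> j" for i
      using arg_cong[OF T0, of "\<lambda>w. w $ i"] that by (simp add: T_def axis_def)
    have "frechet_derivative g (at p) v = (\<Sum>i\<in>UNIV. v $ i * partial i g p)"
      by (rule frechet_derivative_eq_sum_partial[OF smooth_onD(1)[OF g(1) U(2)]])
    also have "\<dots> = (\<Sum>i\<in>UNIV. if i = j then v $ j * partial j g p else 0)"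
      using v by (intro sum.cong) auto
    finally have "v $ j * partial j g p = 0"
      using arg_cong[OF T0, of "\<lambda>w. w $ j"] by (simp add: T_def axis_def)
    then have "v $ j = 0" using dj[OF U(2)] by simp
    with v show "v = 0" by (auto simp: vec_eq_iff) metis
  qed
  then obtain L where L: "linear L" "L \<circ> T p = id"
    using linear_injective_left_inverse[OF linT] by blast
  have "Blinfun L o\<^sub>L f' p = id_blinfun"
    using L by (intro blinfun_eqI)
      (simp add: bounded_linear_Blinfun_apply linear_conv_bounded_linear f' U o_def fun_eq_iff)
  from inverse_function_theorem[OF U(1) _ cont U(2) this, of straighten] d f'
  obtain U' V \<Gamma> \<Gamma>' where "open U'" "U' \<subseteq> U" "p \<in> U'" "open V" "straighten p \<in> V" "homeomorphism U' V straighten \<Gamma>"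
    "\<And>z. z \<in> V \<Longrightarrow> (\<Gamma> has_derivative \<Gamma>' z) (at z)"
    by (metis (no_types, lifting))
  then show thesis
    using that straighten_level[OF g(2)] by (auto simp: differentiable_def) metis
qed

end

section \<open>Charts of level sets\<close>

lemma smooth_on_nth: "smooth_on U (\<lambda>x::real^'n. x $ i)"
  and partial_nth: "partial k (\<lambda>x::real^'n. x $ i) x = (if k = i then 1 else 0)"
proof -
  have d: "((\<lambda>x::real^'n. x $ i) has_derivative (\<lambda>v. v $ i)) (at x)" for x
    by (rule bounded_linear_imp_has_derivative[OF bounded_linear_vec_nth])
  have "Ck_on l U (\<lambda>x::real^'n. x $ i)" for l
  proof (cases l)
    case 0
    then show ?thesis by (simp add: continuous_on_component)
  next
    case (Suc l')
    show ?thesis unfolding Suc Ck_on.simps frechet_derivative_eq[OF d]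
      using d by (auto simp: differentiable_def Ck_on_const)
  qed
  then show "smooth_on U (\<lambda>x::real^'n. x $ i)" by (simp add: smooth_on_def)
  show "partial k (\<lambda>x::real^'n. x $ i) x = (if k = i then 1 else 0)"
    unfolding partial_def frechet_derivative_eq[OF d] by (simp add: axis_def)
qed

locale level_chart = regular_level U g p j for U g p and j :: "'n::finite" +
  fixes U' V :: "(real^'n) set" and \<Gamma> :: "real^'n \<Rightarrow> real^'n"
  assumes U': "open U'" "U' \<subseteq> U" "p \<in> U'" and V: "open V" "proj p \<in> V"
    and hom: "homeomorphism U' V straighten \<Gamma>"
    and diff: "\<And>z. z \<in> V \<Longrightarrow> \<Gamma> differentiable (at z)"
begin

definition chart :: "real^'n \<Rightarrow> real^'n" where "chart y = \<Gamma> (proj y)"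

definition dom :: "(real^'n) set" where "dom = {y. proj y \<in> V}"

lemma has_derivative_proj: "(proj has_derivative proj) (at y)"
  by (rule bounded_linear_imp_has_derivative) (rule linear_proj[unfolded linear_conv_bounded_linear])

lemma open_dom: "open dom"
proof -
  have "continuous_on UNIV proj"
    by (rule linear_continuous_on) (rule linear_proj[unfolded linear_conv_bounded_linear])
  then have "open (proj -` V)" by (rule open_vimage[OF V(1)])
  then show ?thesis by (simp add: dom_def vimage_def)
qed

lemma chart_in: "y \<in> dom \<Longrightarrow> chart y \<in> U'"
  using hom by (auto simp: dom_def chart_def homeomorphism_def)

lemma straighten_chart: "y \<in> dom \<Longrightarrow> straighten (chart y) = proj y"
  using hom by (auto simp: dom_def chart_def homeomorphism_def)

lemma chart_nth: "y \<in> dom \<Longrightarrow> i \<noteq> j \<Longrightarrow> chart y $ i = y $ i"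
  using arg_cong[OF straighten_chart, of y "\<lambda>v. v $ i"] by (simp add: straighten_nth proj_nth)

lemma level_chart: "y \<in> dom \<Longrightarrow> g (chart y) = 0"
  using arg_cong[OF straighten_chart, of y "\<lambda>v. v $ j"] by (simp add: straighten_nth proj_nth)

lemma chart_inverse: "x \<in> U' \<Longrightarrow> g x = 0 \<Longrightarrow> \<Gamma> (proj x) = x"
  using hom by (auto simp: homeomorphism_def simp flip: straighten_level)

text \<open>The derivative is read off from the identities \<open>chart y $ i = y $ i\<close> and
  \<open>g (chart y) = 0\<close>: the former fix its components other than \<open>j\<close>, and the
  latter then expresses the component \<open>j\<close> by the slopes.\<close>

lemma chart_has_derivative:
  assumes "y \<in> dom"
  obtains L where "(chart has_derivative L) (at y)" "\<And>v i. i \<noteq> j \<Longrightarrow> L v $ i = v $ i"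
    "\<And>v. L v $ j = (\<Sum>i\<in>UNIV - {j}. v $ i * slope i (chart y))"
proof -
  obtain G' where G': "(\<Gamma> has_derivative G') (at (proj y))"
    using diff[of "proj y"] assms by (auto simp: dom_def differentiable_def)
  define L where "L = G' \<circ> proj"
  have L: "(chart has_derivative L) (at y)"
    unfolding chart_def[abs_def] L_def using diff_chain_at[OF has_derivative_proj G'] by (simp add: o_def)
  have Li: "L v $ i = v $ i" if "i \<noteq> j" for v i
  proof -
    have 1: "((\<lambda>y. chart y $ i) has_derivative (\<lambda>v. L v $ i)) (at y)"
      using bounded_linear.has_derivative[OF bounded_linear_vec_nth L] .
    have 2: "((\<lambda>y. chart y $ i) has_derivative (\<lambda>v. v $ i)) (at y)"
      by (rule has_derivative_transform_within_open[OF bounded_linear_imp_has_derivative[OF bounded_linear_vec_nth[of i]] open_dom assms])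
         (simp add: chart_nth that)
    show ?thesis using has_derivative_unique[OF 1 2] by (rule fun_cong)
  qed
  have x: "chart y \<in> U" using chart_in[OF assms] U'(2) by blast
  note dg = smooth_onD(1)[OF g(1) x]
  have 1: "((\<lambda>y. g (chart y)) has_derivative (\<lambda>v. frechet_derivative g (at (chart y)) (L v))) (at y)"
    using diff_chain_at[OF L dg] by (simp add: o_def)
  have 2: "((\<lambda>y. g (chart y)) has_derivative (\<lambda>v. 0)) (at y)"
    by (rule has_derivative_transform_within_open[OF has_derivative_const[of 0] open_dom assms])
       (simp add: level_chart)
  have Lj: "L v $ j = (\<Sum>i\<in>UNIV - {j}. v $ i * slope i (chart y))" for v
  proof -
    have "0 = (\<Sum>i\<in>UNIV. L v $ i * partial i g (chart y))"
      using has_derivative_unique[OF 1 2, THEN fun_cong, of v] frechet_derivative_eq_sum_partial[OF dg, of "L v"]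
      by simp
    also have "\<dots> = L v $ j * partial j g (chart y) + (\<Sum>i\<in>UNIV - {j}. L v $ i * partial i g (chart y))"
      by (rule sum.remove) auto
    also have "(\<Sum>i\<in>UNIV - {j}. L v $ i * partial i g (chart y)) = (\<Sum>i\<in>UNIV - {j}. v $ i * partial i g (chart y))"
      by (intro sum.cong) (auto simp: Li)
    finally have "L v $ j = - (\<Sum>i\<in>UNIV - {j}. v $ i * partial i g (chart y)) * inverse (partial j g (chart y))"
      using dj[OF x] by (simp add: field_simps eq_neg_iff_add_eq_0)
    then show ?thesis
      by (simp add: slope_def sum_distrib_right sum_negf mult.assoc)
  qed
  show thesis using that L Li Lj by blast
qed

lemma tang_derivative:
  assumes f: "smooth_on U f" and y: "y \<in> dom"
  shows "((\<lambda>y. f (chart y)) has_derivative (\<lambda>v. \<Sum>i\<in>UNIV - {j}. v $ i * tang i f (chart y))) (at y)"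
proof -
  obtain L where L: "(chart has_derivative L) (at y)" "\<And>v i. i \<noteq> j \<Longrightarrow> L v $ i = v $ i"
    "\<And>v. L v $ j = (\<Sum>i\<in>UNIV - {j}. v $ i * slope i (chart y))"
    using chart_has_derivative[OF y] by blast
  have x: "chart y \<in> U" using chart_in[OF y] U'(2) by blast
  note df = smooth_onD(1)[OF f x]
  have 1: "((\<lambda>y. f (chart y)) has_derivative (\<lambda>v. frechet_derivative f (at (chart y)) (L v))) (at y)"
    using diff_chain_at[OF L(1) df] by (simp add: o_def)
  have "frechet_derivative f (at (chart y)) (L v) = (\<Sum>i\<in>UNIV - {j}. v $ i * tang i f (chart y))" for v
  proof -
    have "frechet_derivative f (at (chart y)) (L v) = (\<Sum>i\<in>UNIV. L v $ i * partial i f (chart y))"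
      by (rule frechet_derivative_eq_sum_partial[OF df])
    also have "\<dots> = L v $ j * partial j f (chart y) + (\<Sum>i\<in>UNIV - {j}. L v $ i * partial i f (chart y))"
      by (rule sum.remove) auto
    also have "(\<Sum>i\<in>UNIV - {j}. L v $ i * partial i f (chart y)) = (\<Sum>i\<in>UNIV - {j}. v $ i * partial i f (chart y))"
      by (intro sum.cong) (auto simp: L(2))
    finally show ?thesis
      unfolding L(3) by (simp add: tang_def sum_distrib_left sum_distrib_right sum.distrib algebra_simps)
  qed
  with 1 show ?thesis by simp
qed

lemma tang_nth: "i \<noteq> j \<Longrightarrow> tang i (\<lambda>x. x $ j) x = slope i x"
  by (simp add: tang_def partial_nth)

lemma chart_continuous: "continuous_on dom chart"
  by (rule continuous_at_imp_continuous_on) (metis chart_has_derivative has_derivative_continuous)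

lemma continuous_on_chart_compose:
  fixes f :: "real^'n \<Rightarrow> real"
  assumes "smooth_on U f"
  shows "continuous_on dom (\<lambda>y. f (chart y))"
  by (rule continuous_at_imp_continuous_on) (use tang_derivative[OF assms] has_derivative_continuous in blast)

lemma directional_derivative:
  fixes f :: "real^'n \<Rightarrow> real"
  assumes "smooth_on U f" "y \<in> dom" "i \<noteq> j"
  shows "((\<lambda>t. f (chart (y + t *\<^sub>R axis i 1))) has_vector_derivative tang i f (chart y)) (at 0)"
proof -
  have "((\<lambda>t::real. y + t *\<^sub>R axis i 1) has_derivative (\<lambda>t. t *\<^sub>R axis i 1)) (at 0)"
    by (auto intro!: derivative_eq_intros)
  moreover have "((\<lambda>y. f (chart y)) has_derivative (\<lambda>v. \<Sum>i\<in>UNIV - {j}. v $ i * tang i f (chart y))) (at (y + 0 *\<^sub>R axis i 1))"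
    using tang_derivative[OF assms(1,2)] by simp
  ultimately have "((\<lambda>t. f (chart (y + t *\<^sub>R axis i 1))) has_derivative
     (\<lambda>t. \<Sum>k\<in>UNIV - {j}. (t *\<^sub>R axis i 1 :: real^'n) $ k * tang k f (chart y))) (at 0)"
    using diff_chain_at by (fastforce simp: o_def)
  also have "(\<lambda>t. \<Sum>k\<in>UNIV - {j}. (t *\<^sub>R axis i 1 :: real^'n) $ k * tang k f (chart y)) = (\<lambda>t. t *\<^sub>R tang i f (chart y))"
  proof
    fix t
    have "(\<Sum>k\<in>UNIV - {j}. (t *\<^sub>R axis i 1 :: real^'n) $ k * tang k f (chart y))
       = (\<Sum>k\<in>UNIV - {j}. if k = i then t * tang i f (chart y) else 0)"
      by (intro sum.cong) (auto simp: axis_def)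
    also have "\<dots> = t *\<^sub>R tang i f (chart y)" using assms(3) by simp
    finally show "(\<Sum>k\<in>UNIV - {j}. (t *\<^sub>R axis i 1 :: real^'n) $ k * tang k f (chart y)) = t *\<^sub>R tang i f (chart y)" .
  qed
  finally show ?thesis by (simp add: has_vector_derivative_def)
qed

section \<open>Uniform bounds for smooth functions in a chart\<close>

lemma chart_mvt:
  fixes f :: "real^'n \<Rightarrow> real"
  assumes f: "smooth_on U f" and A: "convex A" "A \<subseteq> dom" "y \<in> A" "y + h \<in> A"
  shows "\<exists>z\<in>A. f (chart (y + h)) - f (chart y) = (\<Sum>k\<in>UNIV - {j}. h $ k * tang k f (chart z))"
proof -
  have inA: "y + t *\<^sub>R h \<in> A" if "0 \<le> t" "t \<le> 1" for t
  proof -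
    have "(1 - t) *\<^sub>R y + t *\<^sub>R (y + h) \<in> A"
      using that by (intro convexD[OF A(1)] A) auto
    then show ?thesis by (simp add: algebra_simps)
  qed
  have "\<exists>t>0. t < 1 \<and> f (chart (y + 1 *\<^sub>R h)) - f (chart (y + 0 *\<^sub>R h))
      = (1 - 0) * (\<Sum>k\<in>UNIV - {j}. h $ k * tang k f (chart (y + t *\<^sub>R h)))"
  proof (rule MVT2)
    fix t :: real assume t: "0 \<le> t" "t \<le> 1"
    have "((\<lambda>t::real. y + t *\<^sub>R h) has_derivative (\<lambda>t. t *\<^sub>R h)) (at t)"
      by (auto intro!: derivative_eq_intros)
    from diff_chain_at[OF this tang_derivative[OF f]] inA[OF t] A(2)
    have "((\<lambda>t. f (chart (y + t *\<^sub>R h))) has_derivative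
       (\<lambda>s. \<Sum>k\<in>UNIV - {j}. (s *\<^sub>R h) $ k * tang k f (chart (y + t *\<^sub>R h)))) (at t)"
      by (auto simp: o_def)
    then show "((\<lambda>t. f (chart (y + t *\<^sub>R h))) has_real_derivative
       (\<Sum>k\<in>UNIV - {j}. h $ k * tang k f (chart (y + t *\<^sub>R h)))) (at t)"
      unfolding has_field_derivative_def
      by (rule back_subst[of "\<lambda>F. (_ has_derivative F) _"]) (simp add: fun_eq_iff sum_distrib_left mult_ac)
  qed simp
  then obtain t where "0 < t" "t < 1" "f (chart (y + h)) - f (chart y)
      = (\<Sum>k\<in>UNIV - {j}. h $ k * tang k f (chart (y + t *\<^sub>R h)))" by auto
  with inA[of t] show ?thesis by (intro bexI[of _ "y + t *\<^sub>R h"]) auto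
qed

lemma chart_bounded:
  fixes f :: "real^'n \<Rightarrow> real"
  assumes "smooth_on U f" "compact A" "A \<subseteq> dom"
  shows "\<exists>B\<ge>0. \<forall>y\<in>A. \<bar>f (chart y)\<bar> \<le> B"
proof -
  have "bounded ((\<lambda>y. f (chart y)) ` A)"
    by (intro compact_imp_bounded compact_continuous_image assms
        continuous_on_subset[OF continuous_on_chart_compose[OF assms(1)]])
  then show ?thesis unfolding bounded_pos by (auto intro: less_imp_le)
qed

lemma chart_difference_bounded:
  fixes f :: "real^'n \<Rightarrow> real"
  assumes "smooth_on U f" "compact A" "convex A" "A \<subseteq> dom"
  shows "\<exists>B\<ge>0. \<forall>y h. y \<in> A \<longrightarrow> y + h \<in> A \<longrightarrow> \<bar>f (chart (y + h)) - f (chart y)\<bar> \<le> B * (\<Sum>k\<in>UNIV - {j}. \<bar>h $ k\<bar>)"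
proof -
  have "\<exists>b. \<forall>k. b k \<ge> 0 \<and> (\<forall>y\<in>A. \<bar>tang k f (chart y)\<bar> \<le> b k)"
    using chart_bounded[OF smooth_tang[OF assms(1)] assms(2,4)] by (intro choice) blast
  then obtain b where b: "\<And>k. b k \<ge> 0" "\<And>k y. y \<in> A \<Longrightarrow> \<bar>tang k f (chart y)\<bar> \<le> b k" by blast
  define B where "B = (\<Sum>k\<in>UNIV. b k)"
  have bB: "b k \<le> B" for k unfolding B_def using b(1) by (intro member_le_sum) auto
  have "\<bar>f (chart (y + h)) - f (chart y)\<bar> \<le> B * (\<Sum>k\<in>UNIV - {j}. \<bar>h $ k\<bar>)" if yh: "y \<in> A" "y + h \<in> A" for y h
  proof -
    obtain z where z: "z \<in> A" "f (chart (y + h)) - f (chart y) = (\<Sum>k\<in>UNIV - {j}. h $ k * tang k f (chart z))"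
      using chart_mvt[OF assms(1,3,4) yh] by blast
    have "\<bar>f (chart (y + h)) - f (chart y)\<bar> \<le> (\<Sum>k\<in>UNIV - {j}. \<bar>h $ k * tang k f (chart z)\<bar>)"
      unfolding z(2) by (rule sum_abs)
    also have "\<dots> \<le> (\<Sum>k\<in>UNIV - {j}. \<bar>h $ k\<bar> * B)"
      unfolding abs_mult by (intro sum_mono mult_left_mono order_trans[OF b(2)[OF z(1)] bB]) auto
    finally show ?thesis by (simp add: sum_distrib_left mult.commute)
  qed
  moreover have "0 \<le> B" using b(1) by (auto simp: B_def intro: sum_nonneg)
  ultimately show ?thesis by blast
qed

text \<open>The derivative of \<open>f (chart y)\<close> along axis \<open>i\<close> is
  \<open>tang i f (chart y)\<close>, again a smooth function in the chart, so the induction runs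
  over all \<open>f\<close>. The compact set \<open>A\<close> around \<open>W\<close> supplies the
  bounds.\<close>

lemma dir_Ck_chart:
  assumes W: "W \<subseteq> A" and A: "compact A" "A \<subseteq> dom" and i: "i \<noteq> j"
  shows "smooth_on U f \<Longrightarrow> \<exists>B\<ge>0. dir_Ck (axis i 1) W B k (\<lambda>y. complex_of_real (f (chart y)))"
proof (induction k arbitrary: f)
  case 0
  obtain B where "B \<ge> 0" "\<forall>y\<in>A. \<bar>f (chart y)\<bar> \<le> B" using chart_bounded[OF 0 A] by blast
  with W A show ?case
    by (intro exI[of _ B])
       (auto intro!: continuous_on_of_real continuous_on_subset[OF continuous_on_chart_compose[OF 0]])
next
  case (Suc k)
  obtain B where B: "B \<ge> 0" "\<forall>y\<in>A. \<bar>f (chart y)\<bar> \<le> B" using chart_bounded[OF Suc.prems A] by blast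
  obtain B' where B': "B' \<ge> 0" "dir_Ck (axis i 1) W B' k (\<lambda>y. complex_of_real (tang i f (chart y)))"
    using Suc.IH[OF smooth_tang[OF Suc.prems]] by blast
  have "dir_Ck (axis i 1) W (max B B') (Suc k) (\<lambda>y. complex_of_real (f (chart y)))"
  proof (rule dir_Ck_SucI[where f'="\<lambda>y. complex_of_real (tang i f (chart y))"])
    show "continuous_on W (\<lambda>y. complex_of_real (f (chart y)))"
      using W A by (intro continuous_on_of_real continuous_on_subset[OF continuous_on_chart_compose[OF Suc.prems]]) auto
    show "norm (complex_of_real (f (chart y))) \<le> max B B'" if "y \<in> W" for y
      using B(2) that W by (auto intro: max.coboundedI1)
    show "((\<lambda>t. complex_of_real (f (chart (y + t *\<^sub>R axis i 1)))) has_vector_derivative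
        complex_of_real (tang i f (chart y))) (at 0)" if "y \<in> W" for y
      using directional_derivative[OF Suc.prems _ i, of y] that W A
      by (intro has_vector_derivative_of_real) (auto simp: has_real_derivative_iff_has_vector_derivative)
  qed (rule dir_Ck_mono[OF B'(2)], simp)
  then show ?case using B(1) by (intro exI[of _ "max B B'"]) (auto simp del: dir_Ck.simps intro: max.coboundedI1)
qed

text \<open>The derivative of the difference for \<open>f\<close> is the difference for
  \<open>tang i f\<close>, so the mean value bound by the sum of the
  \<open>\<bar>h $ k\<bar>\<close> is available at every order. This becomes
  \<open>reg_diff\<close>.\<close>

lemma dir_Ck_chart_difference:
  assumes W: "W \<subseteq> A" and A: "compact A" "convex A" "A \<subseteq> dom" and i: "i \<noteq> j"
  shows "smooth_on U f \<Longrightarrow> \<exists>B\<ge>0. \<forall>h. dir_Ck (axis i 1) (W \<inter> {y. y + h \<in> W}) (B * (\<Sum>k\<in>UNIV - {j}. \<bar>h $ k\<bar>)) k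
    (\<lambda>y. complex_of_real (f (chart (y + h)) - f (chart y)))"
proof (induction k arbitrary: f)
  case 0
  obtain B where B: "B \<ge> 0" "\<forall>y h. y \<in> A \<longrightarrow> y + h \<in> A \<longrightarrow> \<bar>f (chart (y + h)) - f (chart y)\<bar> \<le> B * (\<Sum>k\<in>UNIV - {j}. \<bar>h $ k\<bar>)"
    using chart_difference_bounded[OF 0 A] by blast
  have "continuous_on (W \<inter> {y. y + h \<in> W}) (\<lambda>y. complex_of_real (f (chart (y + h)) - f (chart y)))" for h
    by (intro continuous_on_of_real continuous_on_diff continuous_on_subset[OF continuous_on_chart_compose[OF 0]]
        continuous_on_compose2[OF continuous_on_chart_compose[OF 0], of _ "\<lambda>y. y + h"]
        continuous_on_add continuous_on_id continuous_on_const) (use W A in auto)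
  moreover have "norm (complex_of_real (f (chart (y + h)) - f (chart y))) \<le> B * (\<Sum>k\<in>UNIV - {j}. \<bar>h $ k\<bar>)"
    if "y \<in> W \<inter> {y. y + h \<in> W}" for y h
    unfolding norm_of_real using B(2) W that by blast
  ultimately show ?case using B(1) unfolding dir_Ck.simps by blast
next
  case (Suc k)
  let ?s = "\<lambda>h::real^'n. \<Sum>k\<in>UNIV - {j}. \<bar>h $ k\<bar>"
  have s: "0 \<le> ?s h" for h by (simp add: sum_nonneg)
  obtain B where B: "B \<ge> 0" "\<forall>y h. y \<in> A \<longrightarrow> y + h \<in> A \<longrightarrow> \<bar>f (chart (y + h)) - f (chart y)\<bar> \<le> B * ?s h"
    using chart_difference_bounded[OF Suc.prems A] by blast
  obtain B' where B': "B' \<ge> 0" "\<And>h. dir_Ck (axis i 1) (W \<inter> {y. y + h \<in> W}) (B' * ?s h) k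
       (\<lambda>y. complex_of_real (tang i f (chart (y + h)) - tang i f (chart y)))"
    using Suc.IH[OF smooth_tang[OF Suc.prems]] by blast
  have "dir_Ck (axis i 1) (W \<inter> {y. y + h \<in> W}) ((B + B') * ?s h) (Suc k) (\<lambda>y. complex_of_real (f (chart (y + h)) - f (chart y)))" for h
  proof (rule dir_Ck_SucI[where f'="\<lambda>y. complex_of_real (tang i f (chart (y + h)) - tang i f (chart y))"])
    show "continuous_on (W \<inter> {y. y + h \<in> W}) (\<lambda>y. complex_of_real (f (chart (y + h)) - f (chart y)))"
      by (intro continuous_on_of_real continuous_on_diff continuous_on_subset[OF continuous_on_chart_compose[OF Suc.prems]]
        continuous_on_compose2[OF continuous_on_chart_compose[OF Suc.prems], of _ "\<lambda>y. y + h"]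
        continuous_on_add continuous_on_id continuous_on_const) (use W A in auto)
    show "norm (complex_of_real (f (chart (y + h)) - f (chart y))) \<le> (B + B') * ?s h"
      if "y \<in> W \<inter> {y. y + h \<in> W}" for y
    proof -
      have "\<bar>f (chart (y + h)) - f (chart y)\<bar> \<le> B * ?s h" using B(2) W that by blast
      also have "\<dots> \<le> (B + B') * ?s h" using B' s by (intro mult_right_mono) auto
      finally show ?thesis by (simp only: norm_of_real)
    qed
    show "((\<lambda>t. complex_of_real (f (chart (y + t *\<^sub>R axis i 1 + h)) - f (chart (y + t *\<^sub>R axis i 1)))) has_vector_derivative
        complex_of_real (tang i f (chart (y + h)) - tang i f (chart y))) (at 0)" if y: "y \<in> W \<inter> {y. y + h \<in> W}" for y
    proof -
      have eq: "(\<lambda>t. f (chart (y + t *\<^sub>R axis i 1 + h))) = (\<lambda>t. f (chart ((y + h) + t *\<^sub>R axis i 1)))"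
        by (simp add: algebra_simps)
      have "((\<lambda>t. f (chart (y + t *\<^sub>R axis i 1 + h))) has_vector_derivative tang i f (chart (y + h))) (at 0)"
        unfolding eq by (rule directional_derivative[OF Suc.prems _ i]) (use y W A in auto)
      moreover have "((\<lambda>t. f (chart (y + t *\<^sub>R axis i 1))) has_vector_derivative tang i f (chart y)) (at 0)"
        by (rule directional_derivative[OF Suc.prems _ i]) (use y W A in auto)
      ultimately show ?thesis
        by (intro has_vector_derivative_of_real)
           (simp only: has_real_derivative_iff_has_vector_derivative has_vector_derivative_diff)
    qed
    show "dir_Ck (axis i 1) (W \<inter> {y. y + h \<in> W}) ((B + B') * ?s h) k
        (\<lambda>y. complex_of_real (tang i f (chart (y + h)) - tang i f (chart y)))"
      by (rule dir_Ck_mono[OF B'(2)]) (use B s in \<open>auto intro!: mult_right_mono\<close>)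
  qed
  then show ?case using B(1) B'(1) by (intro exI[of _ "B + B'"]) (auto simp del: dir_Ck.simps)
qed

end

section \<open>Nondegeneracy from the Gaussian curvature\<close>

context regular_level
begin

text \<open>The gradient rescaled to have component 1 along \<open>j\<close>. Its other components
  are the negated slopes, which ties the unit normal to the Hessian of the graph.\<close>

definition normal_direction :: "real^'n \<Rightarrow> real^'n" where
  "normal_direction x = (\<chi> i. if i = j then 1 else - slope i x)"

lemma grad_eq: "x \<in> U \<Longrightarrow> grad g x = partial j g x *\<^sub>R normal_direction x"
  using dj[of x] by (simp add: vec_eq_iff grad_nth normal_direction_def slope_def)

lemma normal_direction_nz: "normal_direction x \<noteq> 0"
proof
  assume "normal_direction x = 0"
  then have "normal_direction x $ j = 0" by simp
  then show False by (simp add: normal_direction_def)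
qed

lemma has_derivative_normal_direction:
  assumes "x \<in> U"
  shows "(normal_direction has_derivative (\<lambda>v. \<chi> i. if i = j then 0 else - frechet_derivative (slope i) (at x) v)) (at x)"
proof -
  have "((\<lambda>x. if i = j then 1 else - slope i x) has_derivative
      (\<lambda>v. if i = j then 0 else - frechet_derivative (slope i) (at x) v)) (at x)" for i
    using smooth_onD(1)[OF smooth_slope assms] by (cases "i = j") (auto intro!: derivative_eq_intros)
  then show ?thesis
    unfolding has_derivative_componentwise_within[of normal_direction]
    by (auto simp: Basis_vec_def inner_axis normal_direction_def)
qed

text \<open>Near \<open>p\<close> the unit normal is, up to a constant sign, \<open>sgn\<close> of
  \<open>normal_direction\<close>, and the derivative of the latter is made up of the derivatives of
  the slopes.\<close>

lemma unit_normal_has_derivative: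
  "\<exists>D. (unit_normal g has_derivative D) (at p) \<and>
      (\<forall>v. (\<forall>i. i \<noteq> j \<longrightarrow> frechet_derivative (slope i) (at p) v = 0) \<longrightarrow> D v = 0)"
proof -
  define M where "M = (\<lambda>v. \<chi> i. if i = j then 0 else - frechet_derivative (slope i) (at p) v :: real^'n)"
  have M: "(normal_direction has_derivative M) (at p)"
    unfolding M_def by (rule has_derivative_normal_direction[OF U(2)])
  have "(sgn :: real^'n \<Rightarrow> _) differentiable (at (normal_direction p))"
    unfolding sgn_div_norm[abs_def] using normal_direction_nz
    by (intro differentiable_scaleR differentiable_ident differentiable_inverse differentiable_norm_at) auto
  then obtain T where T: "((sgn :: real^'n \<Rightarrow> _) has_derivative T) (at (normal_direction p))"
    by (auto simp: differentiable_def)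
  define s where "s = sgn (partial j g p)"
  have "((\<lambda>x. s *\<^sub>R sgn (normal_direction x)) has_derivative (\<lambda>v. s *\<^sub>R T (M v))) (at p)"
    using has_derivative_scaleR_right[OF diff_chain_at[OF M T], of s] by (simp add: o_def)
  \<comment> \<open>Here \<open>partial j g\<close> has the same sign as at \<open>p\<close>, so
    that \<open>s\<close> is the correct sign on all of \<open>Q\<close>.\<close>
  moreover define Q where "Q = U \<inter> (\<lambda>x. s * partial j g x) -` {0<..}"
  have "open Q"
    unfolding Q_def
    by (intro continuous_open_preimage continuous_intros smooth_onD(2)[OF smooth_on_partial[OF g(1)]] U)
  moreover have "p \<in> Q"
    using U(2) dj[OF U(2)] by (auto simp: Q_def s_def sgn_if mult_pos_pos)
  moreover have "s *\<^sub>R sgn (normal_direction x) = unit_normal g x" if "x \<in> Q" for x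
  proof -
    have x: "x \<in> U" "0 < s * partial j g x" using that by (auto simp: Q_def)
    then have "sgn (partial j g x) = s" by (auto simp: s_def sgn_if zero_less_mult_iff split: if_splits)
    then show ?thesis by (simp add: unit_normal_def grad_eq[OF x(1)] sgn_scaleR)
  qed
  ultimately have D: "(unit_normal g has_derivative (\<lambda>v. s *\<^sub>R T (M v))) (at p)"
    by (rule has_derivative_transform_within_open)
  have "s *\<^sub>R T (M v) = 0" if "\<forall>i. i \<noteq> j \<longrightarrow> frechet_derivative (slope i) (at p) v = 0" for v
  proof -
    have "M v = 0" using that by (simp add: M_def vec_eq_iff)
    then show ?thesis using linear_0[OF has_derivative_linear[OF T]] by simp
  qed
  with D show ?thesis by blast
qed

text \<open>A tangent vector annihilated by the derivatives of all slopes is annihilated by the derivative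
  of the unit normal, hence lies in the kernel of the matrix defining the Gaussian curvature.\<close>
lemma hessian_injective:
  assumes curv: "gaussian_curvature g p \<noteq> 0" and hj: "h $ j = 0"
    and h: "\<And>i. i \<noteq> j \<Longrightarrow> (\<Sum>k\<in>UNIV - {j}. h $ k * tang k (slope i) p) = 0"
  shows "h = 0"
proof -
  \<comment> \<open>The tangent vector of the level set at \<open>p\<close> that lies over
    \<open>h\<close>.\<close>
  define v where "v = h + (\<Sum>k\<in>UNIV - {j}. h $ k * slope k p) *\<^sub>R axis j 1"
  have vi: "v $ i = h $ i" if "i \<noteq> j" for i using that by (simp add: v_def axis_def)
  have vj: "v $ j = (\<Sum>k\<in>UNIV - {j}. h $ k * slope k p)" using hj by (simp add: v_def axis_def)
  have split: "(\<Sum>k\<in>UNIV. v $ k * F k) = (\<Sum>k\<in>UNIV - {j}. h $ k * (F k + slope k p * F j))" for F :: "'n \<Rightarrow> real"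
  proof -
    have "(\<Sum>k\<in>UNIV. v $ k * F k) = v $ j * F j + (\<Sum>k\<in>UNIV - {j}. v $ k * F k)"
      by (rule sum.remove) auto
    also have "(\<Sum>k\<in>UNIV - {j}. v $ k * F k) = (\<Sum>k\<in>UNIV - {j}. h $ k * F k)"
      by (intro sum.cong) (auto simp: vi)
    finally show ?thesis unfolding vj by (simp add: sum_distrib_left sum_distrib_right sum.distrib algebra_simps)
  qed
  have "frechet_derivative (slope i) (at p) v = 0" if "i \<noteq> j" for i
    unfolding frechet_derivative_eq_sum_partial[OF smooth_onD(1)[OF smooth_slope U(2)]] split
    using h[OF that] by (simp add: tang_def)
  moreover obtain D where D: "(unit_normal g has_derivative D) (at p)"
    "\<forall>v. (\<forall>i. i \<noteq> j \<longrightarrow> frechet_derivative (slope i) (at p) v = 0) \<longrightarrow> D v = 0"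
    using unit_normal_has_derivative by blast
  ultimately have Dv: "D v = 0" by blast
  have lD: "linear D" using D(1) by (rule has_derivative_linear)
  define \<nu> where "\<nu> = unit_normal g p"
  have "grad g p \<bullet> v = (\<Sum>k\<in>UNIV. v $ k * partial k g p)"
    by (simp add: inner_vec_def grad_nth mult.commute)
  also have "\<dots> = 0"
    unfolding split using dj[OF U(2)] by (simp add: slope_def mult.assoc)
  finally have "v \<bullet> \<nu> = 0"
    by (simp add: \<nu>_def unit_normal_def sgn_div_norm inner_commute)
  define f where "f = (\<lambda>w. shape_operator g p (w - (w \<bullet> \<nu>) *\<^sub>R \<nu>) + (w \<bullet> \<nu>) *\<^sub>R \<nu>)"
  have f: "f w = - D (w - (w \<bullet> \<nu>) *\<^sub>R \<nu>) + (w \<bullet> \<nu>) *\<^sub>R \<nu>" for w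
    by (simp add: f_def shape_operator_def frechet_derivative_eq[OF D(1)])
  have "linear f"
    by (rule linearI) (simp_all add: f linear_diff[OF lD] linear_add[OF lD] linear_cmul[OF lD]
      inner_add_left scaleR_add_left scaleR_diff_right algebra_simps)
  have "det (matrix f) \<noteq> 0"
    using curv unfolding gaussian_curvature_def Let_def f_def \<nu>_def .
  then have "invertible (matrix f)" by (simp add: invertible_det_nz)
  then have ker: "\<forall>x. matrix f *v x = 0 \<longrightarrow> x = 0"
    using matrix_left_invertible_ker invertible_left_inverse by metis
  have "matrix f *v v = f v"
    using fun_cong[OF matrix_vector_mul(2)[OF \<open>linear f\<close>], of v] by simp
  also have "\<dots> = 0" by (simp add: f \<open>v \<bullet> \<nu> = 0\<close> Dv)
  finally have "v = 0" using ker by blast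
  then have "h $ i = 0" for i using vi[of i] hj by (cases "i = j") auto
  then show ?thesis by (simp add: vec_eq_iff)
qed

text \<open>The numbers \<open>tang k (slope i) p\<close> are the entries of the Hessian of the
  graph function. Its injectivity bounds the image of \<open>h\<close> from below, and one component
  of the image carries a fixed share of this bound.\<close>

lemma hessian_lower_bound:
  assumes "2 \<le> CARD('n)" "gaussian_curvature g p \<noteq> 0"
  shows "\<exists>c>0. \<forall>h. \<exists>i. i \<noteq> j \<and> c * (\<Sum>k\<in>UNIV - {j}. \<bar>h $ k\<bar>) \<le> \<bar>\<Sum>k\<in>UNIV - {j}. h $ k * tang k (slope i) p\<bar>"
proof -
  define H where "H = (\<lambda>i (h::real^'n). \<Sum>k\<in>UNIV - {j}. h $ k * tang k (slope i) p)"
  \<comment> \<open>The identity on the coordinate \<open>j\<close> completes the Hessian to an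
    operator on the whole space.\<close>
  define T where "T = (\<lambda>h. \<chi> i. if i = j then h $ j else H i h)"
  have linT: "linear T"
    by (rule linearI) (auto simp: T_def H_def vec_eq_iff sum.distrib sum_distrib_left algebra_simps)
  have "inj T"
  proof (subst linear_injective_0[OF linT], intro allI impI)
    fix h assume "T h = 0"
    then have T0: "T h $ i = 0" for i by simp
    have "(\<Sum>k\<in>UNIV - {j}. h $ k * tang k (slope i) p) = 0" if "i \<noteq> j" for i
      using T0[of i] that by (simp add: T_def H_def)
    moreover have "h $ j = 0" using T0[of j] by (simp add: T_def)
    ultimately show "h = 0" using hessian_injective[OF assms(2)] by blast
  qed
  then obtain B where B: "0 < B" "\<And>h. B * norm h \<le> norm (T h)"
    using linear_inj_bounded_below_pos[OF linT] by blast
  define n where "n = real CARD('n)"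
  have n: "0 < n" by (simp add: n_def)
  \<comment> \<open>One factor \<open>n\<close> pays for comparing the sum of the
    \<open>\<bar>h $ k\<bar>\<close> with a norm, the other for picking one component among fewer
    than \<open>n\<close>.\<close>
  have "\<exists>i. i \<noteq> j \<and> B / (n * n) * (\<Sum>k\<in>UNIV - {j}. \<bar>h $ k\<bar>) \<le> \<bar>H i h\<bar>" for h
  proof (rule ccontr)
    assume "\<not> ?thesis"
    then have lt: "\<bar>H i h\<bar> < B / (n * n) * (\<Sum>k\<in>UNIV - {j}. \<bar>h $ k\<bar>)" if "i \<noteq> j" for i
      using that by (auto simp: not_le)
    have HP: "H i (proj h) = H i h" for i
      unfolding H_def by (intro sum.cong) (auto simp: proj_nth)
    have ne: "UNIV - {j} \<noteq> {}"
    proof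
      assume "UNIV - {j} = {}"
      then have "card (UNIV - {j}) = 0" by (simp only: card.empty)
      then show False using assms(1) by (simp add: card_Diff_singleton)
    qed
    have s: "(\<Sum>k\<in>UNIV - {j}. \<bar>h $ k\<bar>) \<le> n * norm (proj h)"
    proof -
      have "(\<Sum>k\<in>UNIV - {j}. \<bar>h $ k\<bar>) \<le> (\<Sum>k\<in>UNIV - {j}. norm (proj h))"
        using component_le_norm_cart[of "proj h"] by (intro sum_mono) (metis DiffE insertCI proj_nth)
      also have "\<dots> \<le> n * norm (proj h)"
        by (simp add: n_def card_Diff_singleton mult_right_mono)
      finally show ?thesis .
    qed
    have "B * norm (proj h) \<le> (\<Sum>i\<in>UNIV. \<bar>T (proj h) $ i\<bar>)"
      by (rule order_trans[OF B(2) norm_le_l1_cart])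
    also have "\<dots> = (\<Sum>i\<in>UNIV - {j}. \<bar>H i h\<bar>)"
      by (subst sum.remove[of _ j]) (auto simp: T_def HP proj_nth intro!: sum.cong)
    also have "\<dots> < (\<Sum>i\<in>UNIV - {j}. B / (n * n) * (\<Sum>k\<in>UNIV - {j}. \<bar>h $ k\<bar>))"
      using ne lt by (intro sum_strict_mono) auto
    also have "\<dots> = (n - 1) * (B / (n * n) * (\<Sum>k\<in>UNIV - {j}. \<bar>h $ k\<bar>))"
      by (simp add: n_def card_Diff_singleton of_nat_diff)
    also have "\<dots> \<le> n * (B / (n * n) * (n * norm (proj h)))"
      using B(1) n s by (intro mult_mono mult_left_mono) (auto intro!: mult_nonneg_nonneg sum_nonneg)
    also have "\<dots> = B * norm (proj h)" using n by simp
    finally show False by simp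
  qed
  then show ?thesis
    using B(1) n unfolding H_def by (intro exI[of _ "B / (n * n)"]) auto
qed

end

context level_chart
begin

lemma cube_subset_dom:
  assumes "open A" "proj p \<in> A"
  shows "\<exists>\<delta>>0. cube (proj p) \<delta> \<subseteq> A"
proof -
  obtain e where e: "0 < e" "cball (proj p) e \<subseteq> A"
    using assms open_contains_cball by blast
  define n where "n = real CARD('n)"
  have n: "0 < n" by (simp add: n_def)
  have "y \<in> cball (proj p) e" if "y \<in> cube (proj p) (2 * (e / n))" for y
  proof -
    have "norm (y - proj p) \<le> (\<Sum>i\<in>UNIV. \<bar>(y - proj p) $ i\<bar>)" by (rule norm_le_l1_cart)
    also have "\<dots> \<le> (\<Sum>i\<in>(UNIV::'n set). e / n)"
      using that by (intro sum_mono) (simp add: cube_def)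
    also have "\<dots> = e" using n by (simp add: n_def)
    finally show ?thesis by (simp add: dist_norm norm_minus_commute)
  qed
  with e n show ?thesis by (intro exI[of _ "2 * (e / n)"]) (auto simp: subset_iff)
qed

lemma proj_p_in_dom: "proj p \<in> dom" and chart_proj_p: "chart (proj p) = p"
proof -
  have "proj (proj p) = proj p" by (simp add: vec_eq_iff proj_nth)
  with V(2) chart_inverse[OF U'(3) g(2)] show "proj p \<in> dom" "chart (proj p) = p"
    by (simp_all add: dom_def chart_def)
qed

text \<open>On a small cube the derivatives of the slopes differ from their values at
  \<open>p\<close> by less than \<open>c / 2\<close>. By the mean value theorem the direction that
  \<open>hessian_lower_bound\<close> selects for \<open>h\<close> at \<open>p\<close> keeps half of
  its constant on the whole cube.\<close>

lemma nondegenerate: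
  assumes n2: "2 \<le> CARD('n)" and curv: "gaussian_curvature g p \<noteq> 0"
  shows "\<exists>\<delta> c. 0 < \<delta> \<and> cube (proj p) (4 * \<delta>) \<subseteq> dom \<and>
    nondegenerate_graph j (proj p) \<delta> (\<lambda>y. chart y $ j) (\<lambda>i y. slope i (chart y)) c"
proof -
  obtain c where c: "0 < c" "\<And>h. \<exists>i. i \<noteq> j \<and> c * (\<Sum>k\<in>UNIV - {j}. \<bar>h $ k\<bar>) \<le> \<bar>\<Sum>k\<in>UNIV - {j}. h $ k * tang k (slope i) p\<bar>"
    using hessian_lower_bound[OF n2 curv] by blast
  define A where "A = (\<Inter>i. \<Inter>k. dom \<inter> (\<lambda>y. \<bar>tang k (slope i) (chart y) - tang k (slope i) p\<bar>) -` {..< c / 2})"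
  have "open A"
    unfolding A_def
    by (intro open_INT ballI finite continuous_open_preimage open_dom continuous_intros
        continuous_on_chart_compose smooth_tang smooth_slope)
  moreover have "proj p \<in> A"
    using proj_p_in_dom c(1) by (simp add: A_def chart_proj_p)
  ultimately obtain \<delta>0 where \<delta>0: "0 < \<delta>0" "cube (proj p) \<delta>0 \<subseteq> A" using cube_subset_dom by blast
  \<comment> \<open>The open cube of \<open>nondegenerate_graph\<close> has half-side
    \<open>2 * \<delta>\<close>, so it lies in the compact cube of side
    \<open>4 * \<delta> = \<delta>0\<close>.\<close>
  define \<delta> where "\<delta> = \<delta>0 / 4"
  let ?K = "cube (proj p) (4 * \<delta>)"
  have \<delta>: "0 < \<delta>" "?K \<subseteq> A" using \<delta>0 by (auto simp: \<delta>_def)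
  have "A \<subseteq> dom" by (auto simp: A_def)
  with \<delta> have K: "compact ?K" "convex ?K" "?K \<subseteq> dom"
    by (auto simp: compact_cube) (simp add: cube_eq_cbox)
  let ?W = "{y. \<forall>i. \<bar>y $ i - proj p $ i\<bar> < 2 * \<delta>}"
  have W: "?W \<subseteq> ?K" by (auto simp: cube_def less_imp_le)
  have "nondegenerate_graph j (proj p) \<delta> (\<lambda>y. chart y $ j) (\<lambda>i y. slope i (chart y)) (c / 2)"
  proof
    show "continuous_on ?W (\<lambda>y. chart y $ j)"
      using W K by (intro continuous_on_subset[OF continuous_on_chart_compose[OF smooth_on_nth]]) auto
    show "((\<lambda>t. chart (y + t *\<^sub>R axis i 1) $ j) has_vector_derivative slope i (chart y)) (at 0)"
      if "i \<noteq> j" "y \<in> ?W" for i y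
      using directional_derivative[OF smooth_on_nth[of U j] _ that(1), of y] that W K
      by (auto simp: tang_nth)
    show "\<exists>B\<ge>0. dir_Ck (axis i 1) ?W B k (\<lambda>y. complex_of_real (slope i (chart y)))" if "i \<noteq> j" for i k
      by (rule dir_Ck_chart[OF W K(1,3) that smooth_slope])
    show "\<exists>B\<ge>0. \<forall>h. dir_Ck (axis i 1) (?W \<inter> {y. y + h \<in> ?W}) (B * (\<Sum>k\<in>UNIV - {j}. \<bar>h $ k\<bar>)) k
        (\<lambda>y. complex_of_real (slope i (chart (y + h)) - slope i (chart y)))" if "i \<noteq> j" for i k
      by (rule dir_Ck_chart_difference[OF W K that smooth_slope])
    show "\<exists>i. i \<noteq> j \<and> (\<forall>y\<in>?W. y + h \<in> ?W \<longrightarrow>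
        c / 2 * (\<Sum>k\<in>UNIV - {j}. \<bar>h $ k\<bar>) \<le> \<bar>slope i (chart (y + h)) - slope i (chart y)\<bar>)" for h
    proof -
      obtain i where i: "i \<noteq> j" "c * (\<Sum>k\<in>UNIV - {j}. \<bar>h $ k\<bar>) \<le> \<bar>\<Sum>k\<in>UNIV - {j}. h $ k * tang k (slope i) p\<bar>"
        using c(2) by blast
      have "c / 2 * (\<Sum>k\<in>UNIV - {j}. \<bar>h $ k\<bar>) \<le> \<bar>slope i (chart (y + h)) - slope i (chart y)\<bar>"
        if y: "y \<in> ?W" "y + h \<in> ?W" for y
      proof -
        have "y \<in> ?K" "y + h \<in> ?K" using y W by auto
        then obtain z where z: "z \<in> ?K" "slope i (chart (y + h)) - slope i (chart y) = (\<Sum>k\<in>UNIV - {j}. h $ k * tang k (slope i) (chart z))"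
          using chart_mvt[OF smooth_slope K(2,3)] by blast
        have "z \<in> A" using z(1) \<delta>(2) by blast
        then have close: "\<bar>tang k (slope i) (chart z) - tang k (slope i) p\<bar> \<le> c / 2" for k
          by (simp add: A_def less_imp_le)
        have "\<bar>(\<Sum>k\<in>UNIV - {j}. h $ k * tang k (slope i) (chart z)) - (\<Sum>k\<in>UNIV - {j}. h $ k * tang k (slope i) p)\<bar>
           = \<bar>\<Sum>k\<in>UNIV - {j}. h $ k * (tang k (slope i) (chart z) - tang k (slope i) p)\<bar>"
          by (simp add: sum_subtractf right_diff_distrib)
        also have "\<dots> \<le> (\<Sum>k\<in>UNIV - {j}. \<bar>h $ k * (tang k (slope i) (chart z) - tang k (slope i) p)\<bar>)"
          by (rule sum_abs)
        also have "\<dots> \<le> (\<Sum>k\<in>UNIV - {j}. \<bar>h $ k\<bar> * (c / 2))"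
          unfolding abs_mult by (intro sum_mono mult_left_mono close) auto
        also have "\<dots> = c / 2 * (\<Sum>k\<in>UNIV - {j}. \<bar>h $ k\<bar>)" by (simp add: sum_distrib_left mult.commute)
        finally have "\<bar>(\<Sum>k\<in>UNIV - {j}. h $ k * tang k (slope i) (chart z)) - (\<Sum>k\<in>UNIV - {j}. h $ k * tang k (slope i) p)\<bar>
            \<le> c / 2 * (\<Sum>k\<in>UNIV - {j}. \<bar>h $ k\<bar>)" .
        moreover have "c * (\<Sum>k\<in>UNIV - {j}. \<bar>h $ k\<bar>) = c / 2 * (\<Sum>k\<in>UNIV - {j}. \<bar>h $ k\<bar>) + c / 2 * (\<Sum>k\<in>UNIV - {j}. \<bar>h $ k\<bar>)"
          by (simp add: field_simps)
        ultimately show ?thesis using i(2) unfolding z(2) by linarith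
      qed
      with i(1) show ?thesis by blast
    qed
  qed (use n2 \<delta>(1) c(1) in auto)
  with \<delta>(1) K(3) show ?thesis by blast
qed

end

section \<open>Hausdorff measure of Lipschitz graphs\<close>

lemma hausdorff_content_finite_cover:
  assumes "finite I" "A \<subseteq> (\<Union>i\<in>I. C i)" "0 \<le> D" "D \<le> \<delta>" "0 \<le> \<delta>"
    and C: "\<And>i x y. i \<in> I \<Longrightarrow> x \<in> C i \<Longrightarrow> y \<in> C i \<Longrightarrow> dist x y \<le> D"
  shows "hausdorff_content d \<delta> (A :: 'a::real_normed_vector set)
    \<le> ennreal (real (card I) * (unit_ball_vol (real d) * (D / 2) ^ d))"
proof -
  obtain h where h: "bij_betw h {0..<card I} I"
    using ex_bij_betw_nat_finite[OF assms(1)] by blast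
  \<comment> \<open>Padding by empty sets turns the finite cover into a sequence; they have weight 0
    even for \<open>d = 0\<close>.\<close>
  define C' where "C' = (\<lambda>n. if n < card I then C (h n) else {})"
  have hI: "h n \<in> I" if "n < card I" for n using h that by (auto simp: bij_betw_def)
  have dist: "dist x y \<le> D" if "x \<in> C' n" "y \<in> C' n" for n x y
    using that C[OF hI] by (auto simp: C'_def split: if_splits)
  have bd: "bounded (C' n)" for n unfolding bounded_two_points using dist by blast
  have diam: "diameter (C' n) \<le> D" for n
    by (rule diameter_le) (use dist \<open>0 \<le> D\<close> in \<open>auto simp: dist_norm\<close>)
  have cov: "A \<subseteq> (\<Union>n. C' n)"
  proof
    fix x assume "x \<in> A"
    then obtain i where i: "i \<in> I" "x \<in> C i" using assms(2) by blast
    then have "i \<in> h ` {0..<card I}" using h by (simp add: bij_betw_def)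
    then obtain n where "n < card I" "h n = i" by auto
    with i show "x \<in> (\<Union>n. C' n)" by (auto simp: C'_def)
  qed
  have w: "hausdorff_weight d (C' n) \<le> ennreal (unit_ball_vol (real d) * (D / 2) ^ d)" for n
    unfolding hausdorff_weight_def using diam[of n] diameter_ge_0[OF bd[of n]] \<open>0 \<le> D\<close>
    by (auto intro!: ennreal_leI mult_left_mono power_mono)
  have "hausdorff_content d \<delta> A \<le> (\<Sum>n. hausdorff_weight d (C' n))"
    unfolding hausdorff_content_def
    using cov bd order_trans[OF diam \<open>D \<le> \<delta>\<close>] by (intro INF_lower) auto
  also have "\<dots> = (\<Sum>n<card I. hausdorff_weight d (C' n))"
    by (rule suminf_finite) (auto simp: C'_def)
  also have "\<dots> \<le> (\<Sum>n<card I. ennreal (unit_ball_vol (real d) * (D / 2) ^ d))"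
    by (intro sum_mono w)
  also have "\<dots> = ennreal (real (card I) * (unit_ball_vol (real d) * (D / 2) ^ d))"
    using \<open>0 \<le> D\<close> by (simp add: ennreal_mult ennreal_of_nat_eq_real_of_nat)
  finally show ?thesis .
qed

lemma ex_subinterval:
  assumes "0 \<le> a" "0 \<le> t" "t \<le> real m * a" "0 < m"
  shows "\<exists>k<m. real k * a \<le> t \<and> t \<le> real (Suc k) * a"
  using assms(3,4)
proof (induction m)
  case (Suc m)
  show ?case
  proof (cases "m = 0 \<or> real m * a < t")
    case True
    with Suc.prems assms(2) show ?thesis by (intro exI[of _ m]) auto
  next
    case False
    with Suc.IH show ?thesis by (auto intro: less_SucI)
  qed
qed simp

text \<open>By \<open>graph\<close> every point of \<open>A\<close> has a segment of parameters of
  length \<open>\<delta>\<close> in the dummy coordinate. The parameter set of \<open>A\<close> thus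
  contains a cylinder of height \<open>\<delta>\<close> over the shadow of \<open>A\<close> in the
  hyperplane.\<close>

locale lipschitz_graph =
  fixes j :: "'n::finite" and q :: "real^'n" and \<delta> L :: real and \<Phi> :: "real^'n \<Rightarrow> real^'n" and A :: "(real^'n) set"
  assumes n2: "2 \<le> CARD('n)" and \<delta>: "0 < \<delta>" and L: "0 \<le> L" and qj: "q $ j = 0"
    and lip: "\<And>y y'. y \<in> cube q \<delta> \<Longrightarrow> y' \<in> cube q \<delta> \<Longrightarrow> dist (\<Phi> y) (\<Phi> y') \<le> L * dist y y'"
    and graph: "\<And>x t. x \<in> A \<Longrightarrow> \<bar>t\<bar> \<le> \<delta> / 2 \<Longrightarrow>
      (\<chi> i. if i = j then t else x $ i) \<in> cube q \<delta> \<and> \<Phi> (\<chi> i. if i = j then t else x $ i) = x"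
begin

definition slab :: "real^'n \<Rightarrow> real \<Rightarrow> (real^'n) set" where
  "slab u s = {x \<in> A. \<forall>i. i \<noteq> j \<longrightarrow> u $ i \<le> x $ i \<and> x $ i \<le> u $ i + s}"

text \<open>Chosen so that \<open>C0 * s ^ d\<close>, with \<open>d = CARD('n) - 1\<close>, is the
  Hausdorff weight of a nonempty set of diameter \<open>L * CARD('n) * s\<close>, the bound of
  \<open>slab_dist\<close>.\<close>

definition C0 :: real where
  "C0 = unit_ball_vol (real (CARD('n) - 1)) * (L * CARD('n) / 2) ^ (CARD('n) - 1)"

lemma C0_nonneg: "0 \<le> C0"
  using L by (simp add: C0_def)

lemma slab_dist:
  assumes "x \<in> slab u s" "x' \<in> slab u s" "0 \<le> s"
  shows "dist x x' \<le> L * CARD('n) * s"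
proof -
  define y where "y = (\<lambda>x::real^'n. \<chi> i. if i = j then 0 else x $ i)"
  have x: "y x \<in> cube q \<delta>" "\<Phi> (y x) = x" "y x' \<in> cube q \<delta>" "\<Phi> (y x') = x'"
    using graph[of x 0] graph[of x' 0] assms \<delta> by (auto simp: slab_def y_def)
  have "dist x x' \<le> L * dist (y x) (y x')" using lip[OF x(1,3)] x by simp
  also have "dist (y x) (y x') \<le> (\<Sum>i\<in>UNIV. \<bar>(y x - y x') $ i\<bar>)"
    unfolding dist_norm by (rule norm_le_l1_cart)
  also have "\<dots> \<le> (\<Sum>i\<in>(UNIV::'n set). s)"
  proof (rule sum_mono)
    fix i
    show "\<bar>(y x - y x') $ i\<bar> \<le> s"
      using assms by (cases "i = j") (auto simp: y_def slab_def abs_le_iff dest!: spec[of _ i])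
  qed
  finally show ?thesis using L by (simp add: mult_left_mono mult.assoc)
qed

text \<open>Dividing the base cube into \<open>m ^ d\<close> cells of side \<open>s / m\<close> also
  divides the weight of each piece by \<open>m ^ d\<close>. The total does not depend on
  \<open>m\<close>, while the diameters become as small as desired.\<close>

lemma hausdorff_slab:
  assumes s: "0 \<le> s"
  shows "hausdorff_outer_measure (CARD('n) - 1) (slab u s) \<le> ennreal (C0 * s ^ (CARD('n) - 1))"
  unfolding hausdorff_outer_measure_def
proof (rule SUP_least)
  fix \<eta> :: real assume "\<eta> \<in> {0<..}"
  then have \<eta>: "0 < \<eta>" by simp
  define d where "d = CARD('n) - 1"
  define c where "c = L * CARD('n) * s"
  have c: "0 \<le> c" using L s by (simp add: c_def)
  obtain m :: nat where m: "c / \<eta> < real m" using reals_Archimedean2 by blast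
  have m0: "0 < m" using m c \<eta> by (cases m) (auto simp: divide_less_0_iff not_less)
  define a where "a = s / real m"
  have a: "0 \<le> a" "real m * a = s" using s m0 by (auto simp: a_def)
  define D where "D = c / real m"
  have D: "0 \<le> D" "D \<le> \<eta>" using c m m0 \<eta> by (auto simp: D_def field_simps)
  \<comment> \<open>A grid cell is indexed by its position in each coordinate other than
    \<open>j\<close>.\<close>
  define I where "I = (UNIV - {j}) \<rightarrow>\<^sub>E {..<m}"
  have fI: "finite I" unfolding I_def by (intro finite_PiE) auto
  have cI: "card I = m ^ d"
    unfolding I_def by (subst card_PiE) (auto simp: d_def card_Diff_singleton)
  define C where "C = (\<lambda>\<kappa>::'n \<Rightarrow> nat. slab (\<chi> i. u $ i + real (\<kappa> i) * a) a)"
  have "slab u s \<subseteq> (\<Union>\<kappa>\<in>I. C \<kappa>)"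
  proof
    fix x assume x: "x \<in> slab u s"
    have "\<exists>k. k < m \<and> u $ i + real k * a \<le> x $ i \<and> x $ i \<le> u $ i + real k * a + a" if "i \<noteq> j" for i
      using ex_subinterval[of a "x $ i - u $ i" m] a m0 x that
      by (force simp: slab_def algebra_simps)
    then obtain \<kappa> where \<kappa>: "\<And>i. i \<noteq> j \<Longrightarrow> \<kappa> i < m \<and> u $ i + real (\<kappa> i) * a \<le> x $ i \<and> x $ i \<le> u $ i + real (\<kappa> i) * a + a"
      by metis
    show "x \<in> (\<Union>\<kappa>\<in>I. C \<kappa>)"
    proof (rule UN_I[of "restrict \<kappa> (UNIV - {j})"])
      show "restrict \<kappa> (UNIV - {j}) \<in> I" using \<kappa> by (auto simp: I_def)
      show "x \<in> C (restrict \<kappa> (UNIV - {j}))" using x \<kappa> by (auto simp: C_def slab_def)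
    qed
  qed
  then have "hausdorff_content d \<eta> (slab u s) \<le> ennreal (real (card I) * (unit_ball_vol (real d) * (D / 2) ^ d))"
  proof (rule hausdorff_content_finite_cover[OF fI _ D])
    show "dist x y \<le> D" if "x \<in> C \<kappa>" "y \<in> C \<kappa>" for \<kappa> x y
      using slab_dist[OF that[unfolded C_def] a(1)] by (simp add: D_def c_def a_def)
  qed (use \<eta> in auto)
  also have "real (card I) * (unit_ball_vol (real d) * (D / 2) ^ d) = unit_ball_vol (real d) * (real m * (D / 2)) ^ d"
    unfolding cI by (simp only: of_nat_power power_mult_distrib mult_ac)
  also have "real m * (D / 2) = L * CARD('n) / 2 * s" using m0 by (simp add: D_def c_def)
  also have "unit_ball_vol (real d) * (L * CARD('n) / 2 * s) ^ d = C0 * s ^ d"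
    unfolding C0_def d_def by (simp only: power_mult_distrib mult.assoc)
  finally show "hausdorff_content (CARD('n) - 1) \<eta> (slab u s) \<le> ennreal (C0 * s ^ (CARD('n) - 1))"
    by (simp add: d_def)
qed

text \<open>A slicing argument. Cover the parameter set by almost disjoint cubes of nearly the same
  total volume. For each height \<open>t\<close> the slabs of the cubes met by the slice at
  \<open>t\<close> cover \<open>A\<close>, so the Hausdorff measure of \<open>A\<close> is at most
  the sum of \<open>C0 * s ^ d\<close> over the sides \<open>s\<close> of these cubes. Integrating
  over an interval of length \<open>\<delta>\<close> turns each summand into \<open>C0\<close> times
  the volume of its cube.\<close>

lemma hausdorff_le_lborel:
  assumes Z: "{y \<in> cube q \<delta>. \<Phi> y \<in> A} \<in> sets borel"
  shows "ennreal \<delta> * hausdorff_outer_measure (CARD('n) - 1) A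
    \<le> ennreal C0 * emeasure lborel {y \<in> cube q \<delta>. \<Phi> y \<in> A}"
proof -
  define Z where "Z = {y \<in> cube q \<delta>. \<Phi> y \<in> A}"
  define d where "d = CARD('n) - 1"
  have dn: "CARD('n) = Suc d" using n2 by (simp add: d_def)
  let ?a = "\<chi> i. q $ i - \<delta> / 2" and ?b = "\<chi> i. q $ i + \<delta> / 2"
  have Zb: "Z \<in> sets borel" using Z by (simp add: Z_def)
  have Zc: "Z \<subseteq> cbox ?a ?b" by (auto simp: Z_def cube_eq_cbox)
  have fin: "emeasure lborel Z < \<infinity>"
    using emeasure_mono[OF Zc, of lborel] emeasure_compact_finite[of "cbox ?a ?b"] by (auto intro: le_less_trans)
  have Zl: "Z \<in> lmeasurable" using Zb fin by (intro fmeasurableI) auto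
  have eZ: "ennreal (measure lebesgue Z) = emeasure lborel Z"
    using Zb emeasure_eq_measure2[OF Zl] by simp
  have "ennreal \<delta> * hausdorff_outer_measure d A \<le> ennreal C0 * emeasure lborel Z + ennreal e" if e: "0 < e" for e
  proof -
    \<comment> \<open>Leaves room for the later factor \<open>C0\<close>, since
      \<open>C0 * e' \<le> e\<close>.\<close>
    define e' where "e' = e / (C0 + 1)"
    have e': "0 < e'" using e C0_nonneg by (simp add: e'_def add_nonneg_pos)
    obtain \<D> where \<D>: "countable \<D>"
        "\<And>K. K \<in> \<D> \<Longrightarrow> K \<subseteq> cbox ?a ?b \<and> K \<noteq> {} \<and> (\<exists>c d. K = cbox c d)"
        "pairwise (\<lambda>A B. interior A \<inter> interior B = {}) \<D>"
        "\<And>u v. cbox u v \<in> \<D> \<Longrightarrow> \<exists>n. \<forall>i \<in> Basis. v \<bullet> i - u \<bullet> i = (?b \<bullet> i - ?a \<bullet> i)/2^n"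
        "Z \<subseteq> \<Union>\<D>" "\<Union>\<D> \<in> lmeasurable" "measure lebesgue (\<Union>\<D>) \<le> measure lebesgue Z + e'"
      by (rule measurable_outer_intervals_bounded[OF Zl Zc e']) blast
    have cubes: "\<exists>u s. 0 \<le> s \<and> K = cbox u (u + (\<chi> i. s))" if K: "K \<in> \<D>" for K
    proof -
      obtain u v where uv: "K = cbox u v" using \<D>(2)[OF K] by blast
      obtain n where n: "\<forall>i\<in>Basis. v \<bullet> i - u \<bullet> i = (?b \<bullet> i - ?a \<bullet> i)/2^n" using \<D>(4)[of u v] K uv by blast
      have "v $ i - u $ i = \<delta> / 2 ^ n" for i
        using n[rule_format, of "axis i 1"] by (auto simp: Basis_vec_def inner_axis)
      then have "v = u + (\<chi> i. \<delta> / 2 ^ n)" by (simp add: vec_eq_iff algebra_simps)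
      then show ?thesis using uv \<delta> by (intro exI[of _ u] exI[of _ "\<delta> / 2 ^ n"]) auto
    qed
    then obtain uf sf where us: "\<And>K. K \<in> \<D> \<Longrightarrow> 0 \<le> sf K" "\<And>K. K \<in> \<D> \<Longrightarrow> K = cbox (uf K) (uf K + (\<chi> i. sf K))"
      by metis
    \<comment> \<open>\<open>\<D>\<close> may be finite; \<open>ind n\<close> marks the indices that
      its enumeration uses, and all other terms of the series are 0.\<close>
    define ind where "ind = (\<lambda>n. n \<in> to_nat_on \<D> ` \<D>)"
    define Kn where "Kn = from_nat_into \<D>"
    have KnD: "Kn n \<in> \<D>" if "ind n" for n
      using that \<D>(1) by (auto simp: ind_def Kn_def)
    have Kn_inj: "n = n'" if "ind n" "ind n'" "Kn n = Kn n'" for n n'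
      using that \<D>(1) by (auto simp: ind_def Kn_def)
    have Kn_surj: "\<exists>n. ind n \<and> Kn n = K" if "K \<in> \<D>" for K
      using that \<D>(1) by (intro exI[of _ "to_nat_on \<D> K"]) (auto simp: ind_def Kn_def)
    define w where "w = (\<lambda>n. if ind n then ennreal (C0 * sf (Kn n) ^ d) else 0)"
    define lo where "lo = (\<lambda>n. uf (Kn n) $ j)"
    define s where "s = (\<lambda>n. if ind n then sf (Kn n) else 0)"
    have s: "0 \<le> s n" for n using us(1)[OF KnD] by (simp add: s_def)
    have pt: "hausdorff_outer_measure d A * indicator {- \<delta> / 2..\<delta> / 2} t
        \<le> (\<Sum>n. w n * indicator {lo n..lo n + s n} t)" for t
    proof (cases "\<bar>t\<bar> \<le> \<delta> / 2")
      case True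
      define P where "P = (\<lambda>n. if ind n \<and> t \<in> {lo n..lo n + s n} then slab (uf (Kn n)) (sf (Kn n)) else {})"
      have "A \<subseteq> (\<Union>n. P n)"
      proof
        fix x assume x: "x \<in> A"
        let ?y = "\<chi> i. if i = j then t else x $ i"
        have "?y \<in> Z" using graph[OF x True] x by (simp add: Z_def)
        then obtain K where K: "K \<in> \<D>" "?y \<in> K" using \<D>(5) by blast
        obtain n where n: "ind n" "Kn n = K" using Kn_surj[OF K(1)] by blast
        have "?y \<in> cbox (uf K) (uf K + (\<chi> i. sf K))" using K us(2) by blast
        then have b: "uf K $ i \<le> ?y $ i \<and> ?y $ i \<le> uf K $ i + sf K" for i
          by (simp add: mem_box_cart)
        have "t \<in> {lo n..lo n + s n}" using b[of j] n by (simp add: lo_def s_def)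
        moreover have "x \<in> slab (uf K) (sf K)"
          unfolding slab_def using x b by (auto split: if_splits) (metis (full_types))+
        ultimately show "x \<in> (\<Union>n. P n)" using n by (auto simp: P_def)
      qed
      then have "hausdorff_outer_measure d A \<le> (\<Sum>n. hausdorff_outer_measure d (P n))"
        by (rule order_trans[OF hausdorff_outer_measure_mono hausdorff_outer_measure_countably_subadditive])
      also have "\<dots> \<le> (\<Sum>n. w n * indicator {lo n..lo n + s n} t)"
      proof (intro suminf_le allI)
        fix n
        show "hausdorff_outer_measure d (P n) \<le> w n * indicator {lo n..lo n + s n} t"
          using hausdorff_slab[OF us(1)[OF KnD], of n "uf (Kn n)"] by (auto simp: P_def w_def d_def)
      qed auto
      finally show ?thesis using True by (auto simp: indicator_def)
    next
      case False
      then show ?thesis by (auto simp: indicator_def)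
    qed
    have "ennreal \<delta> * hausdorff_outer_measure d A = (\<integral>\<^sup>+t. hausdorff_outer_measure d A * indicator {- \<delta> / 2..\<delta> / 2} t \<partial>lborel)"
      using \<delta> by (subst nn_integral_cmult_indicator) (auto simp: mult.commute)
    also have "\<dots> \<le> (\<integral>\<^sup>+t. (\<Sum>n. w n * indicator {lo n..lo n + s n} t) \<partial>lborel)"
      by (intro nn_integral_mono pt)
    also have "\<dots> = (\<Sum>n. (\<integral>\<^sup>+t. w n * indicator {lo n..lo n + s n} t \<partial>lborel))"
      by (rule nn_integral_suminf) auto
    also have "\<dots> = (\<Sum>n. w n * ennreal (s n))"
      using s by (subst nn_integral_cmult_indicator) auto
    \<comment> \<open>\<open>s ^ d * s\<close> is the volume of a cube of side \<open>s\<close>. The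
      open boxes are taken because the closed cubes may share boundary points.\<close>
    also have "\<dots> = (\<Sum>n. ennreal C0 * emeasure lborel (if ind n then box (uf (Kn n)) (uf (Kn n) + (\<chi> i. sf (Kn n))) else {}))"
    proof (rule arg_cong[of _ _ suminf], rule ext)
      fix n
      show "w n * ennreal (s n) = ennreal C0 * emeasure lborel (if ind n then box (uf (Kn n)) (uf (Kn n) + (\<chi> i. sf (Kn n))) else {})"
      proof (cases "ind n")
        case True
        have s0: "0 \<le> sf (Kn n)" using us(1)[OF KnD[OF True]] .
        have b: "(\<chi> i. sf (Kn n)) \<bullet> b = sf (Kn n)" if "b \<in> (Basis :: (real^'n) set)" for b
          using that by (auto simp: Basis_vec_def inner_axis)
        have "emeasure lborel (box (uf (Kn n)) (uf (Kn n) + (\<chi> i. sf (Kn n)))) = ennreal (sf (Kn n) ^ CARD('n))"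
          using s0 by (subst emeasure_lborel_box) (auto simp: inner_add_left b)
        then show ?thesis
          using True s0 C0_nonneg by (simp add: w_def s_def dn ennreal_mult[symmetric] mult_ac)
      qed (simp add: w_def)
    qed
    also have "\<dots> = ennreal C0 * (\<Sum>n. emeasure lborel (if ind n then box (uf (Kn n)) (uf (Kn n) + (\<chi> i. sf (Kn n))) else {}))"
      by (rule ennreal_suminf_cmult)
    also have "(\<Sum>n. emeasure lborel (if ind n then box (uf (Kn n)) (uf (Kn n) + (\<chi> i. sf (Kn n))) else {}))
        = emeasure lborel (\<Union>n. (if ind n then box (uf (Kn n)) (uf (Kn n) + (\<chi> i. sf (Kn n))) else {}))"
    proof (rule suminf_emeasure)
      show "disjoint_family (\<lambda>n. if ind n then box (uf (Kn n)) (uf (Kn n) + (\<chi> i. sf (Kn n))) else {})"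
        unfolding disjoint_family_on_def
      proof (intro ballI impI)
        fix n n' :: nat assume "n \<noteq> n'"
        show "(if ind n then box (uf (Kn n)) (uf (Kn n) + (\<chi> i. sf (Kn n))) else {}) \<inter>
          (if ind n' then box (uf (Kn n')) (uf (Kn n') + (\<chi> i. sf (Kn n'))) else {}) = {}"
        proof (cases "ind n \<and> ind n'")
          case True
          then have "Kn n \<noteq> Kn n'" using Kn_inj \<open>n \<noteq> n'\<close> by blast
          then have "interior (Kn n) \<inter> interior (Kn n') = {}"
            using \<D>(3) True KnD by (auto simp: pairwise_def)
          moreover have "interior (Kn m) = box (uf (Kn m)) (uf (Kn m) + (\<chi> i. sf (Kn m)))" if "ind m" for m
            by (subst us(2)[OF KnD[OF that]]) (rule interior_cbox)
          ultimately show ?thesis using True by simp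
        qed auto
      qed
    qed auto
    also have "\<dots> \<le> emeasure lborel (\<Union>\<D>)"
    proof (rule emeasure_mono)
      show "(\<Union>n. (if ind n then box (uf (Kn n)) (uf (Kn n) + (\<chi> i. sf (Kn n))) else {})) \<subseteq> \<Union>\<D>"
      proof (rule UN_least)
        fix n
        show "(if ind n then box (uf (Kn n)) (uf (Kn n) + (\<chi> i. sf (Kn n))) else {}) \<subseteq> \<Union>\<D>"
        proof (cases "ind n")
          case True
          have "box (uf (Kn n)) (uf (Kn n) + (\<chi> i. sf (Kn n))) \<subseteq> Kn n"
            by (subst (3) us(2)[OF KnD[OF True]]) (rule box_subset_cbox)
          with KnD[OF True] True show ?thesis by auto
        qed simp
      qed
      show "\<Union>\<D> \<in> sets lborel"
        using \<D>(1,2) by (intro sets.countable_Union) (auto, metis closed_cbox borel_closed)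
    qed
    also have "emeasure lborel (\<Union>\<D>) \<le> emeasure lborel Z + ennreal e'"
    proof -
      have Db: "\<Union>\<D> \<in> sets lborel"
        using \<D>(1,2) by (intro sets.countable_Union) (auto, metis closed_cbox borel_closed)
      have "emeasure lborel (\<Union>\<D>) = ennreal (measure lebesgue (\<Union>\<D>))"
        using Db emeasure_eq_measure2[OF \<D>(6)] by simp
      also have "\<dots> \<le> ennreal (measure lebesgue Z + e')" using \<D>(7) by (rule ennreal_leI)
      also have "\<dots> = emeasure lborel Z + ennreal e'" using e' by (simp add: eZ[symmetric])
      finally show ?thesis .
    qed
    finally have "ennreal \<delta> * hausdorff_outer_measure d A \<le> ennreal C0 * (emeasure lborel Z + ennreal e')"
      by (meson mult_left_mono zero_le)
    also have "\<dots> = ennreal C0 * emeasure lborel Z + ennreal (C0 * e')"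
      using C0_nonneg e' by (simp add: distrib_left ennreal_mult)
    also have "\<dots> \<le> ennreal C0 * emeasure lborel Z + ennreal e"
    proof (intro add_left_mono ennreal_leI)
      show "C0 * e' \<le> e" using C0_nonneg e by (simp add: e'_def field_simps)
    qed
    finally show ?thesis .
  qed
  then show ?thesis unfolding Z_def d_def by (rule ennreal_le_epsilon)
qed

end

section \<open>Covering a hypersurface by decaying measures\<close>

lemma cube_mono: "r \<le> r' \<Longrightarrow> cube q r \<subseteq> cube q r'"
  unfolding cube_def by (auto intro: order_trans)

context level_chart
begin

lemma chart_lipschitz:
  assumes K: "compact K" "convex K" "K \<subseteq> dom"
  shows "\<exists>L\<ge>0. \<forall>y\<in>K. \<forall>y'\<in>K. dist (chart y) (chart y') \<le> L * dist y y'"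
proof -
  obtain B where B: "0 \<le> B" "\<forall>y h. y \<in> K \<longrightarrow> y + h \<in> K \<longrightarrow>
      \<bar>chart (y + h) $ j - chart y $ j\<bar> \<le> B * (\<Sum>k\<in>UNIV - {j}. \<bar>h $ k\<bar>)"
    using chart_difference_bounded[OF smooth_on_nth K] by blast
  define n where "n = real CARD('n)"
  have "dist (chart y) (chart y') \<le> ((B + 1) * n) * dist y y'" if y: "y \<in> K" "y' \<in> K" for y y'
  proof -
    let ?s = "\<Sum>k\<in>UNIV - {j}. \<bar>(y - y') $ k\<bar>"
    have "dist (chart y) (chart y') \<le> (\<Sum>i\<in>UNIV. \<bar>(chart y - chart y') $ i\<bar>)"
      unfolding dist_norm by (rule norm_le_l1_cart)
    also have "\<dots> = \<bar>chart y $ j - chart y' $ j\<bar> + (\<Sum>i\<in>UNIV - {j}. \<bar>(chart y - chart y') $ i\<bar>)"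
      by (subst sum.remove[of _ j]) auto
    also have "(\<Sum>i\<in>UNIV - {j}. \<bar>(chart y - chart y') $ i\<bar>) = ?s"
      using y K(3) by (intro sum.cong) (auto simp: chart_nth subset_iff)
    also have "\<bar>chart y $ j - chart y' $ j\<bar> \<le> B * ?s"
      using B(2)[rule_format, of y' "y - y'"] y by simp
    also have "B * ?s + ?s = (B + 1) * ?s" by (simp add: algebra_simps)
    also have "\<dots> \<le> (B + 1) * (n * dist y y')"
    proof (rule mult_left_mono)
      have "?s \<le> (\<Sum>k\<in>UNIV. \<bar>(y - y') $ k\<bar>)" by (intro sum_mono2) auto
      also have "\<dots> \<le> (\<Sum>k\<in>(UNIV::'n set). dist y y')"
        unfolding dist_norm by (intro sum_mono component_le_norm_cart)
      finally show "?s \<le> n * dist y y'" by (simp add: n_def)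
    qed (use B in auto)
    finally show ?thesis by (simp add: mult.assoc)
  qed
  with B(1) show ?thesis by (intro exI[of _ "(B + 1) * n"]) (auto simp: n_def)
qed

text \<open>\<open>\<mu>\<close> is a multiple of the decaying image measure. The weight
  \<open>\<psi>\<close> is bounded below on the cube of side \<open>\<delta>\<close>, and
  \<open>hausdorff_le_lborel\<close> compares the Hausdorff measure with the volume of the
  parameters in that cube, so a suitable multiple dominates.\<close>

lemma local_measure:
  assumes n2: "2 \<le> CARD('n)" and curv: "gaussian_curvature g p \<noteq> 0"
  shows "\<exists>Q \<mu> C. open Q \<and> p \<in> Q \<and> finite_measure \<mu> \<and> sets \<mu> = sets borel \<and> 0 \<le> C \<and>
    (\<forall>x. (norm (\<integral>\<xi>. exp (- 2 * of_real pi * \<i> * of_real (x \<bullet> \<xi>)) \<partial>\<mu>))\<^sup>2 \<le> C * (1 / (1 + norm x)) ^ (CARD('n) - 1)) \<and>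
    (\<forall>A\<in>sets borel. A \<subseteq> {x \<in> Q. g x = 0} \<longrightarrow> hausdorff_outer_measure (CARD('n) - 1) A \<le> emeasure \<mu> A)"
proof -
  obtain \<delta> c where \<delta>: "0 < \<delta>" and K: "cube (proj p) (4 * \<delta>) \<subseteq> dom"
    and ng: "nondegenerate_graph j (proj p) \<delta> (\<lambda>y. chart y $ j) (\<lambda>i y. slope i (chart y)) c"
    using nondegenerate[OF n2 curv] by blast
  define N where "N = 2 * (CARD('n) - 1)"
  define q where "q = proj p"
  define \<psi> where "\<psi> = bump q \<delta> (Suc N)"
  obtain C where C: "0 \<le> C" "\<And>x. (norm (\<integral>y. exp (\<i> * complex_of_real (- 2 * pi * graph_phase j (\<lambda>y. chart y $ j) x y)) *
      complex_of_real (\<psi> y) \<partial>lborel))\<^sup>2 \<le> C * (1 / (1 + norm x)) ^ (CARD('n) - 1)"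
    using nondegenerate_graph.fourier_decay[OF ng] nondegenerate_graph.F_def[OF ng]
    unfolding \<psi>_def q_def N_def by auto
  have cK: "compact (cube q (4 * \<delta>))" "convex (cube q (4 * \<delta>))"
    by (simp_all add: compact_cube) (simp add: cube_eq_cbox)
  obtain L where L: "0 \<le> L" "\<forall>y\<in>cube q (4 * \<delta>). \<forall>y'\<in>cube q (4 * \<delta>). dist (chart y) (chart y') \<le> L * dist y y'"
    using chart_lipschitz[OF cK] K by (auto simp: q_def)
  have sub: "cube q \<delta> \<subseteq> cube q (4 * \<delta>)" "cube q (2 * \<delta>) \<subseteq> cube q (4 * \<delta>)"
    using \<delta> by (auto intro!: cube_mono)
  \<comment> \<open>Cut off to be Borel measurable on the whole space; the cube contains the support
    of \<open>\<psi>\<close>, so integrals with weight \<open>\<psi>\<close> see only the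
    chart.\<close>
  define \<Phi> where "\<Phi> = (\<lambda>y. indicator (cube q (4 * \<delta>)) y *\<^sub>R chart y)"
  have \<Phi>[measurable]: "\<Phi> \<in> borel_measurable borel"
    unfolding \<Phi>_def
    by (rule borel_measurable_continuous_on_indicator[OF borel_compact[OF cK(1)] continuous_on_subset[OF chart_continuous]])
       (use K in \<open>simp add: q_def\<close>)
  have \<psi>0: "\<psi> y = 0" if "y \<notin> cube q (2 * \<delta>)" for y
    unfolding \<psi>_def by (rule bump_eq_0[OF \<delta> _ that]) simp
  have \<psi>nn: "0 \<le> \<psi> y" for y unfolding \<psi>_def by (rule bump_nonneg)
  have \<psi>i: "integrable lborel \<psi>"
  proof -
    have "integrable lborel (\<lambda>y. indicator (cube q (2 * \<delta>)) y *\<^sub>R \<psi> y)"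
      unfolding \<psi>_def by (rule borel_integrable_compact[OF compact_cube continuous_on_bump])
    also have "(\<lambda>y. indicator (cube q (2 * \<delta>)) y *\<^sub>R \<psi> y) = \<psi>"
      by (rule ext) (simp add: \<psi>0 split: split_indicator)
    finally show ?thesis .
  qed
  have [measurable]: "\<psi> \<in> borel_measurable borel" using \<psi>i by auto
  define b where "b = ((3 / 4 * \<delta>\<^sup>2) ^ Suc N) ^ CARD('n)"
  have b: "0 < b" using \<delta> by (simp add: b_def)
  have \<psi>b: "b \<le> \<psi> y" if "y \<in> cube q \<delta>" for y
    unfolding b_def \<psi>_def by (rule bump_ge[OF that \<delta>])
  define k where "k = unit_ball_vol (real (CARD('n) - 1)) * (L * CARD('n) / 2) ^ (CARD('n) - 1)"
  have k: "0 \<le> k" using L by (simp add: k_def)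
  \<comment> \<open>\<open>\<delta>\<close> times the Hausdorff measure is at most \<open>k\<close>
    times the volume of the parameters, on which \<open>\<psi>\<close> is at least \<open>b\<close>;
    the choice makes \<open>c1 * b = k / \<delta>\<close>.\<close>
  define c1 where "c1 = k / (\<delta> * b)"
  have c1: "0 \<le> c1" using k \<delta> b by (simp add: c1_def)
  define \<mu> where "\<mu> = distr (density lborel (\<lambda>y. ennreal (c1 * \<psi> y))) borel \<Phi>"
  have sets\<mu>: "sets \<mu> = sets borel" by (simp add: \<mu>_def)
  have "emeasure \<mu> (space \<mu>) = (\<integral>\<^sup>+y. ennreal (c1 * \<psi> y) \<partial>lborel)"
    by (simp add: \<mu>_def emeasure_distr emeasure_density)
  also have "\<dots> = ennreal (\<integral>y. c1 * \<psi> y \<partial>lborel)"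
    using \<psi>i c1 \<psi>nn by (intro nn_integral_eq_integral) auto
  finally have fin: "finite_measure \<mu>" by (intro finite_measureI) simp
  have ft: "(\<integral>\<xi>. exp (- 2 * of_real pi * \<i> * of_real (x \<bullet> \<xi>)) \<partial>\<mu>)
     = of_real c1 * (\<integral>y. exp (\<i> * complex_of_real (- 2 * pi * graph_phase j (\<lambda>y. chart y $ j) x y)) * complex_of_real (\<psi> y) \<partial>lborel)"
    (is "?l = _ * ?r") for x
  proof -
    have [measurable]: "(\<lambda>\<xi>::real^'n. exp (- 2 * of_real pi * \<i> * of_real (x \<bullet> \<xi>)) :: complex) \<in> borel_measurable borel"
      by (intro borel_measurable_continuous_onI continuous_intros)
    have "?l = (\<integral>y. exp (- 2 * of_real pi * \<i> * of_real (x \<bullet> \<Phi> y)) \<partial>density lborel (\<lambda>y. ennreal (c1 * \<psi> y)))"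
      unfolding \<mu>_def by (rule integral_distr) auto
    also have "\<dots> = (\<integral>y. (c1 * \<psi> y) *\<^sub>R exp (- 2 * of_real pi * \<i> * of_real (x \<bullet> \<Phi> y)) \<partial>lborel)"
      by (rule integral_density) (use c1 \<psi>nn in auto)
    also have "\<dots> = (\<integral>y. of_real c1 * (exp (\<i> * complex_of_real (- 2 * pi * graph_phase j (\<lambda>y. chart y $ j) x y)) * complex_of_real (\<psi> y)) \<partial>lborel)"
    proof (rule Bochner_Integration.integral_cong[OF refl])
      fix y
      show "(c1 * \<psi> y) *\<^sub>R exp (- 2 * of_real pi * \<i> * of_real (x \<bullet> \<Phi> y))
        = of_real c1 * (exp (\<i> * complex_of_real (- 2 * pi * graph_phase j (\<lambda>y. chart y $ j) x y)) * complex_of_real (\<psi> y))"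
      proof (cases "y \<in> cube q (2 * \<delta>)")
        case True
        then have yd: "y \<in> dom" "y \<in> cube q (4 * \<delta>)" using sub K by (auto simp: q_def)
        have "x \<bullet> \<Phi> y = (\<Sum>i\<in>UNIV. x $ i * chart y $ i)"
          using yd by (simp add: \<Phi>_def inner_vec_def)
        also have "\<dots> = x $ j * chart y $ j + (\<Sum>i\<in>UNIV - {j}. x $ i * chart y $ i)"
          by (rule sum.remove) auto
        also have "(\<Sum>i\<in>UNIV - {j}. x $ i * chart y $ i) = (\<Sum>i\<in>UNIV - {j}. x $ i * y $ i)"
          using yd by (intro sum.cong) (auto simp: chart_nth)
        finally have "x \<bullet> \<Phi> y = graph_phase j (\<lambda>y. chart y $ j) x y" by (simp add: graph_phase_def)
        then show ?thesis by (simp add: scaleR_conv_of_real mult_ac)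
      qed (simp add: \<psi>0)
    qed
    finally show ?thesis by simp
  qed
  \<comment> \<open>Besides \<open>U'\<close> only the coordinates other than \<open>j\<close> are
    restricted: over such a point the whole parameter segment lies in
    \<open>cube q \<delta>\<close>, where \<open>\<psi>\<close> is at least
    \<open>b\<close>.\<close>
  define Q where "Q = U' \<inter> {x. \<forall>i\<in>UNIV - {j}. \<bar>x $ i - p $ i\<bar> < \<delta> / 2}"
  have "open Q"
  proof -
    have eq: "{x. \<forall>i\<in>UNIV - {j}. \<bar>x $ i - p $ i\<bar> < \<delta> / 2} = (\<Inter>i\<in>UNIV - {j}. (\<lambda>x. \<bar>x $ i - p $ i\<bar>) -` {..< \<delta> / 2})"
      by auto
    moreover have "open ((\<lambda>x::real^'n. \<bar>x $ i - p $ i\<bar>) -` {..< \<delta> / 2})" for i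
      by (intro open_vimage continuous_intros)
    ultimately show ?thesis unfolding Q_def eq by (intro open_Int U'(1) open_INT) auto
  qed
  moreover have "p \<in> Q" using U'(3) \<delta> by (simp add: Q_def)
  moreover have "hausdorff_outer_measure (CARD('n) - 1) A \<le> emeasure \<mu> A"
    if A: "A \<in> sets borel" "A \<subseteq> {x \<in> Q. g x = 0}" for A
  proof -
    interpret lipschitz_graph j q \<delta> L chart A
    proof
      show "q $ j = 0" by (simp add: q_def proj_nth)
      show "dist (chart y) (chart y') \<le> L * dist y y'" if "y \<in> cube q \<delta>" "y' \<in> cube q \<delta>" for y y'
        using L(2) that sub(1) by blast
      show "(\<chi> i. if i = j then t else x $ i) \<in> cube q \<delta> \<and> chart (\<chi> i. if i = j then t else x $ i) = x"
        if x: "x \<in> A" and t: "\<bar>t\<bar> \<le> \<delta> / 2" for x t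
      proof -
        have x': "x \<in> U'" "g x = 0" "\<And>i. i \<noteq> j \<Longrightarrow> \<bar>x $ i - p $ i\<bar> < \<delta> / 2"
          using x A(2) by (auto simp: Q_def)
        have "proj (\<chi> i. if i = j then t else x $ i) = proj x" by (simp add: vec_eq_iff proj_nth)
        then have "chart (\<chi> i. if i = j then t else x $ i) = x"
          using chart_inverse[OF x'(1,2)] by (simp add: chart_def)
        moreover have "(\<chi> i. if i = j then t else x $ i) \<in> cube q \<delta>"
          using x'(3) t by (auto simp: cube_def q_def proj_nth less_imp_le)
        ultimately show ?thesis by blast
      qed
    qed (use n2 \<delta> L in auto)
    define Z where "Z = {y \<in> cube q \<delta>. chart y \<in> A}"
    have Z: "Z = cube q \<delta> \<inter> \<Phi> -` A" using sub(1) by (auto simp: Z_def \<Phi>_def indicator_def)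
    have "\<Phi> -` A \<inter> space borel \<in> sets borel" by (rule measurable_sets[OF \<Phi> A(1)])
    then have \<Phi>A: "\<Phi> -` A \<in> sets borel" by simp
    have Zb: "Z \<in> sets borel" unfolding Z by (intro sets.Int borel_compact compact_cube \<Phi>A)
    have le: "ennreal \<delta> * hausdorff_outer_measure (CARD('n) - 1) A \<le> ennreal k * emeasure lborel Z"
      using hausdorff_le_lborel[folded Z_def, OF Zb] by (simp add: C0_def k_def)
    have "hausdorff_outer_measure (CARD('n) - 1) A = ennreal (1 / \<delta>) * (ennreal \<delta> * hausdorff_outer_measure (CARD('n) - 1) A)"
      using \<delta> by (simp add: mult.assoc[symmetric] ennreal_mult[symmetric])
    also have "\<dots> \<le> ennreal (1 / \<delta>) * (ennreal k * emeasure lborel Z)"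
      by (intro mult_left_mono le) auto
    also have "\<dots> = ennreal (c1 * b) * emeasure lborel Z"
      using \<delta> k b by (simp add: mult.assoc[symmetric] ennreal_mult[symmetric] c1_def)
    also have "\<dots> = (\<integral>\<^sup>+y. ennreal (c1 * b) * indicator Z y \<partial>lborel)"
      using Zb by (simp add: nn_integral_cmult_indicator)
    also have "\<dots> \<le> (\<integral>\<^sup>+y. ennreal (c1 * \<psi> y) * indicator (\<Phi> -` A) y \<partial>lborel)"
    proof (rule nn_integral_mono)
      fix y
      show "ennreal (c1 * b) * indicator Z y \<le> ennreal (c1 * \<psi> y) * indicator (\<Phi> -` A) y"
      proof (cases "y \<in> Z")
        case True
        then have "y \<in> cube q \<delta>" "y \<in> \<Phi> -` A" unfolding Z by auto
        then show ?thesis using True \<psi>b c1 by (auto intro!: ennreal_leI mult_left_mono)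
      qed simp
    qed
    also have "\<dots> = emeasure \<mu> A"
      using A(1) \<Phi>A by (simp add: \<mu>_def emeasure_distr emeasure_density)
    finally show ?thesis .
  qed
  moreover have "(norm (\<integral>\<xi>. exp (- 2 * of_real pi * \<i> * of_real (x \<bullet> \<xi>)) \<partial>\<mu>))\<^sup>2 \<le> (c1\<^sup>2 * C) * (1 / (1 + norm x)) ^ (CARD('n) - 1)" for x
    unfolding ft norm_mult power_mult_distrib using mult_left_mono[OF C(2)[of x], of "c1\<^sup>2"] by (simp add: mult.assoc)
  moreover have "0 \<le> c1\<^sup>2 * C" using C(1) by simp
  ultimately show ?thesis using fin sets\<mu> by blast
qed

end

section \<open>From local to global by compactness\<close>

text \<open>The bound is on the square so that the exponent is a natural number; the root is taken
  in \<open>decaying_measure_kernel\<close>.\<close>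

definition decaying_measure :: "real \<Rightarrow> (real^'n) measure \<Rightarrow> bool" where
  "decaying_measure C \<mu> \<longleftrightarrow> finite_measure \<mu> \<and> sets \<mu> = sets borel \<and>
    (\<forall>x. (norm (\<integral>\<xi>. exp (- 2 * of_real pi * \<i> * of_real (x \<bullet> \<xi>)) \<partial>\<mu>))\<^sup>2 \<le> C * (1 / (1 + norm x)) ^ (CARD('n) - 1))"

text \<open>Near \<open>p\<close> the set \<open>S\<close>, with or without boundary there, is
  contained in the level set of \<open>g\<close>, so the domination on the level set restricts to
  \<open>S\<close>.\<close>

lemma hypersurface_local_measure:
  fixes S :: "(real^'n) set"
  assumes n2: "2 \<le> CARD('n)" and S: "smooth_hypersurface S" "nowhere_vanishing_gaussian_curvature S" and p: "p \<in> S"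
  shows "\<exists>Q \<mu> C. open Q \<and> p \<in> Q \<and> 0 \<le> C \<and> decaying_measure C \<mu> \<and>
    (\<forall>A\<in>sets borel. A \<subseteq> S \<inter> Q \<longrightarrow> hausdorff_outer_measure (CARD('n) - 1) A \<le> emeasure \<mu> A)"
proof -
  obtain g h where gh: "local_defining_functions S p g h" using S(1) p by (auto simp: smooth_hypersurface_def)
  then have curv: "gaussian_curvature g p \<noteq> 0" using S(2) p by (auto simp: nowhere_vanishing_gaussian_curvature_def)
  obtain U where U: "open U" "p \<in> U" "smooth_on U g" "S \<inter> U = {x \<in> U. g x = 0 \<and> 0 \<le> h x}" and gr: "grad g p \<noteq> 0"
    using gh unfolding local_defining_functions_def by blast
  obtain j where j: "partial j g p \<noteq> 0" using gr by (auto simp: vec_eq_iff grad_nth)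
  define U1 where "U1 = U \<inter> partial j g -` (- {0})"
  have U1: "open U1" unfolding U1_def
    by (intro continuous_open_preimage smooth_onD(2)[OF smooth_on_partial[OF U(3)]] U) auto
  note U0 = U
  interpret regular_level U1 g p j
  proof
    show "smooth_on U1 g" by (rule smooth_on_subset[OF U(3)]) (auto simp: U1_def)
    show "g p = 0" using U p by blast
  qed (use U1 U j in \<open>auto simp: U1_def\<close>)
  obtain U' V \<Gamma> where UV: "open U'" "U' \<subseteq> U1" "p \<in> U'" "open V" "proj p \<in> V" "homeomorphism U' V straighten \<Gamma>"
    "\<And>z. z \<in> V \<Longrightarrow> \<Gamma> differentiable (at z)"
    using local_inverse by blast
  interpret level_chart U1 g p j U' V \<Gamma>
    by unfold_locales (use UV in auto)
  obtain Q \<mu> C where Q: "open Q" "p \<in> Q" "finite_measure \<mu>" "sets \<mu> = sets borel" "0 \<le> C"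
    "\<forall>x. (norm (\<integral>\<xi>. exp (- 2 * of_real pi * \<i> * of_real (x \<bullet> \<xi>)) \<partial>\<mu>))\<^sup>2 \<le> C * (1 / (1 + norm x)) ^ (CARD('n) - 1)"
    and H: "\<forall>A\<in>sets borel. A \<subseteq> {x \<in> Q. g x = 0} \<longrightarrow> hausdorff_outer_measure (CARD('n) - 1) A \<le> emeasure \<mu> A"
    using local_measure[OF n2 curv] by blast
  have "S \<inter> (Q \<inter> U) \<subseteq> {x \<in> Q. g x = 0}" using U0(4) by blast
  then have "\<forall>A\<in>sets borel. A \<subseteq> S \<inter> (Q \<inter> U) \<longrightarrow> hausdorff_outer_measure (CARD('n) - 1) A \<le> emeasure \<mu> A"
    using H by (meson order_trans)
  moreover have "decaying_measure C \<mu>" unfolding decaying_measure_def using Q(3,4,6) by blast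
  moreover have "open (Q \<inter> U)" using Q(1) U0(1) by (rule open_Int)
  ultimately show ?thesis using Q(2,5) U0(2) by blast
qed

text \<open>A finite subcover of \<open>S\<close> by the sets \<open>Q p\<close> splits the integral
  into pieces, each at most the integral against its own \<open>\<mu> p\<close>. The form with
  nonnegative integrands is the one applied to the squared Fourier transform.\<close>

lemma nn_integral_surface_le:
  fixes S :: "(real^'n) set"
  assumes n2: "2 \<le> CARD('n)" and S: "compact S" "smooth_hypersurface S" "nowhere_vanishing_gaussian_curvature S"
  shows "\<exists>T \<mu> C. finite T \<and> 0 \<le> C \<and> (\<forall>p\<in>T. decaying_measure C (\<mu> p)) \<and>
    (\<forall>F\<in>borel_measurable borel. (\<integral>\<^sup>+\<xi>. F \<xi> \<partial>surface_measure S) \<le> (\<Sum>p\<in>(T :: (real^'n) set). \<integral>\<^sup>+\<xi>. F \<xi> \<partial>\<mu> p))"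
proof -
  define d where "d = CARD('n) - 1"
  define R where "R = (\<lambda>p Q \<mu> C. open Q \<and> p \<in> Q \<and> 0 \<le> C \<and> decaying_measure C \<mu> \<and>
    (\<forall>A\<in>sets borel. A \<subseteq> S \<inter> Q \<longrightarrow> hausdorff_outer_measure d A \<le> emeasure \<mu> A))"
  have "\<forall>p\<in>S. \<exists>Q \<mu> C. R p Q \<mu> C"
    unfolding R_def d_def using hypersurface_local_measure[OF n2 S(2,3)] by blast
  then obtain Q \<mu> C where "\<forall>p\<in>S. R p (Q p) (\<mu> p) (C p)" by metis
  then have R: "\<And>p. p \<in> S \<Longrightarrow> open (Q p)" "\<And>p. p \<in> S \<Longrightarrow> p \<in> Q p" "\<And>p. p \<in> S \<Longrightarrow> 0 \<le> C p"
    "\<And>p. p \<in> S \<Longrightarrow> decaying_measure (C p) (\<mu> p)"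
    "\<And>p A. p \<in> S \<Longrightarrow> A \<in> sets borel \<Longrightarrow> A \<subseteq> S \<inter> Q p \<Longrightarrow> hausdorff_outer_measure d A \<le> emeasure (\<mu> p) A"
    by (auto simp: R_def)
  obtain T where T: "T \<subseteq> S" "finite T" "S \<subseteq> (\<Union>p\<in>T. Q p)"
    using compactE_image[OF S(1), of S Q] R by (metis UN_I subsetI)
  have Sb: "S \<in> sets borel" by (rule borel_compact[OF S(1)])
  \<comment> \<open>A sum instead of a maximum gives one constant for all \<open>p\<close> in
    \<open>T\<close> and is also right for empty \<open>T\<close>.\<close>
  define C0 where "C0 = (\<Sum>p\<in>T. C p)"
  have C0: "C p \<le> C0" if "p \<in> T" for p
    unfolding C0_def using that T R(3) by (intro member_le_sum) auto
  have dec: "decaying_measure C0 (\<mu> p)" if "p \<in> T" for p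
  proof -
    have "C p * (1 / (1 + norm x)) ^ (CARD('n) - 1) \<le> C0 * (1 / (1 + norm x)) ^ (CARD('n) - 1)" for x :: "real^'n"
      by (intro mult_right_mono C0 that) auto
    then show ?thesis using R(4)[of p] that T(1) unfolding decaying_measure_def by (meson order_trans subsetD)
  qed
  have main: "(\<integral>\<^sup>+\<xi>. F \<xi> \<partial>surface_measure S) \<le> (\<Sum>p\<in>T. \<integral>\<^sup>+\<xi>. F \<xi> \<partial>\<mu> p)"
    if F[measurable]: "F \<in> borel_measurable borel" for F
  proof -
    let ?H = "hausdorff_measure d :: (real^'n) measure"
    have HF: "F \<in> borel_measurable ?H" using F by (simp cong: measurable_cong_sets)
    have meas: "S \<inter> Q p \<in> sets ?H" if "p \<in> T" for p
      using Sb R(1)[of p] that T(1) by auto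
    have "(\<integral>\<^sup>+\<xi>. F \<xi> \<partial>surface_measure S) = (\<integral>\<^sup>+\<xi>. F \<xi> * indicator S \<xi> \<partial>?H)"
      unfolding surface_measure_def d_def by (rule nn_integral_restrict_space) (use Sb in simp)
    also have "\<dots> \<le> (\<integral>\<^sup>+\<xi>. (\<Sum>p\<in>T. F \<xi> * indicator (S \<inter> Q p) \<xi>) \<partial>?H)"
    proof (rule nn_integral_mono)
      fix \<xi>
      show "F \<xi> * indicator S \<xi> \<le> (\<Sum>p\<in>T. F \<xi> * indicator (S \<inter> Q p) \<xi>)"
      proof (cases "\<xi> \<in> S")
        case True
        then obtain p where p: "p \<in> T" "\<xi> \<in> Q p" using T(3) by blast
        have "F \<xi> * indicator S \<xi> = F \<xi> * indicator (S \<inter> Q p) \<xi>" using p True by simp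
        also have "\<dots> \<le> (\<Sum>p\<in>T. F \<xi> * indicator (S \<inter> Q p) \<xi>)"
          by (rule member_le_sum) (use p T in auto)
        finally show ?thesis .
      qed simp
    qed
    also have "\<dots> = (\<Sum>p\<in>T. \<integral>\<^sup>+\<xi>. F \<xi> * indicator (S \<inter> Q p) \<xi> \<partial>?H)"
      by (rule nn_integral_sum) (use HF meas in auto)
    also have "\<dots> \<le> (\<Sum>p\<in>T. \<integral>\<^sup>+\<xi>. F \<xi> \<partial>\<mu> p)"
    proof (rule sum_mono)
      fix p assume p: "p \<in> T"
      then have pS: "p \<in> S" using T(1) by blast
      have s\<mu>: "sets (\<mu> p) = sets borel" using dec[OF p] by (simp add: decaying_measure_def)
      let ?D = "density ?H (indicator (S \<inter> Q p))"
      have "?D \<le> \<mu> p"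
      proof (subst le_measure)
        show "sets ?D = sets (\<mu> p)" by (simp add: s\<mu>)
        show "\<forall>A\<in>sets ?D. emeasure ?D A \<le> emeasure (\<mu> p) A"
        proof
          fix A assume "A \<in> sets ?D"
          then have A: "A \<in> sets borel" by simp
          have AB: "S \<inter> Q p \<inter> A \<in> sets borel" using meas[OF p] A by simp
          have "emeasure ?D A = emeasure ?H (S \<inter> Q p \<inter> A)"
            using A meas[OF p] by (subst emeasure_density) (auto simp: indicator_inter_arith[symmetric] simp flip: nn_integral_indicator)
          also have "\<dots> = hausdorff_outer_measure d (S \<inter> Q p \<inter> A)"
            by (rule emeasure_hausdorff_measure[OF AB])
          also have "\<dots> \<le> emeasure (\<mu> p) (S \<inter> Q p \<inter> A)" by (rule R(5)[OF pS AB]) auto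
          also have "\<dots> \<le> emeasure (\<mu> p) A" using A s\<mu> by (intro emeasure_mono) auto
          finally show "emeasure ?D A \<le> emeasure (\<mu> p) A" .
        qed
      qed
      then have "(\<integral>\<^sup>+\<xi>. F \<xi> \<partial>?D) \<le> (\<integral>\<^sup>+\<xi>. F \<xi> \<partial>\<mu> p)"
        by (intro nn_integral_mono_measure) (simp_all add: s\<mu>)
      moreover have "(\<integral>\<^sup>+\<xi>. F \<xi> \<partial>?D) = (\<integral>\<^sup>+\<xi>. F \<xi> * indicator (S \<inter> Q p) \<xi> \<partial>?H)"
        using HF meas[OF p] by (subst nn_integral_density) (auto simp: mult.commute)
      ultimately show "(\<integral>\<^sup>+\<xi>. F \<xi> * indicator (S \<inter> Q p) \<xi> \<partial>?H) \<le> (\<integral>\<^sup>+\<xi>. F \<xi> \<partial>\<mu> p)" by simp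
    qed
    finally show ?thesis .
  qed
  have "0 \<le> C0" unfolding C0_def using R(3) T(1) by (intro sum_nonneg) auto
  with dec main T(2) show ?thesis by (intro exI[of _ T] exI[of _ \<mu>] exI[of _ C0]) auto
qed

section \<open>Unions of lattice cubes\<close>

lemma finite_lattice_cubes:
  assumes "\<B> \<subseteq> lattice_unit_cubes" "\<Union>\<B> \<subseteq> cube 0 R"
  shows "finite (\<B> :: (real^'n) set set)"
proof -
  define I where "I = {k :: real. k \<in> \<int> \<and> \<bar>k\<bar> \<le> R / 2}"
  have "finite I" unfolding I_def by (rule finite_abs_int_segment)
  then have fin: "finite ((UNIV :: 'n set) \<rightarrow>\<^sub>E I)" by (intro finite_PiE) auto
  have "\<B> \<subseteq> (\<lambda>f. cbox (\<chi> i. f i) (\<chi> i. f i + 1)) ` (UNIV \<rightarrow>\<^sub>E I)"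
  proof
    fix B assume B: "B \<in> \<B>"
    then obtain m :: "real^'n" where m: "B = cbox m (\<chi> i. m $ i + 1)" "\<forall>i. m $ i \<in> \<int>"
      using assms(1) by (auto simp: lattice_unit_cubes_def)
    have "m \<in> B" by (simp add: m(1) mem_box_cart)
    then have "m \<in> cube 0 R" using assms(2) B by blast
    then have "m $ i \<in> I" for i using m(2) by (simp add: I_def cube_def)
    then show "B \<in> (\<lambda>f. cbox (\<chi> i. f i) (\<chi> i. f i + 1)) ` (UNIV \<rightarrow>\<^sub>E I)"
      by (intro image_eqI[of _ _ "\<lambda>i. m $ i"]) (auto simp: m(1))
  qed
  then show ?thesis using fin by (meson finite_imageI finite_subset)
qed

lemma card_le_cube_density:
  fixes \<B> :: "(real^'n) set set"
  assumes \<B>: "\<B> \<subseteq> lattice_unit_cubes" "\<Union>\<B> \<subseteq> cube 0 R" and "0 < \<alpha>" "1 \<le> r" "cube x r \<subseteq> cube 0 R"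
  shows "real (card {B \<in> \<B>. B \<subseteq> cube x r}) \<le> cube_density \<B> \<alpha> R * r powr \<alpha>"
proof -
  have fin: "finite \<B>" by (rule finite_lattice_cubes[OF \<B>])
  let ?A = "{(x :: real^'n, r). 1 \<le> r \<and> cube x r \<subseteq> cube 0 R}"
  let ?f = "\<lambda>(x, r). real (card {B \<in> \<B>. B \<subseteq> cube x r}) / r powr \<alpha>"
  \<comment> \<open>The real supremum in \<open>cube_density\<close> is meaningful only for a
    bounded family; since \<open>r powr \<alpha>\<close> is at least 1, the number of cubes in
    \<open>\<B>\<close> bounds it.\<close>
  have "bdd_above (?f ` ?A)"
  proof (rule bdd_aboveI2)
    fix p assume "p \<in> ?A"
    then obtain x r where p: "p = (x, r)" "1 \<le> r" by auto
    have "1 \<le> r powr \<alpha>" using p(2) assms(3) by (simp add: ge_one_powr_ge_zero)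
    then have "real (card {B \<in> \<B>. B \<subseteq> cube x r}) / r powr \<alpha> \<le> real (card {B \<in> \<B>. B \<subseteq> cube x r}) / 1"
      by (intro divide_left_mono) auto
    also have "\<dots> \<le> real (card \<B>)" using fin by (auto intro: card_mono)
    finally show "?f p \<le> real (card \<B>)" by (simp add: p)
  qed
  then have "?f (x, r) \<le> cube_density \<B> \<alpha> R"
    unfolding cube_density_def by (rule cSUP_upper[rotated]) (use assms in simp)
  then show ?thesis using assms(4) by (simp add: pos_divide_le_eq)
qed

lemma cube_density_nonneg:
  assumes "\<B> \<subseteq> lattice_unit_cubes" "\<Union>\<B> \<subseteq> cube 0 R" "0 < \<alpha>" "1 \<le> R"
  shows "0 \<le> cube_density \<B> \<alpha> R"
  using card_le_cube_density[OF assms(1-3), of 1 0] cube_mono[OF assms(4)]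
  by (smt (verit) of_nat_0_le_iff powr_one_eq_one mult_cancel_left1 mult.right_neutral)

text \<open>One coordinate of the inward move in \<open>card_le_cube_density_centred\<close>: the
  centre \<open>t\<close> is clamped to \<open>[- a, a]\<close>.\<close>

lemma clamp_interval:
  fixes t u a s :: real
  assumes "\<bar>u - t\<bar> \<le> s" "\<bar>u\<bar> \<le> a + s" "\<bar>t\<bar> \<le> a + s" "0 \<le> a"
  shows "\<bar>u - max (- a) (min a t)\<bar> \<le> s"
  using assms unfolding max_def min_def by (smt (verit))

text \<open>The density only controls cubes inside \<open>cube 0 R\<close>; a cube centred in \<open>cube 0 R\<close> that sticks
  out is moved inwards without losing any of its intersection with \<open>cube 0 R\<close>.\<close>
lemma card_le_cube_density_centred:
  fixes \<B> :: "(real^'n) set set"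
  assumes \<B>: "\<B> \<subseteq> lattice_unit_cubes" "\<Union>\<B> \<subseteq> cube 0 R" and \<alpha>: "0 < \<alpha>" and R: "1 \<le> R" and r: "1 \<le> r"
    and x: "x \<in> cube 0 R"
  shows "real (card {B \<in> \<B>. B \<subseteq> cube x r}) \<le> cube_density \<B> \<alpha> R * r powr \<alpha>"
proof -
  have fin: "finite \<B>" by (rule finite_lattice_cubes[OF \<B>])
  define r' where "r' = min r R"
  have r': "1 \<le> r'" "r' \<le> r" "r' \<le> R" using r R by (auto simp: r'_def)
  \<comment> \<open>A cube of side \<open>r'\<close> lies in \<open>cube 0 R\<close> as soon as the
    coordinates of its centre are at most \<open>a\<close> in absolute value.\<close>
  define a where "a = (R - r') / 2"
  have a: "0 \<le> a" using r'(3) by (simp add: a_def)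
  define x' where "x' = (\<chi> i. max (- a) (min a (x $ i)))"
  have xi: "\<bar>x $ i\<bar> \<le> R / 2" for i using x by (simp add: cube_def)
  have x'r': "cube x' r' \<subseteq> cube 0 R"
  proof
    fix y assume y: "y \<in> cube x' r'"
    have "\<bar>y $ i\<bar> \<le> R / 2" for i
    proof -
      have "\<bar>y $ i - x' $ i\<bar> \<le> r' / 2" using y by (simp add: cube_def)
      moreover have "\<bar>x' $ i\<bar> \<le> a" using a by (simp add: x'_def max_def min_def abs_le_iff)
      ultimately have "\<bar>y $ i\<bar> \<le> r' / 2 + a" by linarith
      also have "\<dots> = R / 2" by (simp add: a_def field_simps)
      finally show ?thesis .
    qed
    then show "y \<in> cube 0 R" by (simp add: cube_def)
  qed
  have "cube x r \<inter> cube 0 R \<subseteq> cube x' r'"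
  proof
    fix y assume y: "y \<in> cube x r \<inter> cube 0 R"
    have "\<bar>y $ i - x' $ i\<bar> \<le> r' / 2" for i
    proof -
      have y1: "\<bar>y $ i - x $ i\<bar> \<le> r / 2" "\<bar>y $ i\<bar> \<le> R / 2" using y by (auto simp: cube_def)
      have x'i: "x' $ i = max (- a) (min a (x $ i))" by (simp add: x'_def)
      show ?thesis
      proof (cases "r \<le> R")
        case True
        then have "r' = r" by (simp add: r'_def)
        then have "R / 2 = a + r' / 2" by (simp add: a_def field_simps)
        with y1 xi[of i] a \<open>r' = r\<close> show ?thesis unfolding x'i by (intro clamp_interval) auto
      next
        case False
        then have "r' = R" by (simp add: r'_def)
        with y1 show ?thesis unfolding x'i a_def max_def min_def by (auto simp: abs_le_iff)
      qed
    qed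
    then show "y \<in> cube x' r'" by (simp add: cube_def)
  qed
  then have "{B \<in> \<B>. B \<subseteq> cube x r} \<subseteq> {B \<in> \<B>. B \<subseteq> cube x' r'}" using \<B>(2) by blast
  then have "real (card {B \<in> \<B>. B \<subseteq> cube x r}) \<le> real (card {B \<in> \<B>. B \<subseteq> cube x' r'})"
    using fin by (auto intro: card_mono)
  also have "\<dots> \<le> cube_density \<B> \<alpha> R * r' powr \<alpha>"
    by (rule card_le_cube_density[OF \<B> \<alpha> r'(1) x'r'])
  also have "\<dots> \<le> cube_density \<B> \<alpha> R * r powr \<alpha>"
    using r' \<alpha> by (intro mult_left_mono powr_mono2 cube_density_nonneg[OF \<B> \<alpha> R]) auto
  finally show ?thesis .
qed

lemma lattice_cube_facts:
  fixes B :: "(real^'n) set"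
  assumes "B \<in> lattice_unit_cubes"
  shows "B \<in> sets borel" "emeasure lborel B = 1" "y \<in> B \<Longrightarrow> y' \<in> B \<Longrightarrow> \<bar>y $ i - y' $ i\<bar> \<le> 1"
proof -
  obtain m :: "real^'n" where m: "B = cbox m (\<chi> i. m $ i + 1)"
    using assms by (auto simp: lattice_unit_cubes_def)
  show "B \<in> sets borel" by (simp add: m)
  have 1: "((\<chi> i. m $ i + 1) - m) \<bullet> b = 1" if "b \<in> Basis" for b
    using that by (auto simp: Basis_vec_def inner_axis)
  have "m \<bullet> b \<le> (\<chi> i. m $ i + 1) \<bullet> b" if "b \<in> Basis" for b
    using that by (auto simp: Basis_vec_def inner_axis)
  then show "emeasure lborel B = 1" unfolding m by (simp add: emeasure_lborel_cbox 1)
  show "\<bar>y $ i - y' $ i\<bar> \<le> 1" if "y \<in> B" "y' \<in> B"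
  proof -
    have "m $ i \<le> y $ i \<and> y $ i \<le> m $ i + 1" "m $ i \<le> y' $ i \<and> y' $ i \<le> m $ i + 1"
      using that by (simp_all add: m mem_box_cart)
    then show ?thesis by linarith
  qed
qed

section \<open>The integral of the kernel over the cubes\<close>

text \<open>A lattice cube has level \<open>k\<close> if \<open>cube x (2 ^ Suc k)\<close> is the
  first of the dyadic sequence to contain it. On it the kernel is at most of order
  \<open>2 powr (- \<beta> * k)\<close>, and the density allows of order
  \<open>\<gamma> * 2 powr (\<alpha> * k)\<close> such cubes. The product is largest at the top
  level if \<open>\<alpha> > \<beta>\<close> and at level 0 otherwise, whence the
  \<open>max 0\<close>; the logarithm counts the levels.\<close>

lemma kernel_integral_bound:
  fixes \<B> :: "(real^'n) set set"
  assumes \<B>: "\<B> \<subseteq> lattice_unit_cubes" "\<Union>\<B> \<subseteq> cube 0 R" and \<alpha>: "0 < \<alpha>" and R: "1 \<le> R" and \<beta>: "0 \<le> \<beta>"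
    and x: "x \<in> cube 0 R"
  shows "(\<integral>\<^sup>+y. ennreal ((1 + norm (x - y)) powr - \<beta>) * indicator (\<Union>\<B>) y \<partial>lborel)
    \<le> ennreal (2 powr (\<alpha> + \<beta>) * cube_density \<B> \<alpha> R * (log 2 R + 2) * (2 * R) powr max 0 (\<alpha> - \<beta>))"
proof -
  have fin: "finite \<B>" by (rule finite_lattice_cubes[OF \<B>])
  define \<gamma> where "\<gamma> = cube_density \<B> \<alpha> R"
  have \<gamma>: "0 \<le> \<gamma>" unfolding \<gamma>_def by (rule cube_density_nonneg[OF \<B> \<alpha> R])
  \<comment> \<open>The top level: \<open>R \<le> 2 ^ k0 \<le> 2 * R\<close>, which gives the
    \<open>2 * R\<close> of the bound and at most \<open>log 2 R + 2\<close> levels.\<close>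
  define k0 where "k0 = nat \<lceil>log 2 R\<rceil>"
  have logR: "0 \<le> log 2 R" using R by simp
  have k0: "log 2 R \<le> real k0" "real k0 \<le> log 2 R + 1"
    using logR by (auto simp: k0_def)
  have "R = 2 powr log 2 R" using R by simp
  also have "\<dots> \<le> 2 powr real k0" using k0 by (intro powr_mono) auto
  finally have Rk0: "R \<le> 2 ^ k0" by (simp add: powr_realpow)
  have "2 powr real k0 \<le> 2 powr (log 2 R + 1)" using k0 by (intro powr_mono) auto
  also have "\<dots> = 2 * R" using R by (simp add: powr_add)
  finally have k0R: "2 ^ k0 \<le> 2 * R" by (simp add: powr_realpow)
  have all: "B \<subseteq> cube x (2 ^ Suc k0)" if "B \<in> \<B>" for B
  proof
    fix y assume "y \<in> B"
    then have "y \<in> cube 0 R" using that \<B>(2) by blast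
    then have "\<bar>y $ i - x $ i\<bar> \<le> 2 ^ Suc k0 / 2" for i
    proof -
      have "\<bar>y $ i\<bar> \<le> R / 2" "\<bar>x $ i\<bar> \<le> R / 2" using \<open>y \<in> cube 0 R\<close> x by (auto simp: cube_def)
      with Rk0 show ?thesis by simp
    qed
    then show "y \<in> cube x (2 ^ Suc k0)" by (simp add: cube_def)
  qed
  define lev where "lev = (\<lambda>B. LEAST k. B \<subseteq> cube x (2 ^ Suc k))"
  have lev1: "B \<subseteq> cube x (2 ^ Suc (lev B))" if "B \<in> \<B>" for B
    unfolding lev_def by (rule LeastI[of _ k0]) (rule all[OF that])
  have lev2: "lev B \<le> k0" if "B \<in> \<B>" for B
    unfolding lev_def by (rule Least_le) (rule all[OF that])
  \<comment> \<open>As the cube is not contained in the preceding dyadic cube, one of its points is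
    far from \<open>x\<close> in some coordinate; \<open>y\<close> is within 1 of that point in this
    coordinate, and the summand 1 of the kernel absorbs the difference.\<close>
  have far: "2 ^ lev B / 2 \<le> 1 + norm (x - y)" if B: "B \<in> \<B>" and y: "y \<in> B" for B y
  proof (cases "lev B")
    case 0
    then show ?thesis using norm_ge_zero[of "x - y"] by simp
  next
    case (Suc k)
    have "\<not> B \<subseteq> cube x (2 ^ Suc k)"
      using not_less_Least[of k "\<lambda>k. B \<subseteq> cube x (2 ^ Suc k)"] Suc unfolding lev_def by simp
    then obtain y0 where "y0 \<in> B" "y0 \<notin> cube x (2 ^ Suc k)" by blast
    then obtain i where y0: "y0 \<in> B" "2 ^ Suc k / 2 < \<bar>y0 $ i - x $ i\<bar>"
      unfolding cube_def mem_Collect_eq not_all not_le by blast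
    have "\<bar>y0 $ i - y $ i\<bar> \<le> 1" using lattice_cube_facts(3)[of B y0 y] B \<B>(1) y0 y by blast
    then have "2 ^ Suc k / 2 \<le> 1 + \<bar>(x - y) $ i\<bar>" using y0(2) by simp
    also have "\<dots> \<le> 1 + norm (x - y)" using component_le_norm_cart[of "x - y" i] by simp
    finally show ?thesis by (simp add: Suc)
  qed
  have Bb: "B \<in> sets lborel" and B1: "emeasure lborel B = 1" if "B \<in> \<B>" for B
    using lattice_cube_facts(1,2)[of B] \<B>(1) that by auto
  define w where "w = (\<lambda>k::nat. 2 powr \<beta> * 2 powr (- \<beta> * real k))"
  have w: "0 \<le> w k" for k by (simp add: w_def)
  have pt: "(1 + norm (x - y)) powr - \<beta> \<le> w (lev B)" if "B \<in> \<B>" "y \<in> B" for B y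
  proof -
    have "(1 + norm (x - y)) powr - \<beta> \<le> (2 ^ lev B / 2) powr - \<beta>"
      using far[OF that] \<beta> by (intro powr_mono2') auto
    also have "\<dots> = (2 powr (real (lev B) - 1)) powr - \<beta>"
      by (simp add: powr_diff powr_realpow)
    also have "\<dots> = 2 powr (\<beta> + - \<beta> * real (lev B))"
      by (simp add: powr_powr algebra_simps)
    finally show ?thesis by (simp only: powr_add w_def)
  qed
  have "(\<integral>\<^sup>+y. ennreal ((1 + norm (x - y)) powr - \<beta>) * indicator (\<Union>\<B>) y \<partial>lborel)
     \<le> (\<integral>\<^sup>+y. (\<Sum>B\<in>\<B>. ennreal (w (lev B)) * indicator B y) \<partial>lborel)"
  proof (rule nn_integral_mono)
    fix y
    show "ennreal ((1 + norm (x - y)) powr - \<beta>) * indicator (\<Union>\<B>) y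
      \<le> (\<Sum>B\<in>\<B>. ennreal (w (lev B)) * indicator B y)"
    proof (cases "y \<in> \<Union>\<B>")
      case True
      then obtain B where B: "B \<in> \<B>" "y \<in> B" by blast
      have "ennreal ((1 + norm (x - y)) powr - \<beta>) * indicator (\<Union>\<B>) y \<le> ennreal (w (lev B)) * indicator B y"
        using True B pt[OF B] by (simp add: ennreal_leI)
      also have "\<dots> \<le> (\<Sum>B\<in>\<B>. ennreal (w (lev B)) * indicator B y)"
        by (rule member_le_sum) (use B fin in auto)
      finally show ?thesis .
    qed simp
  qed
  also have "\<dots> = (\<Sum>B\<in>\<B>. \<integral>\<^sup>+y. ennreal (w (lev B)) * indicator B y \<partial>lborel)"
    by (rule nn_integral_sum) (intro borel_measurable_times_ennreal borel_measurable_const borel_measurable_indicator Bb)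
  also have "\<dots> = (\<Sum>B\<in>\<B>. ennreal (w (lev B)))"
  proof (rule sum.cong[OF refl])
    fix B assume "B \<in> \<B>"
    then show "(\<integral>\<^sup>+y. ennreal (w (lev B)) * indicator B y \<partial>lborel)
        = ennreal (w (lev B))"
      by (subst nn_integral_cmult_indicator[OF Bb]) (simp_all add: B1)
  qed
  also have "\<dots> = ennreal (\<Sum>B\<in>\<B>. w (lev B))"
    by (rule sum_ennreal) (simp add: w_def)
  also have "\<dots> \<le> ennreal (2 powr (\<alpha> + \<beta>) * \<gamma> * (log 2 R + 2) * (2 * R) powr max 0 (\<alpha> - \<beta>))"
  proof (rule ennreal_leI)
    \<comment> \<open>Each cube is now counted at every level whose dyadic cube contains it, not
      only at its own; the counts become those that the density bounds.\<close>
    have "(\<Sum>B\<in>\<B>. w (lev B))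
       \<le> (\<Sum>B\<in>\<B>. \<Sum>k\<le>k0. if B \<subseteq> cube x (2 ^ Suc k) then w k else 0)"
    proof (rule sum_mono)
      fix B assume B: "B \<in> \<B>"
      have "w (lev B) = (if B \<subseteq> cube x (2 ^ Suc (lev B)) then w (lev B) else 0)"
        using lev1[OF B] by simp
      also have "\<dots> \<le> (\<Sum>k\<le>k0. if B \<subseteq> cube x (2 ^ Suc k) then w k else 0)"
        by (rule member_le_sum) (use lev2[OF B] w in auto)
      finally show "w (lev B) \<le> (\<Sum>k\<le>k0. if B \<subseteq> cube x (2 ^ Suc k) then w k else 0)" .
    qed
    also have "\<dots> = (\<Sum>k\<le>k0. \<Sum>B\<in>\<B>. if B \<subseteq> cube x (2 ^ Suc k) then w k else 0)"
      by (rule sum.swap)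
    also have "\<dots> = (\<Sum>k\<le>k0. real (card {B \<in> \<B>. B \<subseteq> cube x (2 ^ Suc k)}) * w k)"
      using fin by (intro sum.cong refl) (simp add: sum.inter_filter[symmetric])
    also have "\<dots> \<le> (\<Sum>k\<le>k0. 2 powr (\<alpha> + \<beta>) * \<gamma> * (2 * R) powr max 0 (\<alpha> - \<beta>))"
    proof (rule sum_mono)
      fix k assume k: "k \<in> {..k0}"
      have "real (card {B \<in> \<B>. B \<subseteq> cube x (2 ^ Suc k)}) \<le> \<gamma> * (2 ^ Suc k) powr \<alpha>"
        unfolding \<gamma>_def by (rule card_le_cube_density_centred[OF \<B> \<alpha> R _ x]) (rule one_le_power, simp)
      also have "(2 ^ Suc k) powr \<alpha> = (2 powr real (Suc k)) powr \<alpha>" by (simp only: powr_realpow zero_less_numeral)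
      also have "\<dots> = 2 powr (\<alpha> * real (Suc k))" by (simp only: powr_powr mult.commute)
      finally have "real (card {B \<in> \<B>. B \<subseteq> cube x (2 ^ Suc k)}) * w k
        \<le> \<gamma> * 2 powr (\<alpha> * real (Suc k)) * w k"
        using w by (intro mult_right_mono) auto
      also have "\<dots> = \<gamma> * 2 powr (\<alpha> * real (Suc k) + (\<beta> + - \<beta> * real k))"
        by (simp only: w_def powr_add mult.assoc)
      also have "\<alpha> * real (Suc k) + (\<beta> + - \<beta> * real k) = (\<alpha> + \<beta>) + real k * (\<alpha> - \<beta>)"
        by (simp add: algebra_simps)
      also have "2 powr ((\<alpha> + \<beta>) + real k * (\<alpha> - \<beta>)) = 2 powr (\<alpha> + \<beta>) * (2 powr real k) powr (\<alpha> - \<beta>)"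
        by (simp only: powr_add powr_powr)
      also have "\<gamma> * (2 powr (\<alpha> + \<beta>) * (2 powr real k) powr (\<alpha> - \<beta>))
        \<le> \<gamma> * (2 powr (\<alpha> + \<beta>) * (2 * R) powr max 0 (\<alpha> - \<beta>))"
      proof -
        have "(2::real) ^ k \<le> 2 ^ k0" using k by (intro power_increasing) auto
        also note k0R
        finally have k1: "(2::real) powr real k \<le> 2 * R" by (simp only: powr_realpow zero_less_numeral)
        have k2: "1 \<le> (2::real) powr real k" by (simp add: ge_one_powr_ge_zero)
        have "(2 powr real k) powr (\<alpha> - \<beta>) \<le> (2 powr real k) powr max 0 (\<alpha> - \<beta>)"
          using k2 by (intro powr_mono) auto
        also have "\<dots> \<le> (2 * R) powr max 0 (\<alpha> - \<beta>)" using k1 k2 by (intro powr_mono2) auto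
        finally show ?thesis using \<gamma> by (intro mult_left_mono) auto
      qed
      finally show "real (card {B \<in> \<B>. B \<subseteq> cube x (2 ^ Suc k)}) * w k
        \<le> 2 powr (\<alpha> + \<beta>) * \<gamma> * (2 * R) powr max 0 (\<alpha> - \<beta>)"
        by (simp only: mult_ac)
    qed
    also have "\<dots> = real (Suc k0) * (2 powr (\<alpha> + \<beta>) * \<gamma> * (2 * R) powr max 0 (\<alpha> - \<beta>))" by simp
    also have "\<dots> \<le> (log 2 R + 2) * (2 powr (\<alpha> + \<beta>) * \<gamma> * (2 * R) powr max 0 (\<alpha> - \<beta>))"
      using k0 \<gamma> by (intro mult_right_mono) auto
    also have "\<dots> = 2 powr (\<alpha> + \<beta>) * \<gamma> * (log 2 R + 2) * (2 * R) powr max 0 (\<alpha> - \<beta>)" by (simp only: mult_ac)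
    finally show "(\<Sum>B\<in>\<B>. w (lev B))
      \<le> 2 powr (\<alpha> + \<beta>) * \<gamma> * (log 2 R + 2) * (2 * R) powr max 0 (\<alpha> - \<beta>)" .
  qed
  finally show ?thesis unfolding \<gamma>_def .
qed

section \<open>Schur test and duality\<close>

definition chi :: "real \<Rightarrow> complex" where
  "chi t = exp (- 2 * of_real pi * \<i> * of_real t)"

lemma chi_measurable [measurable]: "chi \<in> borel_measurable borel"
  unfolding chi_def[abs_def] by (intro borel_measurable_continuous_onI continuous_intros)

lemma norm_chi [simp]: "norm (chi t) = 1"
proof -
  have "chi t = exp (\<i> * of_real (- 2 * pi * t))" by (simp add: chi_def mult_ac)
  then show ?thesis by (simp only: norm_exp_i_times)
qed

lemma chi_diff: "chi (s - t) = chi s * cnj (chi t)"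
  by (simp add: chi_def exp_cnj exp_add[symmetric] algebra_simps)

text \<open>A nonintegrable \<open>f\<close> has integral 0, so the bound holds for every
  \<open>f\<close>.\<close>

lemma norm_integral_le_nn_integral:
  fixes f :: "'a \<Rightarrow> complex"
  shows "ennreal (norm (\<integral>x. f x \<partial>M)) \<le> (\<integral>\<^sup>+x. ennreal (norm (f x)) \<partial>M)"
  by (cases "integrable M f") (auto simp: integral_norm_bound_ennreal not_integrable_integral_eq)

text \<open>\<open>v x * v y\<close> is at most half the sum of the squares. By the symmetry of the
  kernel the two halves have the same integral, and in it the kernel is integrated first.\<close>

lemma schur_test:
  fixes v k :: "'a::euclidean_space \<Rightarrow> real" and A :: ennreal
  assumes [measurable]: "v \<in> borel_measurable borel" "k \<in> borel_measurable borel" "X \<in> sets borel"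
    and v: "\<And>x. 0 \<le> v x" "\<And>x. x \<notin> X \<Longrightarrow> v x = 0" and k: "\<And>z. 0 \<le> k z" "\<And>z. k (- z) = k z"
    and A: "\<And>x. x \<in> X \<Longrightarrow> (\<integral>\<^sup>+y. ennreal (k (x - y)) * indicator X y \<partial>lborel) \<le> A"
  shows "(\<integral>\<^sup>+x. (\<integral>\<^sup>+y. ennreal (v x * v y * k (x - y)) \<partial>lborel) \<partial>lborel) \<le> A * (\<integral>\<^sup>+x. ennreal ((v x)\<^sup>2) \<partial>lborel)"
proof -
  define P where "P = (\<lambda>x y. ennreal ((v x)\<^sup>2 / 2) * (ennreal (k (x - y)) * indicator X y))"
  have [measurable]: "(\<lambda>p. P (fst p) (snd p)) \<in> borel_measurable (lborel \<Otimes>\<^sub>M lborel)"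
    "(\<lambda>p. P (snd p) (fst p)) \<in> borel_measurable (lborel \<Otimes>\<^sub>M lborel)"
    unfolding P_def by measurable
  have Pm[measurable]: "(\<lambda>y. P x y) \<in> borel_measurable lborel" "(\<lambda>x. P x y) \<in> borel_measurable lborel" for x y
    unfolding P_def by measurable
  have pt: "ennreal (v x * v y * k (x - y)) \<le> P x y + P y x" for x y
  proof (cases "x \<in> X \<and> y \<in> X")
    case True
    have "v x * v y \<le> (v x)\<^sup>2 / 2 + (v y)\<^sup>2 / 2"
      using sum_squares_bound[of "v x" "v y"] by simp
    from mult_right_mono[OF this k(1)[of "x - y"]]
    have "v x * v y * k (x - y) \<le> (v x)\<^sup>2 / 2 * k (x - y) + (v y)\<^sup>2 / 2 * k (y - x)"
      using k(2)[of "x - y"] by (simp add: distrib_right)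
    then have "ennreal (v x * v y * k (x - y)) \<le> ennreal ((v x)\<^sup>2 / 2 * k (x - y) + (v y)\<^sup>2 / 2 * k (y - x))"
      by (rule ennreal_leI)
    also have "\<dots> = P x y + P y x" using True k(1) by (simp add: P_def ennreal_mult[symmetric])
    finally show ?thesis .
  next
    case False
    then show ?thesis using v by auto
  qed
  have half: "(\<integral>\<^sup>+x. (\<integral>\<^sup>+y. P x y \<partial>lborel) \<partial>lborel) \<le> A * (\<integral>\<^sup>+x. ennreal ((v x)\<^sup>2 / 2) \<partial>lborel)"
  proof -
    have "(\<integral>\<^sup>+x. (\<integral>\<^sup>+y. P x y \<partial>lborel) \<partial>lborel) \<le> (\<integral>\<^sup>+x. A * ennreal ((v x)\<^sup>2 / 2) \<partial>lborel)"
    proof (rule nn_integral_mono)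
      fix x
      have "(\<integral>\<^sup>+y. P x y \<partial>lborel) = ennreal ((v x)\<^sup>2 / 2) * (\<integral>\<^sup>+y. ennreal (k (x - y)) * indicator X y \<partial>lborel)"
        unfolding P_def by (rule nn_integral_cmult) measurable
      also have "\<dots> \<le> ennreal ((v x)\<^sup>2 / 2) * A"
        using A[of x] v(2)[of x] by (cases "x \<in> X") (auto intro: mult_left_mono)
      finally show "(\<integral>\<^sup>+y. P x y \<partial>lborel) \<le> A * ennreal ((v x)\<^sup>2 / 2)" by (simp add: mult.commute)
    qed
    also have "\<dots> = A * (\<integral>\<^sup>+x. ennreal ((v x)\<^sup>2 / 2) \<partial>lborel)" by (rule nn_integral_cmult) measurable
    finally show ?thesis .
  qed
  have swap: "(\<integral>\<^sup>+x. (\<integral>\<^sup>+y. P y x \<partial>lborel) \<partial>lborel) = (\<integral>\<^sup>+x. (\<integral>\<^sup>+y. P x y \<partial>lborel) \<partial>lborel)"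
    by (rule lborel_pair.Fubini') (simp add: case_prod_unfold)
  have "(\<integral>\<^sup>+x. (\<integral>\<^sup>+y. ennreal (v x * v y * k (x - y)) \<partial>lborel) \<partial>lborel)
     \<le> (\<integral>\<^sup>+x. (\<integral>\<^sup>+y. P x y + P y x \<partial>lborel) \<partial>lborel)"
    by (intro nn_integral_mono pt)
  also have "\<dots> = (\<integral>\<^sup>+x. (\<integral>\<^sup>+y. P x y \<partial>lborel) + (\<integral>\<^sup>+y. P y x \<partial>lborel) \<partial>lborel)"
    by (intro nn_integral_cong nn_integral_add) measurable
  also have "\<dots> = (\<integral>\<^sup>+x. (\<integral>\<^sup>+y. P x y \<partial>lborel) \<partial>lborel) + (\<integral>\<^sup>+x. (\<integral>\<^sup>+y. P y x \<partial>lborel) \<partial>lborel)"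
    by (intro nn_integral_add lborel.borel_measurable_nn_integral) (simp_all add: case_prod_unfold)
  also have "\<dots> \<le> A * (\<integral>\<^sup>+x. ennreal ((v x)\<^sup>2 / 2) \<partial>lborel) + A * (\<integral>\<^sup>+x. ennreal ((v x)\<^sup>2 / 2) \<partial>lborel)"
    unfolding swap by (intro add_mono half)
  also have "\<dots> = A * ((\<integral>\<^sup>+x. ennreal ((v x)\<^sup>2 / 2) \<partial>lborel) + (\<integral>\<^sup>+x. ennreal ((v x)\<^sup>2 / 2) \<partial>lborel))"
    by (rule distrib_left[symmetric])
  also have "(\<integral>\<^sup>+x. ennreal ((v x)\<^sup>2 / 2) \<partial>lborel) + (\<integral>\<^sup>+x. ennreal ((v x)\<^sup>2 / 2) \<partial>lborel) = (\<integral>\<^sup>+x. ennreal ((v x)\<^sup>2) \<partial>lborel)"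
    by (subst nn_integral_add[symmetric]) (auto simp flip: ennreal_plus)
  finally show ?thesis .
qed

section \<open>The Fourier transform of a bounded function on \<open>X\<close>\<close>

locale bounded_support =
  fixes u :: "real^'n \<Rightarrow> complex" and X :: "(real^'n) set" and B :: real
  assumes u[measurable]: "u \<in> borel_measurable borel" and X[measurable]: "X \<in> sets borel"
    and fin: "emeasure lborel X < \<infinity>" and bnd: "\<And>x. norm (u x) \<le> B" and u0: "\<And>x. x \<notin> X \<Longrightarrow> u x = 0"
begin

text \<open>The transpose of the extension operator applied to \<open>u\<close>, in the sense of
  \<open>duality\<close>.\<close>

definition G :: "real^'n \<Rightarrow> complex" where
  "G \<xi> = (\<integral>x. chi (x \<bullet> \<xi>) * u x \<partial>lborel)"

lemma B_nonneg: "0 \<le> B"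
  using bnd order_trans[OF norm_ge_zero] by blast

lemma G_measurable [measurable]: "G \<in> borel_measurable borel"
  unfolding G_def[abs_def] by measurable

lemma u_integrable: "integrable lborel u"
  by (rule integrableI_bounded_set[where A=X and B=B]) (use fin bnd u0 in auto)

lemma norm_G_le: "norm (G \<xi>) \<le> (\<integral>x. norm (u x) \<partial>lborel)"
  unfolding G_def using integral_norm_bound[of lborel "\<lambda>x. chi (x \<bullet> \<xi>) * u x"] by (simp add: norm_mult)

text \<open>Expanding the square gives the double integral of \<open>u x * cnj (u y)\<close> times
  the Fourier transform of \<open>\<mu>\<close> at \<open>x - y\<close>, whose norm is majorized by
  \<open>k\<close>.\<close>

lemma nn_integral_G_le:
  assumes \<mu>: "finite_measure \<mu>" "sets \<mu> = sets borel"
    and [measurable]: "k \<in> borel_measurable borel" and k: "\<And>z. norm (\<integral>\<xi>. chi (z \<bullet> \<xi>) \<partial>\<mu>) \<le> k z"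
  shows "(\<integral>\<^sup>+\<xi>. ennreal ((norm (G \<xi>))\<^sup>2) \<partial>\<mu>)
    \<le> (\<integral>\<^sup>+x. (\<integral>\<^sup>+y. ennreal (norm (u x) * norm (u y) * k (x - y)) \<partial>lborel) \<partial>lborel)"
proof -
  interpret \<mu>: finite_measure \<mu> by fact
  interpret P: pair_sigma_finite "lborel :: (real^'n) measure" \<mu> ..
  note [measurable_cong] = \<mu>(2)
  have [measurable]: "cnj \<in> borel_measurable borel"
    by (intro borel_measurable_continuous_onI continuous_intros)
  define U where "U = (\<integral>x. norm (u x) \<partial>lborel)"
  have U: "norm (G \<xi>) \<le> U" for \<xi> unfolding U_def by (rule norm_G_le)
  have spm: "emeasure \<mu> (space \<mu>) < \<infinity>" using \<mu>.emeasure_finite by (simp add: less_top[symmetric])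
  have finX: "emeasure (lborel \<Otimes>\<^sub>M \<mu>) (X \<times> space \<mu>) < \<infinity>"
    using fin spm by (subst \<mu>.emeasure_pair_measure_Times) (auto simp: ennreal_mult_less_top)
  \<comment> \<open>Serves both exchanges of integrals below, with \<open>g\<close> a character and
    with \<open>g\<close> a character times \<open>cnj (G \<xi>)\<close>.\<close>
  have int: "integrable (lborel \<Otimes>\<^sub>M \<mu>) (\<lambda>(x, \<xi>). w x * g x \<xi>)"
    if [measurable]: "w \<in> borel_measurable borel" "(\<lambda>p. g (fst p) (snd p)) \<in> borel_measurable (lborel \<Otimes>\<^sub>M \<mu>)"
      and w: "\<And>x. norm (w x) \<le> B" "\<And>x. x \<notin> X \<Longrightarrow> w x = 0" and g: "\<And>x \<xi>. norm (g x \<xi>) \<le> D"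
    for w :: "real^'n \<Rightarrow> complex" and g :: "real^'n \<Rightarrow> real^'n \<Rightarrow> complex" and D
  proof (rule integrableI_bounded_set[where A="X \<times> space \<mu>" and B="B * D"])
    show "X \<times> space \<mu> \<in> sets (lborel \<Otimes>\<^sub>M \<mu>)" by measurable
    show "(\<lambda>(x, \<xi>). w x * g x \<xi>) \<in> borel_measurable (lborel \<Otimes>\<^sub>M \<mu>)"
      unfolding case_prod_unfold by measurable
    show "AE p in lborel \<Otimes>\<^sub>M \<mu>. p \<in> X \<times> space \<mu> \<longrightarrow> norm (case p of (x, \<xi>) \<Rightarrow> w x * g x \<xi>) \<le> B * D"
      using w g B_nonneg by (intro AE_I2) (auto simp: norm_mult intro!: mult_mono)
    show "AE p in lborel \<Otimes>\<^sub>M \<mu>. p \<notin> X \<times> space \<mu> \<longrightarrow> (case p of (x, \<xi>) \<Rightarrow> w x * g x \<xi>) = 0"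
    proof (intro AE_I2 impI)
      fix p assume "p \<in> space (lborel \<Otimes>\<^sub>M \<mu>)" "p \<notin> X \<times> space \<mu>"
      then have "fst p \<notin> X" by (cases p) (simp add: space_pair_measure)
      then show "(case p of (x, \<xi>) \<Rightarrow> w x * g x \<xi>) = 0" by (simp add: case_prod_unfold w(2))
    qed
  qed (rule finX)
  \<comment> \<open>Introducing the integral over \<open>\<xi>\<close> as a function of
    \<open>x\<close> splits the rearrangement of a triple integral into two applications of
    Fubini.\<close>
  define H where "H = (\<lambda>x. \<integral>\<xi>. chi (x \<bullet> \<xi>) * cnj (G \<xi>) \<partial>\<mu>)"
  have H: "H x = (\<integral>y. cnj (u y) * (\<integral>\<xi>. chi ((x - y) \<bullet> \<xi>) \<partial>\<mu>) \<partial>lborel)" for x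
  proof -
    have "H x = (\<integral>\<xi>. (\<integral>y. cnj (u y) * chi ((x - y) \<bullet> \<xi>) \<partial>lborel) \<partial>\<mu>)"
      unfolding H_def
    proof (rule Bochner_Integration.integral_cong[OF refl])
      fix \<xi>
      have "chi (x \<bullet> \<xi>) * cnj (G \<xi>) = chi (x \<bullet> \<xi>) * (\<integral>y. cnj (chi (y \<bullet> \<xi>) * u y) \<partial>lborel)"
        unfolding G_def by (simp only: Bochner_Integration.integral_cnj)
      also have "\<dots> = (\<integral>y. chi (x \<bullet> \<xi>) * cnj (chi (y \<bullet> \<xi>) * u y) \<partial>lborel)"
        by simp
      also have "\<dots> = (\<integral>y. cnj (u y) * chi ((x - y) \<bullet> \<xi>) \<partial>lborel)"
        by (simp add: inner_diff_left chi_diff mult_ac)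
      finally show "chi (x \<bullet> \<xi>) * cnj (G \<xi>) = (\<integral>y. cnj (u y) * chi ((x - y) \<bullet> \<xi>) \<partial>lborel)" .
    qed
    also have "\<dots> = (\<integral>y. (\<integral>\<xi>. cnj (u y) * chi ((x - y) \<bullet> \<xi>) \<partial>\<mu>) \<partial>lborel)"
      by (rule P.Fubini_integral, rule int[where D=1]) (use bnd u0 in auto)
    finally show ?thesis by simp
  qed
  have Hb: "ennreal (norm (H x)) \<le> (\<integral>\<^sup>+y. ennreal (norm (u y) * k (x - y)) \<partial>lborel)" for x
  proof -
    have "ennreal (norm (H x)) \<le> (\<integral>\<^sup>+y. ennreal (norm (cnj (u y) * (\<integral>\<xi>. chi ((x - y) \<bullet> \<xi>) \<partial>\<mu>))) \<partial>lborel)"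
      unfolding H by (rule norm_integral_le_nn_integral)
    also have "\<dots> \<le> (\<integral>\<^sup>+y. ennreal (norm (u y) * k (x - y)) \<partial>lborel)"
      by (intro nn_integral_mono ennreal_leI) (simp add: norm_mult mult_left_mono k)
    finally show ?thesis .
  qed
  have intG: "integrable \<mu> (\<lambda>\<xi>. (norm (G \<xi>))\<^sup>2)"
    by (rule \<mu>.integrable_const_bound[where B="U\<^sup>2"]) (use U in \<open>auto intro!: AE_I2 power_mono\<close>)
  have "(\<integral>\<^sup>+\<xi>. ennreal ((norm (G \<xi>))\<^sup>2) \<partial>\<mu>) = ennreal (\<integral>\<xi>. (norm (G \<xi>))\<^sup>2 \<partial>\<mu>)"
    by (rule nn_integral_eq_integral[OF intG]) simp
  also have "(\<integral>\<xi>. (norm (G \<xi>))\<^sup>2 \<partial>\<mu>) = norm (complex_of_real (\<integral>\<xi>. (norm (G \<xi>))\<^sup>2 \<partial>\<mu>))"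
    by simp
  also have "complex_of_real (\<integral>\<xi>. (norm (G \<xi>))\<^sup>2 \<partial>\<mu>) = (\<integral>\<xi>. G \<xi> * cnj (G \<xi>) \<partial>\<mu>)"
    by (simp only: complex_norm_square integral_complex_of_real[symmetric])
  also have "\<dots> = (\<integral>\<xi>. (\<integral>x. u x * (chi (x \<bullet> \<xi>) * cnj (G \<xi>)) \<partial>lborel) \<partial>\<mu>)"
  proof (rule Bochner_Integration.integral_cong[OF refl])
    fix \<xi>
    have "G \<xi> * cnj (G \<xi>) = (\<integral>x. chi (x \<bullet> \<xi>) * u x * cnj (G \<xi>) \<partial>lborel)"
      by (subst (1) G_def) simp
    then show "G \<xi> * cnj (G \<xi>) = (\<integral>x. u x * (chi (x \<bullet> \<xi>) * cnj (G \<xi>)) \<partial>lborel)"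
      by (simp only: mult_ac)
  qed
  also have "\<dots> = (\<integral>x. (\<integral>\<xi>. u x * (chi (x \<bullet> \<xi>) * cnj (G \<xi>)) \<partial>\<mu>) \<partial>lborel)"
    by (rule P.Fubini_integral, rule int[where D=U]) (use bnd u0 U in \<open>auto simp: norm_mult\<close>)
  also have "\<dots> = (\<integral>x. u x * H x \<partial>lborel)" by (simp add: H_def)
  also have "ennreal (norm \<dots>) \<le> (\<integral>\<^sup>+x. ennreal (norm (u x * H x)) \<partial>lborel)"
    by (rule norm_integral_le_nn_integral)
  also have "\<dots> \<le> (\<integral>\<^sup>+x. (\<integral>\<^sup>+y. ennreal (norm (u x) * norm (u y) * k (x - y)) \<partial>lborel) \<partial>lborel)"
  proof (rule nn_integral_mono)
    fix x
    have "0 \<le> k z" for z using order_trans[OF norm_ge_zero k] .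
    then have "(\<integral>\<^sup>+y. ennreal (norm (u x) * norm (u y) * k (x - y)) \<partial>lborel)
        = (\<integral>\<^sup>+y. ennreal (norm (u x)) * ennreal (norm (u y) * k (x - y)) \<partial>lborel)"
      by (simp add: ennreal_mult mult.assoc)
    moreover have "ennreal (norm (u x)) * (\<integral>\<^sup>+y. ennreal (norm (u y) * k (x - y)) \<partial>lborel)
       \<le> (\<integral>\<^sup>+y. ennreal (norm (u x)) * ennreal (norm (u y) * k (x - y)) \<partial>lborel)"
      by (subst nn_integral_cmult) auto
    moreover have "ennreal (norm (u x * H x)) \<le> ennreal (norm (u x)) * (\<integral>\<^sup>+y. ennreal (norm (u y) * k (x - y)) \<partial>lborel)"
      using mult_left_mono[OF Hb[of x], of "ennreal (norm (u x))"] by (simp add: norm_mult ennreal_mult)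
    ultimately show "ennreal (norm (u x * H x)) \<le> (\<integral>\<^sup>+y. ennreal (norm (u x) * norm (u y) * k (x - y)) \<partial>lborel)"
      by simp
  qed
  finally show ?thesis .
qed

end

text \<open>Fubini. The surface measure lives on the subspace \<open>S\<close> and its sets are
  traces of Borel sets; \<open>id\<close> makes Borel functions on the whole space measurable for
  it.\<close>

lemma (in bounded_support) duality:
  assumes \<sigma>: "finite_measure \<sigma>" and id[measurable]: "(\<lambda>\<xi>. \<xi>) \<in> measurable \<sigma> borel"
    and f: "integrable \<sigma> f"
  shows "(\<integral>x. u x * (\<integral>\<xi>. chi (x \<bullet> \<xi>) * f \<xi> \<partial>\<sigma>) \<partial>lborel) = (\<integral>\<xi>. G \<xi> * f \<xi> \<partial>\<sigma>)"
proof -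
  interpret \<sigma>: finite_measure \<sigma> by fact
  interpret P: pair_sigma_finite "lborel :: (real^'n) measure" \<sigma> ..
  have [measurable]: "f \<in> borel_measurable \<sigma>" using f by auto
  have [measurable]: "snd \<in> borel_measurable (lborel \<Otimes>\<^sub>M \<sigma>)"
    using measurable_compose[OF measurable_snd id, of lborel] by simp
  have fx: "integrable \<sigma> (\<lambda>\<xi>. chi (x \<bullet> \<xi>) * f \<xi>)" for x
    by (rule Bochner_Integration.integrable_bound[OF f]) (auto simp: norm_mult)
  have int: "integrable (lborel \<Otimes>\<^sub>M \<sigma>) (\<lambda>(x, \<xi>). u x * (chi (x \<bullet> \<xi>) * f \<xi>))"
  proof (rule P.Fubini_integrable)
    show "(\<lambda>(x, \<xi>). u x * (chi (x \<bullet> \<xi>) * f \<xi>)) \<in> borel_measurable (lborel \<Otimes>\<^sub>M \<sigma>)"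
      unfolding case_prod_unfold by measurable
    show "integrable lborel (\<lambda>x. \<integral>\<xi>. norm (case (x, \<xi>) of (x, \<xi>) \<Rightarrow> u x * (chi (x \<bullet> \<xi>) * f \<xi>)) \<partial>\<sigma>)"
      using u_integrable by (simp add: norm_mult)
    show "AE x in lborel. integrable \<sigma> (\<lambda>\<xi>. case (x, \<xi>) of (x, \<xi>) \<Rightarrow> u x * (chi (x \<bullet> \<xi>) * f \<xi>))"
      using fx by (intro AE_I2) simp
  qed
  have "(\<integral>x. u x * (\<integral>\<xi>. chi (x \<bullet> \<xi>) * f \<xi> \<partial>\<sigma>) \<partial>lborel) = (\<integral>x. (\<integral>\<xi>. u x * (chi (x \<bullet> \<xi>) * f \<xi>) \<partial>\<sigma>) \<partial>lborel)"
    by simp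
  also have "\<dots> = (\<integral>\<xi>. (\<integral>x. u x * (chi (x \<bullet> \<xi>) * f \<xi>) \<partial>lborel) \<partial>\<sigma>)"
    by (rule P.Fubini_integral[OF int, symmetric])
  also have "\<dots> = (\<integral>\<xi>. G \<xi> * f \<xi> \<partial>\<sigma>)"
  proof (rule Bochner_Integration.integral_cong[OF refl])
    fix \<xi>
    have "(\<integral>x. u x * (chi (x \<bullet> \<xi>) * f \<xi>) \<partial>lborel) = (\<integral>x. (chi (x \<bullet> \<xi>) * u x) * f \<xi> \<partial>lborel)"
      by (simp only: mult_ac)
    also have "\<dots> = G \<xi> * f \<xi>" unfolding G_def by (rule Bochner_Integration.integral_mult_left_zero)
    finally show "(\<integral>x. u x * (chi (x \<bullet> \<xi>) * f \<xi>) \<partial>lborel) = G \<xi> * f \<xi>" .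
  qed
  finally show ?thesis .
qed

section \<open>From Fourier decay to the extension estimate\<close>

lemma decaying_measure_kernel:
  fixes \<mu> :: "(real^'n) measure"
  assumes "decaying_measure C \<mu>" "0 \<le> C"
  shows "norm (\<integral>\<xi>. chi (z \<bullet> \<xi>) \<partial>\<mu>) \<le> sqrt C * (1 + norm z) powr - ((real CARD('n) - 1) / 2)"
proof (rule power2_le_imp_le)
  have pm: "(1 / (1 + norm z)) ^ m = (1 + norm z) powr - real m" for m
    by (simp add: powr_minus powr_realpow power_one_over inverse_eq_divide add_pos_nonneg)
  have "(norm (\<integral>\<xi>. chi (z \<bullet> \<xi>) \<partial>\<mu>))\<^sup>2 \<le> C * (1 / (1 + norm z)) ^ (CARD('n) - 1)"
    using assms(1) by (simp add: decaying_measure_def chi_def)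
  also have "(1 / (1 + norm z)) ^ (CARD('n) - 1) = (1 + norm z) powr - real (CARD('n) - 1)"
    by (rule pm)
  also have "real (CARD('n) - 1) = (real CARD('n) - 1) / 2 + (real CARD('n) - 1) / 2"
    by (simp add: of_nat_diff)
  also have "(1 + norm z) powr - ((real CARD('n) - 1) / 2 + (real CARD('n) - 1) / 2) = ((1 + norm z) powr - ((real CARD('n) - 1) / 2))\<^sup>2"
    by (simp add: power2_eq_square powr_add[symmetric])
  also have "C * ((1 + norm z) powr - ((real CARD('n) - 1) / 2))\<^sup>2 = (sqrt C * (1 + norm z) powr - ((real CARD('n) - 1) / 2))\<^sup>2"
    using assms(2) by (simp add: power_mult_distrib)
  finally show "(norm (\<integral>\<xi>. chi (z \<bullet> \<xi>) \<partial>\<mu>))\<^sup>2 \<le> (sqrt C * (1 + norm z) powr - ((real CARD('n) - 1) / 2))\<^sup>2" .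
qed (use assms in simp)

text \<open>Absorbs the number of dyadic levels into the loss
  \<open>R powr \<epsilon>\<close>.\<close>

lemma log_le_powr:
  assumes "0 < \<epsilon>" "1 \<le> R"
  shows "log 2 R + 2 \<le> (2 + 1 / (\<epsilon> * ln 2)) * R powr \<epsilon>"
proof -
  have "log 2 R = ln R / ln 2" by (simp add: log_def)
  also have "\<dots> \<le> (R powr \<epsilon> / \<epsilon>) / ln 2" using assms by (intro divide_right_mono ln_powr_bound) auto
  finally have "log 2 R \<le> 1 / (\<epsilon> * ln 2) * R powr \<epsilon>" by simp
  moreover have "2 \<le> 2 * R powr \<epsilon>" using assms by (simp add: ge_one_powr_ge_zero)
  ultimately show ?thesis by (simp add: distrib_right)
qed

text \<open>Duality without dividing by norms: \<open>N\<close> is bounded by the pairing, hence by Young's inequality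
  by \<open>t F / 2 + a N / (2 t)\<close> for all \<open>t > 0\<close>.\<close>
lemma absorb:
  fixes N F a :: real
  assumes "0 \<le> N" "0 \<le> F" "0 \<le> a" and t: "\<And>t. 0 < t \<Longrightarrow> N \<le> t / 2 * F + a * N / (2 * t)"
  shows "N \<le> a * F"
proof (rule field_le_epsilon)
  fix e :: real assume e: "0 < e"
  define s where "s = a + e / (F + 1)"
  have s: "0 < s" using assms e by (simp add: s_def add_nonneg_pos)
  have "a * N / (2 * s) \<le> s * N / (2 * s)"
    using assms s e by (intro divide_right_mono mult_right_mono) (auto simp: s_def)
  also have "\<dots> = N / 2" using s by simp
  finally have "N / 2 \<le> s / 2 * F" using t[OF s] by linarith
  then have "N \<le> s * F" by simp
  also have "\<dots> = a * F + e * (F / (F + 1))" by (simp add: s_def distrib_right)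
  also have "\<dots> \<le> a * F + e * 1" using assms e by (intro add_left_mono mult_left_mono) auto
  finally show "N \<le> a * F + e" by simp
qed

text \<open>Let \<open>u\<close> be the conjugate of the extension of \<open>f\<close> on
  \<open>X\<close>. Pairing the extension with \<open>u\<close> gives its squared norm
  \<open>N\<close> on \<open>X\<close>, and by \<open>duality\<close> this equals the pairing of
  \<open>f\<close> with \<open>G\<close>. The dominating measures and the Schur test bound the
  squared norm of \<open>G\<close> by \<open>c * A * N\<close>, and \<open>absorb\<close> eliminates
  the \<open>N\<close> on the right.\<close>

lemma extension_L2_bound:
  fixes S :: "(real^'n) set"
  assumes n2: "2 \<le> CARD('n)" and S: "compact S" "smooth_hypersurface S" "nowhere_vanishing_gaussian_curvature S"
  shows "\<exists>c\<ge>0. \<forall>X A f. X \<in> sets borel \<longrightarrow> bounded X \<longrightarrow> 0 \<le> A \<longrightarrow>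
    (\<forall>x\<in>X. (\<integral>\<^sup>+y. ennreal ((1 + norm (x - y)) powr - ((real CARD('n) - 1) / 2)) * indicator X y \<partial>lborel) \<le> ennreal A) \<longrightarrow>
    f \<in> L2_space (surface_measure S) \<longrightarrow>
    extension_operator S f \<in> L2_space (restrict_space lborel X) \<and>
    L2_norm (restrict_space lborel X) (extension_operator S f) \<le> sqrt (c * A) * L2_norm (surface_measure S) f"
proof -
  define \<beta> where "\<beta> = (real CARD('n) - 1) / 2"
  define \<sigma> where "\<sigma> = surface_measure S"
  obtain T and \<mu> :: "real^'n \<Rightarrow> (real^'n) measure" and C where T: "finite (T :: (real^'n) set)" "0 \<le> C"
      "\<And>p. p \<in> T \<Longrightarrow> decaying_measure C (\<mu> p)"
    and le: "\<And>F. F \<in> borel_measurable borel \<Longrightarrow> (\<integral>\<^sup>+\<xi>. F \<xi> \<partial>\<sigma>) \<le> (\<Sum>p\<in>T. \<integral>\<^sup>+\<xi>. F \<xi> \<partial>\<mu> p)"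
    unfolding \<sigma>_def using nn_integral_surface_le[OF n2 S] by metis
  have \<mu>: "finite_measure (\<mu> p)" "sets (\<mu> p) = sets borel" if "p \<in> T" for p
    using T(3)[OF that] by (auto simp: decaying_measure_def)
  have fin\<sigma>: "finite_measure \<sigma>"
  proof (rule finite_measureI)
    have "emeasure \<sigma> (space \<sigma>) = (\<integral>\<^sup>+\<xi>. 1 \<partial>\<sigma>)" by simp
    also have "\<dots> \<le> (\<Sum>p\<in>T. \<integral>\<^sup>+\<xi>. 1 \<partial>\<mu> p)" by (rule le) simp
    also have "\<dots> < \<infinity>"
      using \<mu>(1) T(1) by (auto simp: finite_measure.emeasure_finite less_top[symmetric])
    finally show "emeasure \<sigma> (space \<sigma>) \<noteq> \<infinity>" by simp
  qed
  interpret \<sigma>: finite_measure \<sigma> by (rule fin\<sigma>)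
  have id: "(\<lambda>\<xi>. \<xi>) \<in> measurable \<sigma> borel"
    unfolding \<sigma>_def surface_measure_def by (intro measurable_restrict_space1) (simp add: measurable_def)
  define c where "c = real (card T) * sqrt C"
  have c: "0 \<le> c" using T(2) by (simp add: c_def)
  have "extension_operator S f \<in> L2_space (restrict_space lborel X) \<and>
    L2_norm (restrict_space lborel X) (extension_operator S f) \<le> sqrt (c * A) * L2_norm \<sigma> f"
    if X[measurable]: "X \<in> sets borel" and bX: "bounded X" and A: "0 \<le> A"
      and kA: "\<forall>x\<in>X. (\<integral>\<^sup>+y. ennreal ((1 + norm (x - y)) powr - \<beta>) * indicator X y \<partial>lborel) \<le> ennreal A"
      and f: "f \<in> L2_space \<sigma>" for X A f
  proof -
    have fm[measurable]: "f \<in> borel_measurable \<sigma>" and f2: "integrable \<sigma> (\<lambda>\<xi>. (norm (f \<xi>))\<^sup>2)"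
      using f by (auto simp: L2_space_def)
    \<comment> \<open>The surface measure is finite, so \<open>a \<le> 1 + a^2\<close> turns square
      integrability into integrability.\<close>
    have fi: "integrable \<sigma> f"
    proof (rule Bochner_Integration.integrable_bound[of _ "\<lambda>\<xi>. 1 + (norm (f \<xi>))\<^sup>2"])
      show "integrable \<sigma> (\<lambda>\<xi>. 1 + (norm (f \<xi>))\<^sup>2)" using f2 by simp
      have "a \<le> 1 + a\<^sup>2" for a :: real
      proof -
        have "2 * a \<le> a\<^sup>2 + 1" using sum_squares_bound[of a 1] by simp
        moreover have "0 \<le> a\<^sup>2" by simp
        ultimately show ?thesis by linarith
      qed
      then show "AE \<xi> in \<sigma>. norm (f \<xi>) \<le> norm (1 + (norm (f \<xi>))\<^sup>2)" by (intro AE_I2) simp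
    qed simp
    define g where "g = extension_operator S f"
    have g: "g x = (\<integral>\<xi>. chi (x \<bullet> \<xi>) * f \<xi> \<partial>\<sigma>)" for x
      by (simp add: g_def extension_operator_def chi_def \<sigma>_def)
    have snd[measurable]: "snd \<in> borel_measurable (borel \<Otimes>\<^sub>M \<sigma>)"
      using measurable_compose[OF measurable_snd id, of borel] by simp
    have gm[measurable]: "g \<in> borel_measurable borel"
      unfolding g[abs_def] by (rule \<sigma>.borel_measurable_lebesgue_integral) (simp add: case_prod_unfold)
    define B where "B = (\<integral>\<xi>. norm (f \<xi>) \<partial>\<sigma>)"
    have gB: "norm (g x) \<le> B" for x
      unfolding g B_def using integral_norm_bound[of \<sigma> "\<lambda>\<xi>. chi (x \<bullet> \<xi>) * f \<xi>"] by (simp add: norm_mult)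
    have B: "0 \<le> B" by (simp add: B_def)
    have finX: "emeasure lborel X < \<infinity>" by (rule emeasure_bounded_finite[OF bX])
    define u where "u = (\<lambda>x. if x \<in> X then cnj (g x) else 0)"
    have [measurable]: "cnj \<in> borel_measurable borel"
      by (intro borel_measurable_continuous_onI continuous_intros)
    interpret bounded_support u X B
    proof
      show "u \<in> borel_measurable borel" unfolding u_def by measurable
    qed (use finX gB B in \<open>auto simp: u_def\<close>)
    have ug: "u x * g x = complex_of_real ((norm (u x))\<^sup>2)" for x
      using complex_norm_square[of "g x"] by (simp add: u_def mult.commute)
    have u2: "integrable lborel (\<lambda>x. (norm (u x))\<^sup>2)"
      by (rule integrableI_bounded_set[where A=X and B="B\<^sup>2"])
         (use finX bnd u0 in \<open>auto intro!: AE_I2 power_mono\<close>)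
    define N where "N = (\<integral>x. (norm (u x))\<^sup>2 \<partial>lborel)"
    define F where "F = (\<integral>\<xi>. (norm (f \<xi>))\<^sup>2 \<partial>\<sigma>)"
    define Q where "Q = (\<integral>\<xi>. (norm (G \<xi>))\<^sup>2 \<partial>\<sigma>)"
    have nn: "0 \<le> N" "0 \<le> F" "0 \<le> Q" by (simp_all add: N_def F_def Q_def)
    have Gm\<sigma>[measurable]: "G \<in> borel_measurable \<sigma>"
      using measurable_compose[OF id G_measurable] by simp
    define W where "W = (\<integral>x. norm (u x) \<partial>lborel)"
    have GW: "norm (G \<xi>) \<le> W" for \<xi> unfolding W_def by (rule norm_G_le)
    have G2: "integrable \<sigma> (\<lambda>\<xi>. (norm (G \<xi>))\<^sup>2)"
      by (rule \<sigma>.integrable_const_bound[where B="W\<^sup>2"]) (use GW in \<open>auto intro!: AE_I2 power_mono\<close>)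
    have "complex_of_real N = (\<integral>x. u x * g x \<partial>lborel)"
      unfolding N_def ug by (rule integral_complex_of_real[symmetric])
    also have "\<dots> = (\<integral>\<xi>. G \<xi> * f \<xi> \<partial>\<sigma>)"
      unfolding g by (rule duality[OF fin\<sigma> id fi])
    finally have "N = norm (\<integral>\<xi>. G \<xi> * f \<xi> \<partial>\<sigma>)" using nn(1) by (metis norm_of_real abs_of_nonneg)
    then have NG: "N \<le> (\<integral>\<xi>. norm (G \<xi> * f \<xi>) \<partial>\<sigma>)" using integral_norm_bound by simp
    have Gf: "integrable \<sigma> (\<lambda>\<xi>. norm (G \<xi> * f \<xi>))"
      by (rule Bochner_Integration.integrable_bound[of _ "\<lambda>\<xi>. W * norm (f \<xi>)"])
         (use fi GW in \<open>auto simp: norm_mult intro!: AE_I2 mult_right_mono order_trans[OF _ abs_ge_self]\<close>)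
    define k where "k = (\<lambda>z::real^'n. sqrt C * (1 + norm z) powr - \<beta>)"
    have [measurable]: "k \<in> borel_measurable borel" unfolding k_def by measurable
    have schur: "(\<integral>\<^sup>+x. (\<integral>\<^sup>+y. ennreal (norm (u x) * norm (u y) * k (x - y)) \<partial>lborel) \<partial>lborel)
        \<le> ennreal (sqrt C * A) * (\<integral>\<^sup>+x. ennreal ((norm (u x))\<^sup>2) \<partial>lborel)"
    proof (rule schur_test[where X=X])
      fix x assume x: "x \<in> X"
      have "(\<integral>\<^sup>+y. ennreal (k (x - y)) * indicator X y \<partial>lborel)
         = (\<integral>\<^sup>+y. ennreal (sqrt C) * (ennreal ((1 + norm (x - y)) powr - \<beta>) * indicator X y) \<partial>lborel)"
        using T(2) by (simp add: k_def ennreal_mult mult.assoc)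
      also have "\<dots> = ennreal (sqrt C) * (\<integral>\<^sup>+y. ennreal ((1 + norm (x - y)) powr - \<beta>) * indicator X y \<partial>lborel)"
        by (rule nn_integral_cmult) measurable
      also have "\<dots> \<le> ennreal (sqrt C) * ennreal A" using kA x by (intro mult_left_mono) auto
      also have "\<dots> = ennreal (sqrt C * A)" using T(2) A by (simp add: ennreal_mult)
      finally show "(\<integral>\<^sup>+y. ennreal (k (x - y)) * indicator X y \<partial>lborel) \<le> ennreal (sqrt C * A)" .
    qed (use u0 T(2) in \<open>auto simp: k_def\<close>)
    also have "(\<integral>\<^sup>+x. ennreal ((norm (u x))\<^sup>2) \<partial>lborel) = ennreal N"
      unfolding N_def by (rule nn_integral_eq_integral[OF u2]) simp
    finally have schur': "(\<integral>\<^sup>+x. (\<integral>\<^sup>+y. ennreal (norm (u x) * norm (u y) * k (x - y)) \<partial>lborel) \<partial>lborel)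
        \<le> ennreal (sqrt C * A * N)" using T(2) A nn by (simp add: ennreal_mult)
    have "ennreal Q = (\<integral>\<^sup>+\<xi>. ennreal ((norm (G \<xi>))\<^sup>2) \<partial>\<sigma>)"
      unfolding Q_def by (rule nn_integral_eq_integral[OF G2, symmetric]) simp
    also have "\<dots> \<le> (\<Sum>p\<in>T. \<integral>\<^sup>+\<xi>. ennreal ((norm (G \<xi>))\<^sup>2) \<partial>\<mu> p)"
      by (rule le) measurable
    also have "\<dots> \<le> (\<Sum>p\<in>T. ennreal (sqrt C * A * N))"
    proof (rule sum_mono)
      fix p assume p: "p \<in> T"
      show "(\<integral>\<^sup>+\<xi>. ennreal ((norm (G \<xi>))\<^sup>2) \<partial>\<mu> p) \<le> ennreal (sqrt C * A * N)"
        by (rule order_trans[OF nn_integral_G_le[OF \<mu>[OF p], of k] schur'])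
           (simp_all add: k_def \<beta>_def decaying_measure_kernel[OF T(3)[OF p] T(2)])
    qed
    also have "\<dots> = ennreal (c * A * N)"
      using T(2) A nn by (simp add: c_def ennreal_mult ennreal_of_nat_eq_real_of_nat mult.assoc)
    finally have QN: "Q \<le> c * A * N" using c A nn by (subst (asm) ennreal_le_iff) auto
    have "N \<le> (c * A) * F"
    proof (rule absorb)
      fix t :: real assume t: "0 < t"
      have young: "a * b \<le> b\<^sup>2 * (t / 2) + a\<^sup>2 * (1 / (2 * t))" for a b :: real
      proof -
        have "0 \<le> (t * b - a)\<^sup>2" by simp
        then have "2 * t * (a * b) \<le> t\<^sup>2 * b\<^sup>2 + a\<^sup>2" by (simp add: power2_diff power_mult_distrib mult_ac)
        then have "(2 * t * (a * b)) / (2 * t) \<le> (t\<^sup>2 * b\<^sup>2 + a\<^sup>2) / (2 * t)" using t by (intro divide_right_mono) auto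
        then show ?thesis using t by (simp add: add_divide_distrib power2_eq_square mult_ac)
      qed
      have "N \<le> (\<integral>\<xi>. norm (G \<xi> * f \<xi>) \<partial>\<sigma>)" by (rule NG)
      also have "\<dots> \<le> (\<integral>\<xi>. (norm (f \<xi>))\<^sup>2 * (t / 2) + (norm (G \<xi>))\<^sup>2 * (1 / (2 * t)) \<partial>\<sigma>)"
        by (rule integral_mono[OF Gf]) (use f2 G2 young in \<open>auto simp: norm_mult\<close>)
      also have "\<dots> = F * (t / 2) + Q * (1 / (2 * t))"
        using f2 G2 by (simp add: F_def Q_def)
      also have "\<dots> \<le> F * (t / 2) + (c * A * N) * (1 / (2 * t))"
        using QN t by (intro add_left_mono mult_right_mono) auto
      finally show "N \<le> t / 2 * F + c * A * N / (2 * t)" by (simp add: mult.commute)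
    qed (use nn c A in auto)
    have ind: "indicator X x *\<^sub>R (norm (g x))\<^sup>2 = (norm (u x))\<^sup>2" for x
      by (simp add: u_def indicator_def)
    have "g \<in> L2_space (restrict_space lborel X)"
      unfolding L2_space_def using gm u2
      by (auto intro: measurable_restrict_space1 simp: integrable_restrict_space ind[simplified real_scaleR_def] ind)
    moreover have "(\<integral>x. (norm (g x))\<^sup>2 \<partial>restrict_space lborel X) = (\<integral>x. indicator X x *\<^sub>R (norm (g x))\<^sup>2 \<partial>lborel)"
      by (rule integral_restrict_space) simp
    then have "L2_norm (restrict_space lborel X) g = sqrt N"
      unfolding L2_norm_def N_def ind by (rule arg_cong)
    moreover have "sqrt N \<le> sqrt (c * A) * L2_norm \<sigma> f"
      unfolding L2_norm_def F_def[symmetric] real_sqrt_mult[symmetric] using \<open>N \<le> (c * A) * F\<close> by (rule real_sqrt_le_mono)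
    ultimately show ?thesis unfolding g_def by simp
  qed
  then show ?thesis unfolding \<sigma>_def \<beta>_def using c by blast
qed

theorem corollary4p1:
  fixes S :: "(real^'n) set" and \<alpha> :: real
  assumes "2 \<le> CARD('n)"
    and "0 < \<alpha>" and "\<alpha> \<le> real CARD('n) / 2"
    and "compact S" and "smooth_hypersurface S"
    and "nowhere_vanishing_gaussian_curvature S"
  shows "\<forall>\<epsilon>>0. \<exists>C\<^sub>\<epsilon>>0. \<forall>R\<ge>1. \<forall>\<B> X \<gamma> f.
    \<B> \<subseteq> lattice_unit_cubes \<and> X = \<Union>\<B> \<and> X \<subseteq> cube 0 R \<and>
    \<gamma> = cube_density \<B> \<alpha> R \<and> f \<in> L2_space (surface_measure S) \<longrightarrow>
      extension_operator S f \<in> L2_space (restrict_space lborel X) \<and>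
      L2_norm (restrict_space lborel X) (extension_operator S f)
        \<le> C\<^sub>\<epsilon> * R powr \<epsilon> * \<gamma> powr (1/2) * R powr restriction_exponent (real CARD('n)) \<alpha>
            * L2_norm (surface_measure S) f"
proof (intro allI impI)
  fix \<epsilon> :: real assume \<epsilon>: "0 < \<epsilon>"
  define \<beta> where "\<beta> = (real CARD('n) - 1) / 2"
  have \<beta>: "0 \<le> \<beta>" using assms(1) by (simp add: \<beta>_def)
  define e where "e = restriction_exponent (real CARD('n)) \<alpha>"
  \<comment> \<open>\<open>A\<close> enters the final bound under a square root, so the exponent of
    \<open>R\<close> from the kernel is twice \<open>e\<close>.\<close>
  have e: "max 0 (\<alpha> - \<beta>) = e + e" by (auto simp: e_def restriction_exponent_def \<beta>_def max_def field_simps)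
  obtain c where c: "0 \<le> c" and main: "\<And>X A f. X \<in> sets borel \<Longrightarrow> bounded X \<Longrightarrow> 0 \<le> A \<Longrightarrow>
    (\<forall>x\<in>X. (\<integral>\<^sup>+y. ennreal ((1 + norm (x - y)) powr - \<beta>) * indicator X y \<partial>lborel) \<le> ennreal A) \<Longrightarrow>
    f \<in> L2_space (surface_measure S) \<Longrightarrow>
    extension_operator S f \<in> L2_space (restrict_space lborel X) \<and>
    L2_norm (restrict_space lborel X) (extension_operator S f) \<le> sqrt (c * A) * L2_norm (surface_measure S) f"
    unfolding \<beta>_def using extension_L2_bound[OF assms(1,4-6)] by blast
  \<comment> \<open>Collects the factors that do not depend on \<open>R\<close> and
    \<open>\<gamma>\<close>. The logarithm is bounded with \<open>2 * \<epsilon>\<close> because the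
    square root halves the exponent.\<close>
  define C1 where "C1 = 2 powr (\<alpha> + \<beta>) * (2 + 1 / (2 * \<epsilon> * ln 2)) * 2 powr (e + e)"
  have C1: "0 \<le> C1" using \<epsilon> by (simp add: C1_def)
  have bound: "extension_operator S f \<in> L2_space (restrict_space lborel X) \<and>
      L2_norm (restrict_space lborel X) (extension_operator S f)
        \<le> (sqrt (c * C1) + 1) * R powr \<epsilon> * \<gamma> powr (1/2) * R powr e * L2_norm (surface_measure S) f"
    if R: "1 \<le> R" and \<B>: "\<B> \<subseteq> lattice_unit_cubes" and X: "X = \<Union>\<B>" "X \<subseteq> cube 0 R"
      and \<gamma>: "\<gamma> = cube_density \<B> \<alpha> R" and f: "f \<in> L2_space (surface_measure S)" for R \<B> X \<gamma> f
  proof -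
    have \<B>X: "\<Union>\<B> \<subseteq> cube 0 R" using X by simp
    have \<gamma>0: "0 \<le> \<gamma>" unfolding \<gamma> by (rule cube_density_nonneg[OF \<B> \<B>X assms(2) R])
    have Xb: "X \<in> sets borel"
      unfolding X using finite_lattice_cubes[OF \<B> \<B>X] lattice_cube_facts(1) \<B> by (intro sets.finite_Union) auto
    have bX: "bounded X" using X(2) compact_cube by (meson bounded_subset compact_imp_bounded)
    define A where "A = C1 * R powr (2 * \<epsilon>) * \<gamma> * R powr (e + e)"
    have A: "0 \<le> A" using C1 \<gamma>0 by (simp add: A_def)
    have "2 powr (\<alpha> + \<beta>) * \<gamma> * (log 2 R + 2) * (2 * R) powr max 0 (\<alpha> - \<beta>)
       \<le> 2 powr (\<alpha> + \<beta>) * \<gamma> * ((2 + 1 / (2 * \<epsilon> * ln 2)) * R powr (2 * \<epsilon>)) * (2 * R) powr max 0 (\<alpha> - \<beta>)"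
      using \<gamma>0 log_le_powr[of "2 * \<epsilon>" R] \<epsilon> R by (intro mult_right_mono mult_left_mono) auto
    also have "\<dots> = A"
      using R by (simp add: A_def C1_def e powr_mult mult_ac)
    finally have leA: "2 powr (\<alpha> + \<beta>) * \<gamma> * (log 2 R + 2) * (2 * R) powr max 0 (\<alpha> - \<beta>) \<le> A" .
    have "(\<integral>\<^sup>+y. ennreal ((1 + norm (x - y)) powr - \<beta>) * indicator X y \<partial>lborel) \<le> ennreal A" if "x \<in> X" for x
      unfolding X(1) using kernel_integral_bound[OF \<B> \<B>X assms(2) R \<beta>, of x] that X(2) ennreal_leI[OF leA]
      unfolding \<gamma> by (auto intro: order_trans)
    from main[OF Xb bX A _ f] this
    have *: "extension_operator S f \<in> L2_space (restrict_space lborel X)"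
      "L2_norm (restrict_space lborel X) (extension_operator S f) \<le> sqrt (c * A) * L2_norm (surface_measure S) f"
      by auto
    have "c * A = (c * C1) * (R powr \<epsilon>)\<^sup>2 * \<gamma> * (R powr e)\<^sup>2"
      by (simp add: A_def power2_eq_square powr_add[symmetric] mult_ac)
    then have "sqrt (c * A) = sqrt (c * C1) * R powr \<epsilon> * \<gamma> powr (1/2) * R powr e"
      using \<gamma>0 by (simp only: real_sqrt_mult real_sqrt_abs powr_half_sqrt abs_of_nonneg powr_ge_zero)
    \<comment> \<open>The summand 1 keeps the constant positive even when \<open>c * C1\<close> is
      0.\<close>
    also have "\<dots> \<le> (sqrt (c * C1) + 1) * R powr \<epsilon> * \<gamma> powr (1/2) * R powr e"
      by (intro mult_right_mono) auto
    finally have "sqrt (c * A) * L2_norm (surface_measure S) f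
       \<le> (sqrt (c * C1) + 1) * R powr \<epsilon> * \<gamma> powr (1/2) * R powr e * L2_norm (surface_measure S) f"
      by (rule mult_right_mono) (simp add: L2_norm_def)
    with * show ?thesis by linarith
  qed
  have "0 < sqrt (c * C1) + 1" using c C1 by (simp add: add_nonneg_pos)
  then show "\<exists>C\<^sub>\<epsilon>>0. \<forall>R\<ge>1. \<forall>\<B> X \<gamma> f.
    \<B> \<subseteq> lattice_unit_cubes \<and> X = \<Union>\<B> \<and> X \<subseteq> cube 0 R \<and>
    \<gamma> = cube_density \<B> \<alpha> R \<and> f \<in> L2_space (surface_measure S) \<longrightarrow>
      extension_operator S f \<in> L2_space (restrict_space lborel X) \<and>
      L2_norm (restrict_space lborel X) (extension_operator S f)
        \<le> C\<^sub>\<epsilon> * R powr \<epsilon> * \<gamma> powr (1/2) * R powr restriction_exponent (real CARD('n)) \<alpha>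
            * L2_norm (surface_measure S) f"
    using bound unfolding e_def by blast
qed

end
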